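(* Let $Q\subset\mathbb{Z}^d$ be a pointed affine semigroup, $\mathfrak m$ the maximal monomial ideal of $\Bbbk[Q]$, and $M$ a finitely generated $\mathbb{Z}^d$-graded $\Bbbk[Q]$-module. Then for every $i$ the multigraded Hilbert series $\sum_{\mathbf a\in\mathbb{Z}^d}\dim_{\Bbbk}\big(H^i_{\mathfrak m}(M)\big)_{\mathbf a}\,\mathbf t^{\mathbf a}$ of the local cohomology module $H^i_{\mathfrak m}(M)$ can be expressed as a finite formal sum of rational functions.
   Context: $\Bbbk$ is an infinite field. An affine semigroup is a finitely generated submonoid $Q$ of $\mathbb{Z}^d$, and $\Bbbk[Q]$ is its semigroup ring. $Q$ is pointed if the cone $\mathbb{R}_{\ge0}Q$ has the origin as its unique zero-dimensional face. $\mathbf t^{\mathbf a}=t_1^{a_1}\cdots t_d^{a_d}$. "Formal sum of rational functions" means a sum of finitely many formal series in $t_1^{\pm1},\dots,t_d^{\pm1}$, each of which is the expansion of a rational function as a series supported in a translate of a pointed cone (possibly different cones for different summands); the sum is taken as a sum of formal series, not as a sum in the field of rational functions (where, for instance, $\frac{1}{1-x}+\frac{x^{-1}}{1-x^{-1}}=0$ while the sum of the corresponding formal series is $\sum_{i\in\mathbb{Z}}x^i$). *)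

theory Defs
  imports
    "HOL-Analysis.Polytope"
    "HOL-Analysis.Finite_Cartesian_Product"
    "HOL-Library.Poly_Mapping"
    "HOL-Algebra.Module"
    "HOL-Algebra.Ideal_Product"
begin

section \<open>Affine semigroups and cones\<close>

definition additive_submonoid :: "'a::comm_monoid_add set \<Rightarrow> bool" where
  "additive_submonoid S \<longleftrightarrow> 0 \<in> S \<and> (\<forall>x\<in>S. \<forall>y\<in>S. x + y \<in> S)"

definition affine_semigroup :: "(int ^ 'd) set \<Rightarrow> bool" where
  "affine_semigroup Q \<longleftrightarrow>
     additive_submonoid Q \<and> (\<exists>G. finite G \<and> Q = additive_submonoid hull G)"

definition real_vec :: "int ^ 'd \<Rightarrow> real ^ 'd" where
  "real_vec a = (\<chi> i. real_of_int (a $ i))"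

definition real_cone :: "(int ^ 'd) set \<Rightarrow> (real ^ 'd) set" where
  "real_cone A = convex_cone hull (real_vec ` A)"

text \<open>The origin is the unique zero-dimensional face.\<close>

definition pointed_cone :: "(real ^ 'd) set \<Rightarrow> bool" where
  "pointed_cone C \<longleftrightarrow> {F. F face_of C \<and> aff_dim F = 0} = {{0}}"

definition pointed :: "(int ^ 'd) set \<Rightarrow> bool" where
  "pointed Q \<longleftrightarrow> pointed_cone (real_cone Q)"


section \<open>Semigroup rings\<close>

text \<open>
  \<open>(int ^ 'd) \<Rightarrow>\<^sub>0 'k\<close> with its convolution product is the Laurent polynomial ring in
  \<open>d\<close> variables; the monomial \<open>c t\<^sup>a\<close> is \<open>Poly_Mapping.single a c\<close>.
\<close>

type_synonym ('k, 'd) laurent = "(int ^ 'd) \<Rightarrow>\<^sub>0 'k"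

definition semigroup_ring :: "(int ^ 'd) set \<Rightarrow> ('k::field, 'd) laurent ring" where
  "semigroup_ring Q =
     \<lparr> carrier = {f. Poly_Mapping.keys f \<subseteq> Q}, mult = (*), one = 1, zero = 0, add = (+) \<rparr>"

text \<open>The ideal spanned by all monomials that are not units, i.e. the largest proper
  monomial ideal. For pointed \<open>Q\<close> only \<open>a = 0\<close> is excluded.\<close>

definition max_monomial_ideal :: "(int ^ 'd) set \<Rightarrow> ('k::field, 'd) laurent set" where
  "max_monomial_ideal Q = {f. Poly_Mapping.keys f \<subseteq> {a \<in> Q. - a \<notin> Q}}"


section \<open>Graded modules\<close>

record ('r, 'm, 'g) gmodule = "('r, 'm) module" +
  component :: "'g \<Rightarrow> 'm set"

type_synonym ('k, 'd, 'm) zd_module = "(('k, 'd) laurent, 'm, int ^ 'd) gmodule"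

locale graded_module = module "semigroup_ring Q" M
  for Q :: "(int ^ 'd) set" and M :: "('k::field, 'd, 'm) zd_module" +
  assumes component_subgroup: "additive_subgroup (component M a) M"
    and component_decomposition:
      "x \<in> carrier M \<Longrightarrow>
         \<exists>!c. (\<forall>a. c a \<in> component M a) \<and> finite {a. c a \<noteq> \<zero>\<^bsub>M\<^esub>} \<and>
              x = (\<Oplus>\<^bsub>M\<^esub>a\<in>{a. c a \<noteq> \<zero>\<^bsub>M\<^esub>}. c a)"
    and smult_component:
      "b \<in> Q \<Longrightarrow> x \<in> component M a \<Longrightarrow>
         Poly_Mapping.single b r \<odot>\<^bsub>M\<^esub> x \<in> component M (b + a)"

definition finitely_generated ::
    "('r, 'b) ring_scheme \<Rightarrow> ('r, 'm, 'c) module_scheme \<Rightarrow> bool" where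
  "finitely_generated R M \<longleftrightarrow>
     (\<exists>G. finite G \<and> G \<subseteq> carrier M \<and>
        (\<forall>x\<in>carrier M. \<exists>c\<in>G \<rightarrow> carrier R. x = (\<Oplus>\<^bsub>M\<^esub>g\<in>G. c g \<odot>\<^bsub>M\<^esub> g)))"

text \<open>Homogeneous homomorphisms of degree \<open>0\<close>.\<close>

definition graded_hom ::
    "(int ^ 'd) set \<Rightarrow> ('k::field, 'd, 'm) zd_module \<Rightarrow> ('k, 'd, 'n) zd_module \<Rightarrow> ('m \<Rightarrow> 'n) set"
  where
  "graded_hom Q M N =
     {h. h \<in> carrier M \<rightarrow> carrier N \<and>
         (\<forall>x\<in>carrier M. \<forall>y\<in>carrier M. h (x \<oplus>\<^bsub>M\<^esub> y) = h x \<oplus>\<^bsub>N\<^esub> h y) \<and>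
         (\<forall>r\<in>carrier (semigroup_ring Q). \<forall>x\<in>carrier M. h (r \<odot>\<^bsub>M\<^esub> x) = r \<odot>\<^bsub>N\<^esub> h x) \<and>
         (\<forall>a. h ` component M a \<subseteq> component N a)}"


section \<open>Injective resolutions and local cohomology\<close>

text \<open>
  Injective objects of the category of graded modules. A formula cannot quantify over types, so
  the test modules \<open>A\<close>, \<open>B\<close> are the graded modules (with arbitrary operations) whose elements
  are drawn from the type of Laurent polynomials. This includes \<open>k[Q]\<close>, its graded
  ideals and all their degree shifts, so by the graded version of Baer's criterion the bound on
  the size of \<open>A\<close> and \<open>B\<close> does not change the notion.
\<close>

definition graded_injective ::
    "(int ^ 'd) set \<Rightarrow> ('k::field, 'd, 'm) zd_module \<Rightarrow> bool" where
  "graded_injective Q J \<longleftrightarrow>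
     graded_module Q J \<and>
     (\<forall>(A :: ('k, 'd, ('k, 'd) laurent) zd_module) (B :: ('k, 'd, ('k, 'd) laurent) zd_module).
        \<forall>u \<in> graded_hom Q A B. \<forall>f \<in> graded_hom Q A J.
          graded_module Q A \<longrightarrow> graded_module Q B \<longrightarrow> inj_on u (carrier A) \<longrightarrow>
          (\<exists>g \<in> graded_hom Q B J. \<forall>x\<in>carrier A. g (u x) = f x))"

text \<open>Exactness of \<open>0 \<rightarrow> M \<rightarrow> J 0 \<rightarrow> J 1 \<rightarrow> \<dots>\<close>, with augmentation \<open>\<epsilon>\<close> and
  differentials \<open>d n\<close>, and injectivity of every \<open>J n\<close>.\<close>

definition graded_injective_resolution ::
    "(int ^ 'd) set \<Rightarrow> ('k::field, 'd, 'm) zd_module \<Rightarrow> ('m \<Rightarrow> 'j) \<Rightarrow>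
     (nat \<Rightarrow> ('k, 'd, 'j) zd_module) \<Rightarrow> (nat \<Rightarrow> 'j \<Rightarrow> 'j) \<Rightarrow> bool" where
  "graded_injective_resolution Q M \<epsilon> J d \<longleftrightarrow>
     (\<forall>n. graded_injective Q (J n)) \<and>
     \<epsilon> \<in> graded_hom Q M (J 0) \<and>
     (\<forall>n. d n \<in> graded_hom Q (J n) (J (Suc n))) \<and>
     inj_on \<epsilon> (carrier M) \<and>
     \<epsilon> ` carrier M = {x \<in> carrier (J 0). d 0 x = \<zero>\<^bsub>J 1\<^esub>} \<and>
     (\<forall>n. d n ` carrier (J n) =
          {x \<in> carrier (J (Suc n)). d (Suc n) x = \<zero>\<^bsub>J (Suc (Suc n))\<^esub>})"

text \<open>The functor \<open>\<Gamma>\<^sub>I\<close>: the elements annihilated by some power of \<open>I\<close>.\<close>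

definition torsion ::
    "('r, 'b) ring_scheme \<Rightarrow> 'r set \<Rightarrow> ('r, 'm, 'g) gmodule \<Rightarrow> ('r, 'm, 'g) gmodule" where
  "torsion R I N =
     (let T = {x \<in> carrier N. \<exists>n::nat. \<forall>f \<in> I [^]\<^bsub>ideals_set R\<^esub> n. f \<odot>\<^bsub>N\<^esub> x = \<zero>\<^bsub>N\<^esub>}
      in N\<lparr> carrier := T, component := \<lambda>a. component N a \<inter> T \<rparr>)"

text \<open>For graded submodules \<open>B \<subseteq> Z\<close> of \<open>N\<close>, the graded module \<open>Z/B\<close>. The fields \<open>mult\<close> and
  \<open>one\<close>, inherited from the record of rings, play no role in modules.\<close>

definition subquotient ::
    "('r, 'm, 'g) gmodule \<Rightarrow> 'm set \<Rightarrow> 'm set \<Rightarrow> ('r, 'm set, 'g) gmodule" where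
  "subquotient N Z B =
     \<lparr> carrier = (\<lambda>x. B +>\<^bsub>N\<^esub> x) ` Z,
       mult = undefined,
       one = undefined,
       zero = B,
       add = set_add N,
       smult = (\<lambda>r X. \<Union>x\<in>X. B +>\<^bsub>N\<^esub> (r \<odot>\<^bsub>N\<^esub> x)),
       component = (\<lambda>a. (\<lambda>x. B +>\<^bsub>N\<^esub> x) ` (Z \<inter> component N a)) \<rparr>"

definition cohomology ::
    "(nat \<Rightarrow> ('r, 'm, 'g) gmodule) \<Rightarrow> (nat \<Rightarrow> 'm \<Rightarrow> 'm) \<Rightarrow> nat \<Rightarrow> ('r, 'm set, 'g) gmodule" where
  "cohomology C d i =
     subquotient (C i)
       {x \<in> carrier (C i). d i x = \<zero>\<^bsub>C (Suc i)\<^esub>}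
       (case i of 0 \<Rightarrow> {\<zero>\<^bsub>C 0\<^esub>} | Suc j \<Rightarrow> d j ` carrier (C j))"

text \<open>If \<open>(J, d)\<close> is a graded injective resolution of \<open>M\<close>, this is the \<open>i\<close>-th right derived
  functor of \<open>\<Gamma>\<^sub>I\<close> at \<open>M\<close>, i.e. the \<open>i\<close>-th local cohomology module of \<open>M\<close> supported on \<open>I\<close>.\<close>

definition local_cohomology ::
    "('r, 'b) ring_scheme \<Rightarrow> 'r set \<Rightarrow> (nat \<Rightarrow> ('r, 'm, 'g) gmodule) \<Rightarrow> (nat \<Rightarrow> 'm \<Rightarrow> 'm) \<Rightarrow>
     nat \<Rightarrow> ('r, 'm set, 'g) gmodule" where
  "local_cohomology R I J d i = cohomology (\<lambda>n. torsion R I (J n)) d i"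


section \<open>Hilbert series\<close>

text \<open>\<open>B\<close> is a \<open>k\<close>-basis of the degree-\<open>a\<close> component; \<open>c \<in> k\<close> acts as the constant \<open>c t\<^sup>0\<close>.\<close>

definition component_basis ::
    "('k::field, 'd, 'm) zd_module \<Rightarrow> int ^ 'd \<Rightarrow> 'm set \<Rightarrow> bool" where
  "component_basis M a B \<longleftrightarrow>
     finite B \<and> B \<subseteq> component M a \<and>
     (\<forall>x\<in>component M a. \<exists>!c. c \<in> B \<rightarrow>\<^sub>E (UNIV :: 'k set) \<and>
        x = (\<Oplus>\<^bsub>M\<^esub>b\<in>B. Poly_Mapping.single 0 (c b) \<odot>\<^bsub>M\<^esub> b))"

text \<open>All components are finite-dimensional and \<open>h a\<close> is the dimension in degree \<open>a\<close>, so that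
  \<open>h\<close> is the coefficient function of the Hilbert series.\<close>

definition has_hilbert_function ::
    "('k::field, 'd, 'm) zd_module \<Rightarrow> (int ^ 'd \<Rightarrow> nat) \<Rightarrow> bool" where
  "has_hilbert_function M h \<longleftrightarrow> (\<forall>a. \<exists>B. component_basis M a B \<and> card B = h a)"


section \<open>Formal sums of rational functions\<close>

text \<open>
  Formal series in \<open>t\<^sub>1\<^sup>\<plusminus>, \<dots>, t\<^sub>d\<^sup>\<plusminus>\<close> are their coefficient functions.
  The series \<open>S\<close> is an expansion of the rational function \<open>p / q\<close> if \<open>q * S = p\<close> and \<open>S\<close> is
  supported in a translate \<open>b + C\<close> of a pointed cone \<open>C\<close>. For given \<open>C\<close> such an \<open>S\<close> is unique,
  since the series supported in finitely many translates of \<open>C\<close> form a domain.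
\<close>

definition expansion_of ::
    "(rat, 'd) laurent \<Rightarrow> (rat, 'd) laurent \<Rightarrow> (int ^ 'd \<Rightarrow> rat) \<Rightarrow> bool" where
  "expansion_of p q S \<longleftrightarrow>
     q \<noteq> 0 \<and>
     (\<forall>a. (\<Sum>b\<in>Poly_Mapping.keys q. Poly_Mapping.lookup q b * S (a - b)) =
          Poly_Mapping.lookup p a) \<and>
     (\<exists>b G. finite G \<and> pointed_cone (real_cone G) \<and>
        (\<forall>a. S a \<noteq> 0 \<longrightarrow> real_vec (a - b) \<in> real_cone G))"

definition formal_sum_of_rational_functions :: "(int ^ 'd \<Rightarrow> rat) \<Rightarrow> bool" where
  "formal_sum_of_rational_functions H \<longleftrightarrow>
     (\<exists>(n::nat) S. (\<forall>j<n. \<exists>p q. expansion_of p q (S j)) \<and> (\<forall>a. H a = (\<Sum>j<n. S j a)))"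

end

theory Submission
  imports Defs "HOL-Library.Function_Algebras"
begin

text \<open>
  A graded \<open>k[Q]\<close>-module is a family of vector spaces \<open>V\<^sub>a\<close> with maps \<open>V\<^sub>a \<rightarrow> V\<^bsub>a+q\<^esub>\<close>, \<open>q \<in> Q\<close>, and
  graded ideals are subsets \<open>I \<subseteq> Q\<close> with \<open>I + Q \<subseteq> I\<close>. Write \<open>J[I]\<close> for the elements of \<open>J\<close> that
  are killed by \<open>I\<close>. If \<open>J\<close> is injective, Baer's criterion makes
  \<open>0 \<rightarrow> J[I+x] \<rightarrow> J[I] \<rightarrow> J[I:x] \<rightarrow> 0\<close> exact. As the cohomology of a resolution \<open>J\<close> of \<open>M\<close> is
  noetherian, the long exact sequences show that every \<open>H\<^sup>n(J[I])\<close> is noetherian; hence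
  \<open>H\<^sup>n(J[m])\<close>, on which \<open>m\<close> acts as \<open>0\<close>, is finite-dimensional. The torsion \<open>T\<close> of \<open>J\<close> satisfies the
  same criterion, and \<open>T[m] = J[m]\<close>. Descending from \<open>I = m\<close> to \<open>I = {}\<close> by noetherian induction,
  with an argument of Melkersson in the case \<open>I:x = I\<close>, shows that the local cohomology \<open>H\<^sup>n(T)\<close> is
  artinian. The proof of the Hilbert--Serre theorem, applied to an artinian module, shows that
  \<open>\<Prod>\<^sub>g (1 - t\<^bsup>-g\<^esup>)\<close>, with \<open>g\<close> ranging over generators of \<open>Q\<close>, times the Hilbert series is a Laurent
  polynomial, and that the series is supported in finitely many translates of \<open>-Q\<close>, so in one
  translate of a pointed cone. A single rational function therefore suffices.
\<close>

section \<open>Chain conditions\<close>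

text \<open>The modules of an injective resolution satisfy no finiteness condition themselves, so
  every finiteness statement concerns cohomology, and injectivity enters only through the extension
  of families from monoid ideals. The noetherian and the artinian condition meet at J[m]: on its
  cohomology the ring acts through the field, and both conditions mean finite total dimension. Hence
  the ascent from {} to m is made with J, the descent from m to {} with its torsion. The ascent is
  an induction on the cohomological degree, because the connecting map asks for I:x one degree
  lower. In the descent I:x occurs in the same degree and must be strictly larger than I; if I:x =
  I, only the kernel C[I+x] of x is under control, and torsion supplies the missing local
  nilpotency. Pointedness is used through a linear form l that is positive on the generators: its
  levels l \<ge> N replace the powers of m, it makes nonzero elements of Q locally nilpotent on
  torsion, and it bounds degrees in the Hilbert series. Subquotients Z/B are handled as intervals of
  subspaces, so that chain arguments form no quotients.\<close>

definition chain_condition :: "('a \<Rightarrow> 'a \<Rightarrow> bool) \<Rightarrow> 'a set \<Rightarrow> bool" where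
  "chain_condition r S \<longleftrightarrow>
     (\<forall>f::nat \<Rightarrow> 'a. (\<forall>n. f n \<in> S) \<longrightarrow> (\<forall>n. r (f n) (f (Suc n))) \<longrightarrow> (\<exists>n. \<forall>m\<ge>n. f m = f n))"

lemma chain_conditionD:
  assumes "chain_condition r S" "\<And>n::nat. f n \<in> S" "\<And>n. r (f n) (f (Suc n))"
  shows "\<exists>n. \<forall>m\<ge>n. f m = f n"
  using assms unfolding chain_condition_def by meson

text \<open>Abstract form of the fact that an extension of noetherian (artinian) modules is
  noetherian (artinian): \<open>\<phi>\<close> and \<open>\<psi>\<close> play the trace on a
  submodule and the image in the quotient. As in the modular law, together they separate comparable
  elements only.\<close>

lemma chain_condition_two:
  assumes "chain_condition r' S1" "chain_condition r'' S2"
    and "\<And>x. x \<in> S \<Longrightarrow> \<phi> x \<in> S1" "\<And>x. x \<in> S \<Longrightarrow> \<psi> x \<in> S2"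
    and "\<And>x y. x \<in> S \<Longrightarrow> y \<in> S \<Longrightarrow> r x y \<Longrightarrow> r' (\<phi> x) (\<phi> y)"
    and "\<And>x y. x \<in> S \<Longrightarrow> y \<in> S \<Longrightarrow> r x y \<Longrightarrow> r'' (\<psi> x) (\<psi> y)"
    and inj: "\<And>x y. x \<in> S \<Longrightarrow> y \<in> S \<Longrightarrow> r x y \<Longrightarrow> \<phi> x = \<phi> y \<Longrightarrow> \<psi> x = \<psi> y \<Longrightarrow> x = y"
  shows "chain_condition r S"
  unfolding chain_condition_def
proof (intro allI impI)
  fix f assume f: "\<forall>n. f n \<in> S" "\<forall>n. r (f n) (f (Suc n))"
  obtain n1 where n1: "\<And>m. m \<ge> n1 \<Longrightarrow> \<phi> (f m) = \<phi> (f n1)"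
    using chain_conditionD[OF assms(1), of "\<lambda>n. \<phi> (f n)"] assms(3,5) f by blast
  obtain n2 where n2: "\<And>m. m \<ge> n2 \<Longrightarrow> \<psi> (f m) = \<psi> (f n2)"
    using chain_conditionD[OF assms(2), of "\<lambda>n. \<psi> (f n)"] assms(4,6) f by blast
  have step: "f (Suc m) = f m" if "m \<ge> max n1 n2" for m
    by (rule inj[symmetric]) (use f n1[of m] n1[of "Suc m"] n2[of m] n2[of "Suc m"] that in auto)
  have "f m = f (max n1 n2)" if "m \<ge> max n1 n2" for m
    using that by (induction m rule: dec_induct) (auto simp: step)
  then show "\<exists>n. \<forall>m\<ge>n. f m = f n" by blast
qed

lemma chain_condition_inj:
  assumes "chain_condition r' S1"
    and "\<And>x. x \<in> S \<Longrightarrow> \<phi> x \<in> S1"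
    and "\<And>x y. x \<in> S \<Longrightarrow> y \<in> S \<Longrightarrow> r x y \<Longrightarrow> r' (\<phi> x) (\<phi> y)"
    and "\<And>x y. x \<in> S \<Longrightarrow> y \<in> S \<Longrightarrow> r x y \<Longrightarrow> \<phi> x = \<phi> y \<Longrightarrow> x = y"
  shows "chain_condition r S"
  by (rule chain_condition_two[where \<phi> = \<phi> and \<psi> = \<phi>, OF assms(1) assms(1)])
    (use assms in blast)+

lemma chain_condition_singleton: "S \<subseteq> {x} \<Longrightarrow> chain_condition r S"
  unfolding chain_condition_def by (metis singletonD subsetD)

section \<open>Affine monoids with a positive grading\<close>

definition monoid_ideal :: "'g::ab_group_add set \<Rightarrow> 'g set \<Rightarrow> bool" where
  "monoid_ideal Q I \<longleftrightarrow> I \<subseteq> Q \<and> (\<forall>x\<in>I. \<forall>b\<in>Q. x + b \<in> I)"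

text \<open>The ideals \<open>I : x\<close> and \<open>I + (x)\<close>.\<close>

definition colon :: "'g::ab_group_add set \<Rightarrow> 'g set \<Rightarrow> 'g \<Rightarrow> 'g set" where
  "colon Q I x = {b \<in> Q. x + b \<in> I}"

definition extend_ideal :: "'g::ab_group_add set \<Rightarrow> 'g set \<Rightarrow> 'g \<Rightarrow> 'g set" where
  "extend_ideal Q I x = I \<union> {x + b | b. b \<in> Q}"

lemma submonoid_hull: "additive_submonoid (additive_submonoid hull G)"
  by (rule hull_in) (auto simp: additive_submonoid_def)

text \<open>The additive function \<open>l\<close> encodes pointedness: positivity on
  \<open>G\<close> excludes 0 from \<open>G\<close> and makes 0 the only invertible element of the
  monoid.\<close>

locale pos_monoid =
  fixes G :: "'g::ab_group_add set" and l :: "'g \<Rightarrow> real"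
  assumes finite_G: "finite G" and l_add: "l (a + b) = l a + l b"
    and l_pos: "g \<in> G \<Longrightarrow> l g > 0"
begin

definition Q where "Q = additive_submonoid hull G"

lemma Q_zero [simp, intro]: "0 \<in> Q" and Q_add [simp, intro]: "a \<in> Q \<Longrightarrow> b \<in> Q \<Longrightarrow> a + b \<in> Q"
  using submonoid_hull[of G] by (auto simp: Q_def additive_submonoid_def)

lemma G_Q: "g \<in> G \<Longrightarrow> g \<in> Q"
  unfolding Q_def by (meson hull_subset subsetD)

lemma Q_induct [consumes 1, case_names zero add]:
  assumes "q \<in> Q" "P 0" "\<And>g q. g \<in> G \<Longrightarrow> q \<in> Q \<Longrightarrow> P q \<Longrightarrow> P (g + q)"
  shows "P q"
proof -
  have "Q \<subseteq> {q \<in> Q. \<forall>p\<in>Q. P p \<longrightarrow> P (q + p)}" (is "_ \<subseteq> ?S")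
    unfolding Q_def
  proof (rule hull_minimal; unfold Q_def[symmetric])
    show "additive_submonoid ?S"
      by (auto simp: additive_submonoid_def add.assoc)
    show "G \<subseteq> ?S"
      using assms(3) G_Q by auto
  qed
  then show ?thesis using assms(1,2) by force
qed

lemma l_0 [simp]: "l 0 = 0" using l_add[of 0 0] by simp

lemma l_minus: "l (- a) = - l a" using l_add[of a "- a"] by simp

lemma l_nonneg: "q \<in> Q \<Longrightarrow> l q \<ge> 0"
  by (induction rule: Q_induct) (auto simp: l_add dest: l_pos)

lemma l_pos_Q: assumes "q \<in> Q" "q \<noteq> 0" shows "l q > 0"
proof -
  have "q = 0 \<or> l q > 0" using assms(1)
    by (induction rule: Q_induct) (auto simp: l_add dest: l_pos l_nonneg add_pos_nonneg)
  with assms show ?thesis by auto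
qed

lemma monoid_ideal_extend: "monoid_ideal Q I \<Longrightarrow> x \<in> Q \<Longrightarrow> monoid_ideal Q (extend_ideal Q I x)"
  by (auto simp: monoid_ideal_def extend_ideal_def add.assoc)

lemma monoid_ideal_colon: "monoid_ideal Q I \<Longrightarrow> monoid_ideal Q (colon Q I x)"
  by (auto simp: monoid_ideal_def colon_def add.assoc[symmetric])

lemma colon_mono: "monoid_ideal Q I \<Longrightarrow> x \<in> Q \<Longrightarrow> I \<subseteq> colon Q I x"
  by (auto simp: monoid_ideal_def colon_def add.commute)

lemma monoid_ideal_empty: "monoid_ideal Q {}" by (auto simp: monoid_ideal_def)

lemma monoid_ideal_Q: "monoid_ideal Q Q" by (auto simp: monoid_ideal_def)

lemma monoid_ideal_union: "monoid_ideal Q I \<Longrightarrow> monoid_ideal Q J \<Longrightarrow> monoid_ideal Q (I \<union> J)"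
  by (auto simp: monoid_ideal_def)

lemma monoid_ideal_level: "monoid_ideal Q {q \<in> Q. l q \<ge> N}"
  by (auto simp: monoid_ideal_def l_add dest: l_nonneg)

text \<open>A form of Dickson's lemma. Each \<open>f n\<close> is a multiple of the new generator
  plus an element of the smaller monoid; one passes to a subsequence along which the multiplicities
  increase and applies the induction hypothesis to the remainders. Such representations are not
  unique, but any choice will do.\<close>

lemma dickson_subseq:
  fixes f :: "nat \<Rightarrow> 'g"
  assumes "finite H" "\<And>n. f n \<in> additive_submonoid hull H"
  shows "\<exists>r::nat \<Rightarrow> nat. strict_mono r \<and> (\<forall>i j. i < j \<longrightarrow> f (r j) - f (r i) \<in> additive_submonoid hull H)"
  using assms
proof (induction H arbitrary: f rule: finite_induct)
  case empty
  have "additive_submonoid hull {} = {0::'g}"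
    by (rule hull_unique) (auto simp: additive_submonoid_def)
  then show ?case using empty by (metis diff_zero singletonD strict_mono_id singletonI)
next
  case (insert g H)
  let ?M = "additive_submonoid hull H" and ?M' = "additive_submonoid hull (insert g H)"
  \<comment> \<open>\<open>((+) g ^^ k) 0\<close> is the multiple k g.\<close>
  have mult: "((+) g ^^ k) 0 \<in> ?M'" for k
    using submonoid_hull[of "insert g H"] hull_subset[of "insert g H" additive_submonoid]
    by (induction k) (auto simp: additive_submonoid_def)
  have mult_add: "((+) g ^^ (k + k')) 0 = ((+) g ^^ k) 0 + ((+) g ^^ k') 0" for k k'
    by (induction k) (auto simp: add.assoc)
  have sub: "?M \<subseteq> ?M'" by (rule hull_mono) auto
  have "?M' \<subseteq> {((+) g ^^ k) 0 + m | k m. m \<in> ?M}"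
  proof (rule hull_minimal)
    show "insert g H \<subseteq> {((+) g ^^ k) 0 + m | k m. m \<in> ?M}"
    proof
      fix x assume "x \<in> insert g H"
      then consider "x = g" | "x \<in> H" by auto
      then show "x \<in> {((+) g ^^ k) 0 + m | k m. m \<in> ?M}"
      proof cases
        case 1
        have "x = ((+) g ^^ 1) 0 + 0" using 1 by simp
        then show ?thesis using submonoid_hull[of H] unfolding additive_submonoid_def by blast
      next
        case 2
        have "x = ((+) g ^^ 0) 0 + x" "x \<in> ?M" using 2 hull_subset[of H additive_submonoid] by auto
        then show ?thesis by blast
      qed
    qed
    show "additive_submonoid {((+) g ^^ k) 0 + m | k m. m \<in> ?M}"
    proof (rule additive_submonoid_def[THEN iffD2], intro conjI ballI)
      have "0 = ((+) g ^^ 0) 0 + (0::'g)" by simp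
      then show "0 \<in> {((+) g ^^ k) 0 + m | k m. m \<in> ?M}" using submonoid_hull[of H] unfolding additive_submonoid_def by blast
    next
      fix x y assume "x \<in> {((+) g ^^ k) 0 + m | k m. m \<in> ?M}" "y \<in> {((+) g ^^ k) 0 + m | k m. m \<in> ?M}"
      then obtain k m k' m' where *: "x = ((+) g ^^ k) 0 + m" "y = ((+) g ^^ k') 0 + m'" "m \<in> ?M" "m' \<in> ?M" by auto
      then have "x + y = ((+) g ^^ (k + k')) 0 + (m + m')" unfolding mult_add by (simp add: algebra_simps)
      then show "x + y \<in> {((+) g ^^ k) 0 + m | k m. m \<in> ?M}"
        using * submonoid_hull[of H] unfolding additive_submonoid_def by blast
    qed
  qed
  then have "\<forall>n. \<exists>k m. f n = ((+) g ^^ k) 0 + m \<and> m \<in> ?M" using insert.prems by blast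
  then obtain k m where km: "\<And>n. f n = ((+) g ^^ (k n)) 0 + m n" "\<And>n. m n \<in> ?M" by metis
  obtain r where r: "strict_mono r" "monoseq (k \<circ> r)" using seq_monosub[of k] unfolding comp_def by blast
  \<comment> \<open>A monotone subsequence that is not increasing is decreasing, hence constant from
    the place where it attains its minimum \<open>v\<close>; that tail counts as increasing.\<close>
  have "\<exists>s::nat \<Rightarrow> nat. strict_mono s \<and> incseq (k \<circ> s)"
  proof (cases "incseq (k \<circ> r)")
    case False
    then have dec: "decseq (k \<circ> r)" using r by (simp add: monoseq_iff)
    define v where "v = (LEAST v. v \<in> range (k \<circ> r))"
    have v: "v \<in> range (k \<circ> r)" unfolding v_def by (rule LeastI[of _ "(k \<circ> r) 0"]) auto
    have vl: "v \<le> (k \<circ> r) i" for i unfolding v_def by (rule Least_le) auto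
    obtain i0 where i0: "v = (k \<circ> r) i0" using v by auto
    have "(k \<circ> r) (i0 + i) = v" for i using vl[of "i0 + i"] decseqD[OF dec, of i0 "i0 + i"] i0 by auto
    then have "incseq (k \<circ> (\<lambda>i. r (i0 + i)))" by (auto simp: incseq_def)
    moreover have "strict_mono (\<lambda>i. r (i0 + i))" using r by (auto simp: strict_mono_def)
    ultimately show ?thesis by blast
  qed (use r in auto)
  then obtain s :: "nat \<Rightarrow> nat" where s: "strict_mono s" "incseq (k \<circ> s)" by blast
  obtain t :: "nat \<Rightarrow> nat" where t: "strict_mono t" "\<And>i j. i < j \<Longrightarrow> m (s (t j)) - m (s (t i)) \<in> ?M"
    using insert.IH[of "m \<circ> s"] km by auto
  have "f (s (t j)) - f (s (t i)) \<in> ?M'" if ij: "i < j" for i j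
  proof -
    have "t i < t j" using ij t by (auto simp: strict_mono_def)
    then have "k (s (t i)) \<le> k (s (t j))" using s(2) by (auto simp: incseq_def)
    then obtain e where e: "k (s (t j)) = k (s (t i)) + e" using le_Suc_ex by blast
    have "f (s (t j)) - f (s (t i)) = ((+) g ^^ e) 0 + (m (s (t j)) - m (s (t i)))"
      unfolding km(1) e mult_add by (simp add: algebra_simps)
    then show ?thesis using mult[of e] t(2)[OF ij] sub submonoid_hull[of "insert g H"]
      unfolding additive_submonoid_def by auto
  qed
  moreover have "strict_mono (s \<circ> t)" using s t by (auto simp: strict_mono_def)
  ultimately show ?case by (intro exI[of _ "s \<circ> t"]) (simp add: comp_def)
qed

text \<open>From a chain that never stabilises one picks \<open>q n\<close> outside
  \<open>f n\<close> but in a later ideal. Along a Dickson subsequence a later element is a multiple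
  of an earlier one, so it already lies in an ideal that it was chosen to avoid.\<close>

lemma chain_condition_ideals: "chain_condition (\<le>) {I. monoid_ideal Q I}"
  unfolding chain_condition_def
proof (intro allI impI)
  fix f :: "nat \<Rightarrow> 'g set" assume f: "\<forall>n. f n \<in> {I. monoid_ideal Q I}" "\<forall>n. f n \<le> f (Suc n)"
  have mono: "f i \<subseteq> f j" if "i \<le> j" for i j using lift_Suc_mono_le[of f, OF _ that] f(2) by auto
  show "\<exists>n. \<forall>m\<ge>n. f m = f n"
  proof (rule ccontr)
    assume "\<not> ?thesis"
    then have "\<forall>n. \<exists>m>n. \<exists>q. q \<in> f m \<and> q \<notin> f n" using mono by (metis le_neq_implies_less subsetI subset_antisym)
    then obtain h q where hq: "\<And>n. h n > n" "\<And>n. q n \<in> f (h n)" "\<And>n. q n \<notin> f n" by metis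
    \<comment> \<open>\<open>s\<close> jumps along \<open>h\<close>, so that \<open>q (s i)\<close>
      lies in \<open>f (s (Suc i))\<close>.\<close>
    define s where "s i = (h ^^ i) 0" for i
    have s: "strict_mono s" unfolding strict_mono_Suc_iff s_def using hq by auto
    have "\<And>i. (q \<circ> s) i \<in> additive_submonoid hull G"
      using hq(2) f unfolding monoid_ideal_def Q_def[symmetric] comp_def by blast
    with dickson_subseq[OF finite_G, of "q \<circ> s"] obtain r :: "nat \<Rightarrow> nat"
      where r: "strict_mono r" "\<And>i j. i < j \<Longrightarrow> q (s (r j)) - q (s (r i)) \<in> Q"
      by (auto simp: Q_def)
    have "q (s (r 0)) \<in> f (s (Suc (r 0)))" using hq(2)[of "s (r 0)"] by (simp add: s_def)
    moreover have "Suc (r 0) \<le> r 1" using strict_monoD[OF r(1), of 0 1] by linarith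
    then have "s (Suc (r 0)) \<le> s (r 1)" by (rule monoD[OF strict_mono_mono[OF s]])
    ultimately have "q (s (r 0)) \<in> f (s (r 1))" using mono by (meson subsetD)
    moreover have "q (s (r 1)) - q (s (r 0)) \<in> Q" "monoid_ideal Q (f (s (r 1)))"
      using f r(2)[of 0 1] by auto
    ultimately have "q (s (r 0)) + (q (s (r 1)) - q (s (r 0))) \<in> f (s (r 1))"
      unfolding monoid_ideal_def by blast
    then show False using hq(3) by simp
  qed
qed

lemma ideal_induct [consumes 1, case_names step]:
  assumes "monoid_ideal Q I"
    and "\<And>I. monoid_ideal Q I \<Longrightarrow> (\<And>J. monoid_ideal Q J \<Longrightarrow> I \<subset> J \<Longrightarrow> P J) \<Longrightarrow> P I"
  shows "P I"
proof -
  let ?R = "{(J, I). monoid_ideal Q I \<and> monoid_ideal Q J \<and> I \<subset> J}"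
  have "\<nexists>f. \<forall>i. (f (Suc i), f i) \<in> ?R"
  proof
    assume "\<exists>f. \<forall>i. (f (Suc i), f i) \<in> ?R"
    then obtain f where "\<forall>i. (f (Suc i), f i) \<in> ?R" ..
    then have f: "\<And>i. monoid_ideal Q (f i)" "\<And>i. f i \<subset> f (Suc i)" by auto
    obtain n where "\<And>m. m \<ge> n \<Longrightarrow> f m = f n"
      using chain_conditionD[OF chain_condition_ideals, of f] f by auto
    from this[of "Suc n"] f(2)[of n] show False by auto
  qed
  then have "wf ?R" unfolding wf_iff_no_infinite_down_chain .
  then have "monoid_ideal Q I \<longrightarrow> P I"
  proof (induction rule: wf_induct_rule)
    case (less I)
    show ?case using assms(2)[of I] less by blast
  qed
  then show ?thesis using assms(1) by blast
qed

text \<open>Adding missing elements of \<open>I\<close> to the generators must stop. The noetherian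
  induction runs over the ideal \<open>K\<close> generated so far, not over
  \<open>I\<close>.\<close>

lemma ideal_fg:
  assumes "monoid_ideal Q I"
  obtains F where "finite F" "F \<subseteq> I" "I = {f + b | f b. f \<in> F \<and> b \<in> Q}"
proof -
  define gen where "gen F = {f + b | f b. f \<in> F \<and> b \<in> Q}" for F
  have gen: "monoid_ideal Q (gen F)" if "F \<subseteq> I" for F
    unfolding monoid_ideal_def
  proof (intro conjI subsetI ballI)
    fix x assume "x \<in> gen F" then show "x \<in> Q" using that assms unfolding monoid_ideal_def gen_def by auto
  next
    fix x b assume "x \<in> gen F" "b \<in> Q"
    then obtain f c where "x = f + c" "f \<in> F" "c \<in> Q" unfolding gen_def by auto
    then have "x + b = f + (c + b)" "f \<in> F" "c + b \<in> Q" using \<open>b \<in> Q\<close> by (auto simp: add.assoc)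
    then show "x + b \<in> gen F" unfolding gen_def by blast
  qed
  have sub: "gen F \<subseteq> I" if "F \<subseteq> I" for F
    using that assms by (auto simp: monoid_ideal_def gen_def)
  have "\<exists>F. finite F \<and> F \<subseteq> I \<and> I = gen F" if "K = gen F" "finite F" "F \<subseteq> I" "monoid_ideal Q K" for K F
    using that(4,1-3)
  proof (induction K arbitrary: F rule: ideal_induct)
    case (step K)
    show ?case
    proof (cases "I \<subseteq> gen F")
      case False
      then obtain q where q: "q \<in> I" "q \<notin> gen F" by auto
      have "q + 0 \<in> gen (insert q F)" unfolding gen_def by blast
      moreover have "gen F \<subseteq> gen (insert q F)" unfolding gen_def by blast
      ultimately have "K \<subset> gen (insert q F)" using step.prems q by auto
      then show ?thesis using step.IH[of "gen (insert q F)" "insert q F"] gen[of "insert q F"] q step.prems by auto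
    qed (use step.prems sub in blast)
  qed
  from this[of "gen {}" "{}"] gen[of "{}"] obtain F where "finite F" "F \<subseteq> I" "I = gen F" by auto
  then show ?thesis using that unfolding gen_def by blast
qed

end

section \<open>Complexes of graded modules\<close>

text \<open>The graded submodules of \<open>Z/B\<close>, given by their preimages in \<open>Z\<close>. The same function \<open>X q\<close> acts on
  all degrees, and only its values on the spaces at hand matter.\<close>

definition (in vector_space) interval ::
    "'g::ab_group_add set \<Rightarrow> ('g \<Rightarrow> 'b \<Rightarrow> 'b) \<Rightarrow> ('g \<Rightarrow> 'b set) \<Rightarrow> ('g \<Rightarrow> 'b set) \<Rightarrow> ('g \<Rightarrow> 'b set) set" where
  "interval K X B Z = {N. \<forall>a. subspace (N a) \<and> B a \<subseteq> N a \<and> N a \<subseteq> Z a \<and>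
     (\<forall>q\<in>K. \<forall>x\<in>N a. X q x \<in> N (a + q))}"

locale graded_complex = pos_monoid G l + vector_space scale
  for G :: "'g::ab_group_add set" and l :: "'g \<Rightarrow> real"
    and scale :: "'k::field \<Rightarrow> 'w::ab_group_add \<Rightarrow> 'w" (infixr "*s" 75) +
  fixes C :: "nat \<Rightarrow> 'g \<Rightarrow> 'w set"
    and X :: "nat \<Rightarrow> 'g \<Rightarrow> 'w \<Rightarrow> 'w"
    and D :: "nat \<Rightarrow> 'w \<Rightarrow> 'w"
  assumes sub_C: "subspace (C n a)"
    and X_in: "q \<in> Q \<Longrightarrow> x \<in> C n a \<Longrightarrow> X n q x \<in> C n (a + q)"
    and X_add: "q \<in> Q \<Longrightarrow> x \<in> C n a \<Longrightarrow> y \<in> C n a \<Longrightarrow> X n q (x + y) = X n q x + X n q y"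
    and X_scale: "q \<in> Q \<Longrightarrow> x \<in> C n a \<Longrightarrow> X n q (c *s x) = c *s X n q x"
    and X_0: "x \<in> C n a \<Longrightarrow> X n 0 x = x"
    and X_X: "q \<in> Q \<Longrightarrow> r \<in> Q \<Longrightarrow> x \<in> C n a \<Longrightarrow> X n (q + r) x = X n q (X n r x)"
    and D_in: "x \<in> C n a \<Longrightarrow> D n x \<in> C (Suc n) a"
    and D_add: "x \<in> C n a \<Longrightarrow> y \<in> C n a \<Longrightarrow> D n (x + y) = D n x + D n y"
    and D_scale: "x \<in> C n a \<Longrightarrow> D n (c *s x) = c *s D n x"
    and D_X: "q \<in> Q \<Longrightarrow> x \<in> C n a \<Longrightarrow> D n (X n q x) = X (Suc n) q (D n x)"
    and D_D: "x \<in> C n a \<Longrightarrow> D (Suc n) (D n x) = 0"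
begin

lemma zero_C [simp]: "0 \<in> C n a"
  by (rule subspace_0[OF sub_C])

lemma X_zero [simp]: "q \<in> Q \<Longrightarrow> X n q 0 = 0"
  using X_scale[of q 0 n 0 0] by simp

lemma D_zero [simp]: "D n 0 = 0"
  using D_scale[of 0 n 0 0] by simp

lemma diff_C: "x \<in> C n a \<Longrightarrow> y \<in> C n a \<Longrightarrow> x - y \<in> C n a"
  by (rule subspace_diff[OF sub_C])

lemma X_diff: "q \<in> Q \<Longrightarrow> x \<in> C n a \<Longrightarrow> y \<in> C n a \<Longrightarrow> X n q (x - y) = X n q x - X n q y"
  using X_add[of q "x - y" n a y] diff_C[of x n a y] by (simp add: algebra_simps)

lemma D_diff: "x \<in> C n a \<Longrightarrow> y \<in> C n a \<Longrightarrow> D n (x - y) = D n x - D n y"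
  using D_add[of "x - y" n a y] diff_C[of x n a y] by (simp add: algebra_simps)

text \<open>The complex C[I], that is, Hom(k[Q]/I, C) degree by degree.\<close>

definition ann :: "nat \<Rightarrow> 'g set \<Rightarrow> 'g \<Rightarrow> 'w set" where
  "ann n I a = {y \<in> C n a. \<forall>q\<in>I. X n q y = 0}"

definition cycles :: "nat \<Rightarrow> 'g set \<Rightarrow> 'g \<Rightarrow> 'w set" where
  "cycles n I a = {y \<in> ann n I a. D n y = 0}"

definition boundaries :: "nat \<Rightarrow> 'g set \<Rightarrow> 'g \<Rightarrow> 'w set" where
  "boundaries n I a = (case n of 0 \<Rightarrow> {0} | Suc m \<Rightarrow> D m ` ann m I a)"

lemma boundaries_Suc: "boundaries (Suc m) I a = D m ` ann m I a"
  and boundaries_0: "boundaries 0 I a = {0}"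
  by (simp_all add: boundaries_def)

abbreviation "Itv n B Z \<equiv> interval Q (X n) B Z"

text \<open>The relation \<open>r\<close> selects the noetherian \<open>(\<le>)\<close> or the
  artinian \<open>(\<ge>)\<close> condition on the cohomology of C[I], so that the exact sequence
  arguments serve both.\<close>

definition chain_H :: "(('g \<Rightarrow> 'w set) \<Rightarrow> ('g \<Rightarrow> 'w set) \<Rightarrow> bool) \<Rightarrow> nat \<Rightarrow> 'g set \<Rightarrow> bool" where
  "chain_H r n I \<longleftrightarrow> chain_condition r (Itv n (boundaries n I) (cycles n I))"

lemma annD: "y \<in> ann n I a \<Longrightarrow> y \<in> C n a" "y \<in> ann n I a \<Longrightarrow> q \<in> I \<Longrightarrow> X n q y = 0"
  by (auto simp: ann_def)

lemma sub_ann: "I \<subseteq> Q \<Longrightarrow> subspace (ann n I a)"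
  unfolding subspace_def ann_def using sub_C[of n a] 
  by (auto simp: subspace_def X_add X_scale subset_iff)

lemma sub_cycles: "I \<subseteq> Q \<Longrightarrow> subspace (cycles n I a)"
  using sub_ann[of I n a] unfolding subspace_def cycles_def
  by (auto simp: D_add[OF annD(1) annD(1)] D_scale[OF annD(1)])

lemma sub_D_image:
  assumes "subspace A" "A \<subseteq> C n a" shows "subspace (D n ` A)"
  unfolding subspace_def
proof (intro conjI ballI allI)
  show "0 \<in> D n ` A" using subspace_0[OF assms(1)] by force
next
  fix x y assume "x \<in> D n ` A" "y \<in> D n ` A"
  then obtain u v where "x = D n u" "y = D n v" "u \<in> A" "v \<in> A" by auto
  then show "x + y \<in> D n ` A" using D_add[of u n a v] subspace_add[OF assms(1)] assms(2) by (metis image_eqI subsetD)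
next
  fix c x assume "x \<in> D n ` A"
  then obtain u where "x = D n u" "u \<in> A" by auto
  then show "c *s x \<in> D n ` A" using D_scale[of u n a c] subspace_scale[OF assms(1)] assms(2) by (metis image_eqI subsetD)
qed

lemma sub_X_image:
  assumes "subspace A" "A \<subseteq> C n a" "q \<in> Q" shows "subspace (X n q ` A)"
  unfolding subspace_def
proof (intro conjI ballI allI)
  show "0 \<in> X n q ` A" using subspace_0[OF assms(1)] assms(3) by force
next
  fix x y assume "x \<in> X n q ` A" "y \<in> X n q ` A"
  then obtain u v where "x = X n q u" "y = X n q v" "u \<in> A" "v \<in> A" by auto
  then show "x + y \<in> X n q ` A" using X_add[of q u n a v] subspace_add[OF assms(1)] assms(2,3) by (metis image_eqI subsetD)
next
  fix c x assume "x \<in> X n q ` A"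
  then obtain u where "x = X n q u" "u \<in> A" by auto
  then show "c *s x \<in> X n q ` A" using X_scale[of q u n a c] subspace_scale[OF assms(1)] assms(2,3) by (metis image_eqI subsetD)
qed

lemma sub_boundaries: "I \<subseteq> Q \<Longrightarrow> subspace (boundaries n I a)"
  unfolding boundaries_def
  by (auto split: nat.split intro!: sub_D_image[OF sub_ann] simp: subspace_single_0 dest: annD)

lemma X_ann: assumes "y \<in> ann n I a" "q \<in> Q" "I \<subseteq> Q" shows "X n q y \<in> ann n I (a + q)"
proof -
  have "X n p (X n q y) = 0" if "p \<in> I" for p
    using assms that X_X[of p q y n a] X_X[of q p y n a] by (auto simp: ann_def add.commute[of p])
  then show ?thesis using assms by (auto simp: ann_def X_in)
qed

lemma X_ann_colon: assumes "y \<in> ann n I a" "x \<in> Q" shows "X n x y \<in> ann n (colon Q I x) (a + x)"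
  using assms X_X[of _ x y n a] by (auto simp: ann_def colon_def X_in add.commute[of x])

lemma ann_extend:
  assumes "y \<in> ann n I a" "x \<in> Q" "X n x y = 0" shows "y \<in> ann n (extend_ideal Q I x) a"
  using assms X_X[of _ x y n a] by (auto simp: ann_def extend_ideal_def add.commute[of x])

lemma ann_extendD: assumes "y \<in> ann n (extend_ideal Q I x) a" shows "y \<in> ann n I a" "X n x y = 0"
proof -
  have "x + 0 \<in> extend_ideal Q I x" unfolding extend_ideal_def by blast
  then show "X n x y = 0" using assms by (auto simp: ann_def)
qed (use assms in \<open>auto simp: ann_def extend_ideal_def\<close>)

lemma D_ann: "y \<in> ann n I a \<Longrightarrow> I \<subseteq> Q \<Longrightarrow> D n y \<in> ann (Suc n) I a"
  by (auto simp: ann_def D_in D_X[symmetric] subset_iff)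

lemma X_cycles: "y \<in> cycles n I a \<Longrightarrow> q \<in> Q \<Longrightarrow> I \<subseteq> Q \<Longrightarrow> X n q y \<in> cycles n I (a + q)"
  by (auto simp: cycles_def X_ann D_X[OF _ annD(1)])

lemma X_boundaries: "y \<in> boundaries n I a \<Longrightarrow> q \<in> Q \<Longrightarrow> I \<subseteq> Q \<Longrightarrow> X n q y \<in> boundaries n I (a + q)"
  by (cases n) (auto simp: boundaries_Suc boundaries_0 D_X[OF _ annD(1), symmetric] intro!: imageI X_ann)

lemma boundaries_cycles: "I \<subseteq> Q \<Longrightarrow> boundaries n I a \<subseteq> cycles n I a"
  by (cases n) (auto simp: boundaries_Suc boundaries_0 cycles_def D_ann D_D[OF annD(1)] subspace_0[OF sub_ann])

lemma intervalD:
  assumes "N \<in> interval K Y B Z"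
  shows "subspace (N a)" "B a \<subseteq> N a" "N a \<subseteq> Z a" "q \<in> K \<Longrightarrow> x \<in> N a \<Longrightarrow> Y q x \<in> N (a + q)"
  using assms by (auto simp: interval_def)

lemma intervalI:
  assumes "\<And>a. subspace (N a)" "\<And>a. B a \<subseteq> N a" "\<And>a. N a \<subseteq> Z a"
    "\<And>a q x. q \<in> K \<Longrightarrow> x \<in> N a \<Longrightarrow> Y q x \<in> N (a + q)"
  shows "N \<in> interval K Y B Z"
  using assms by (auto simp: interval_def)

lemma cycles_C: "cycles n I a \<subseteq> C n a"
  by (auto simp: cycles_def ann_def)

lemma cycles_antimono: "I \<subseteq> J \<Longrightarrow> cycles n J a \<subseteq> cycles n I a"
  by (auto simp: cycles_def ann_def)

lemma boundaries_antimono: "I \<subseteq> J \<Longrightarrow> boundaries n J a \<subseteq> boundaries n I a"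
  by (cases n) (auto simp: boundaries_Suc boundaries_0 ann_def)

end

text \<open>Graded ideals of k[Q] are spanned by monomials, so a graded homomorphism from an ideal
  is determined by its values \<open>f q\<close> on monomials, and compatibility with the action of
  Q is all that has to be required. The element \<open>y\<close> is the image of 1 under an
  extension to k[Q], shifted to degree \<open>a\<close>.\<close>

locale baer_complex = graded_complex +
  assumes baer: "monoid_ideal Q I \<Longrightarrow> (\<And>q. q \<in> I \<Longrightarrow> f q \<in> C n (a + q)) \<Longrightarrow>
      (\<And>q b. q \<in> I \<Longrightarrow> b \<in> Q \<Longrightarrow> f (q + b) = X n b (f q)) \<Longrightarrow>
      \<exists>y\<in>C n a. \<forall>q\<in>I. X n q y = f q"
begin

text \<open>The solution is prescribed on the ideal J + x: killed by J, and multiplied by x to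
  \<open>y\<close>. The two prescriptions agree on the overlap by the assumption on
  \<open>y\<close>, and \<open>baer\<close> realises the resulting family.\<close>

lemma ann_surj_aux:
  assumes I: "monoid_ideal Q I" and J: "monoid_ideal Q J" "I \<subseteq> J" and x: "x \<in> Q"
    and y: "y \<in> C n (a + x)" "\<And>b. b \<in> Q \<Longrightarrow> x + b \<in> J \<Longrightarrow> X n b y = 0"
  shows "\<exists>z\<in>ann n J a. X n x z = y"
proof -
  define f where "f q = (if q \<in> J then 0 else X n (q - x) y)" for q
  have f: "f (x + b) = X n b y" if "b \<in> Q" for b using y that by (auto simp: f_def)
  have f0: "f q = 0" if "q \<in> J" for q using that by (auto simp: f_def)
  have "\<exists>z\<in>C n a. \<forall>q\<in>extend_ideal Q J x. X n q z = f q"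
  proof (rule baer)
    show "monoid_ideal Q (extend_ideal Q J x)" using J(1) x by (rule monoid_ideal_extend)
  next
    fix q assume "q \<in> extend_ideal Q J x"
    then consider "q \<in> J" | b where "q = x + b" "b \<in> Q" by (auto simp: extend_ideal_def)
    then show "f q \<in> C n (a + q)"
    proof cases
      case 2 then show ?thesis using X_in[OF 2(2) y(1)] f[of b] by (simp add: add.assoc)
    qed (simp add: f0)
  next
    fix q c assume "q \<in> extend_ideal Q J x" and c: "c \<in> Q"
    then consider "q \<in> J" | b where "q = x + b" "b \<in> Q" by (auto simp: extend_ideal_def)
    then show "f (q + c) = X n c (f q)"
    proof cases
      case 1
      then have "q + c \<in> J" using J c by (auto simp: monoid_ideal_def)
      then show ?thesis using f0 1 c by simp
    next
      case 2
      then have "f (q + c) = X n (c + b) y" using f[of "b + c"] c by (simp add: add.assoc add.commute[of c b])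
      then show ?thesis using 2 c f[of b] X_X[OF c 2(2) y(1)] by simp
    qed
  qed
  then obtain z where z: "z \<in> C n a" "\<And>q. q \<in> extend_ideal Q J x \<Longrightarrow> X n q z = f q" by blast
  have "x + 0 \<in> extend_ideal Q J x" unfolding extend_ideal_def by blast
  then have "X n x z = y" using z(2)[of x] f[of 0] X_0[OF y(1)] by simp
  moreover have "z \<in> ann n J a" using z f0 by (auto simp: ann_def extend_ideal_def)
  ultimately show ?thesis by blast
qed

lemma ann_surj:
  assumes "monoid_ideal Q I" "x \<in> Q" "y \<in> ann n (colon Q I x) (a + x)"
  obtains z where "z \<in> ann n I a" "X n x z = y"
  using ann_surj_aux[of I I x y n a] assms by (auto simp: ann_def colon_def)

text \<open>A primitive in C[I:x] lifts along x to C[I], and the differential commutes with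
  x.\<close>

lemma boundaries_surj:
  assumes I: "monoid_ideal Q I" and x: "x \<in> Q" and y: "y \<in> boundaries n (colon Q I x) (a + x)"
  shows "\<exists>z\<in>boundaries n I a. X n x z = y"
proof (cases n)
  case 0 then show ?thesis using y x by (simp add: boundaries_0)
next
  case (Suc m)
  then obtain u where u: "u \<in> ann m (colon Q I x) (a + x)" "y = D m u" using y by (auto simp: boundaries_Suc)
  obtain v where v: "v \<in> ann m I a" "X m x v = u" using ann_surj[OF I x u(1)] .
  then show ?thesis using u Suc D_X[OF x annD(1)[OF v(1)]] by (auto simp: boundaries_Suc)
qed

text \<open>The exact sequence \<open>0 \<rightarrow> C[I+x] \<rightarrow> C[I] \<rightarrow> C[I:x] \<rightarrow> 0\<close> gives
  \<open>H\<^sup>n C[I:x] \<rightarrow> H\<^sup>n\<^sup>+\<^sup>1 C[I+x] \<rightarrow> H\<^sup>n\<^sup>+\<^sup>1 C[I]\<close>.\<close>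

lemma chain_H_extend_ideal:
  assumes I: "monoid_ideal Q I" and x: "x \<in> Q" and r: "r = (\<le>) \<or> r = (\<ge>)"
    and H: "chain_H r n (colon Q I x)" "chain_H r (Suc n) I"
  shows "chain_H r (Suc n) (extend_ideal Q I x)"
proof -
  let ?P = "extend_ideal Q I x" and ?K = "colon Q I x"
  have IQ: "I \<subseteq> Q" and PQ: "?P \<subseteq> Q" and KQ: "?K \<subseteq> Q" and IP: "I \<subseteq> ?P"
    using I monoid_ideal_extend[OF I x] by (auto simp: monoid_ideal_def colon_def extend_ideal_def)
  \<comment> \<open>Preimage of N under the connecting map: \<open>u\<close> in C[I:x] lifts to
    \<open>w\<close> with u = x w, and its class goes to that of D w. Lifting along x lowers the
    degree from \<open>a\<close> to \<open>a - x\<close>.\<close>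
  define \<phi> where "\<phi> N a = {u. \<exists>w\<in>ann n I (a - x). D n w \<in> N (a - x) \<and> u = X n x w}" for N :: "'a \<Rightarrow> 'c set" and a
  \<comment> \<open>Image of N in the cohomology of C[I].\<close>
  define \<psi> where "\<psi> N a = {u + v | u v. u \<in> N a \<and> v \<in> boundaries (Suc n) I a}" for N :: "'a \<Rightarrow> 'c set" and a
  let ?S = "Itv (Suc n) (boundaries (Suc n) ?P) (cycles (Suc n) ?P)"
  have mono: "\<phi> N \<le> \<phi> N'" "\<psi> N \<le> \<psi> N'" if "N \<le> N'" for N N'
    using that unfolding \<phi>_def \<psi>_def le_fun_def by blast+
  have incl: "u \<in> \<psi> N a" if "u \<in> N a" for u N a
    using that subspace_0[OF sub_boundaries[OF IQ]] unfolding \<psi>_def by force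
  show ?thesis unfolding chain_H_def
  proof (rule chain_condition_two[OF H[unfolded chain_H_def], of _ \<phi> \<psi>])
    fix N assume N: "N \<in> ?S"
    note N = intervalD[OF N]
    show "\<phi> N \<in> Itv n (boundaries n ?K) (cycles n ?K)"
    proof (rule intervalI)
      fix a
      let ?A = "{w \<in> ann n I (a - x). D n w \<in> N (a - x)}"
      have "subspace ?A" using sub_ann[OF IQ, of n "a - x"] N(1)[of "a - x"]
        unfolding subspace_def by (auto simp: D_add[OF annD(1) annD(1)] D_scale[OF annD(1)])
      moreover have "\<phi> N a = X n x ` ?A" unfolding \<phi>_def by auto
      moreover have "?A \<subseteq> C n (a - x)" using annD(1) by blast
      ultimately show "subspace (\<phi> N a)" using sub_X_image[OF _ _ x, of ?A n "a - x"] by auto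
      show "boundaries n ?K a \<subseteq> \<phi> N a"
      proof
        fix y assume "y \<in> boundaries n ?K a"
        then obtain z where z: "z \<in> boundaries n I (a - x)" "X n x z = y"
          using boundaries_surj[OF I x, of y n "a - x"] by auto
        then have "z \<in> cycles n I (a - x)" using boundaries_cycles[OF IQ] by blast
        then have "z \<in> ann n I (a - x)" "D n z = 0" by (auto simp: cycles_def)
        moreover have "D n z \<in> N (a - x)" using \<open>D n z = 0\<close> subspace_0[OF N(1)] by simp
        ultimately show "y \<in> \<phi> N a" using z(2) unfolding \<phi>_def by blast
      qed
      show "\<phi> N a \<subseteq> cycles n ?K a"
      proof
        fix y assume "y \<in> \<phi> N a"
        then obtain w where w: "w \<in> ann n I (a - x)" "D n w \<in> N (a - x)" "y = X n x w" unfolding \<phi>_def by auto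
        have "D n w \<in> ann (Suc n) ?P (a - x)" using w(2) N(3) unfolding cycles_def by blast
        then have "X (Suc n) x (D n w) = 0" by (rule ann_extendD(2))
        then show "y \<in> cycles n ?K a" using w X_ann_colon[OF w(1) x] D_X[OF x annD(1)[OF w(1)]]
          by (auto simp: cycles_def)
      qed
      fix q y assume q: "q \<in> Q" and "y \<in> \<phi> N a"
      then obtain w where w: "w \<in> ann n I (a - x)" "D n w \<in> N (a - x)" "y = X n x w" unfolding \<phi>_def by auto
      have "X n q w \<in> ann n I (a + q - x)" using X_ann[OF w(1) q IQ] by (simp add: algebra_simps)
      moreover have "D n (X n q w) \<in> N (a + q - x)"
        using N(4)[OF q w(2)] D_X[OF q annD(1)[OF w(1)]] by (simp add: algebra_simps)
      moreover have "X n q y = X n x (X n q w)"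
        using w(3) X_X[OF q x annD(1)[OF w(1)]] X_X[OF x q annD(1)[OF w(1)]] by (simp add: add.commute)
      ultimately show "X n q y \<in> \<phi> N (a + q)" unfolding \<phi>_def by auto
    qed
    show "\<psi> N \<in> Itv (Suc n) (boundaries (Suc n) I) (cycles (Suc n) I)"
    proof (rule intervalI)
      fix a
      show "subspace (\<psi> N a)" using subspace_sums[OF N(1) sub_boundaries[OF IQ]] unfolding \<psi>_def by simp
      show "boundaries (Suc n) I a \<subseteq> \<psi> N a" using subspace_0[OF N(1)] unfolding \<psi>_def by force
      show "\<psi> N a \<subseteq> cycles (Suc n) I a"
        using N(3)[of a] cycles_antimono[OF IP, of "Suc n" a] boundaries_cycles[OF IQ, of "Suc n" a]
          subspace_add[OF sub_cycles[OF IQ]] unfolding \<psi>_def by blast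
      fix q y assume q: "q \<in> Q" and "y \<in> \<psi> N a"
      then obtain u v where uv: "y = u + v" "u \<in> N a" "v \<in> boundaries (Suc n) I a" unfolding \<psi>_def by auto
      have "u \<in> C (Suc n) a" "v \<in> C (Suc n) a" using uv N(3)[of a] boundaries_cycles[OF IQ] cycles_C by blast+
      then show "X (Suc n) q y \<in> \<psi> N (a + q)"
        using uv N(4)[OF q uv(2)] X_boundaries[OF uv(3) q IQ] X_add[OF q] unfolding \<psi>_def by blast
    qed
  next
    fix N N' assume N: "N \<in> ?S" and N': "N' \<in> ?S" and "r N N'"
    then show "r (\<phi> N) (\<phi> N')" "r (\<psi> N) (\<psi> N')" using mono r by auto
    assume eq: "\<phi> N = \<phi> N'" "\<psi> N = \<psi> N'"
    \<comment> \<open>An element of N is u + D w with u in N'. As the preimages under the connecting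
      map agree, x w = x w' for some w' with D w' in N'. Then w - w' lies in C[I+x], so D (w - w')
      is a boundary and belongs to N' as well.\<close>
    have key: "N a \<subseteq> N' a" if N: "N \<in> ?S" and N': "N' \<in> ?S" and le: "N' \<le> N" and eq: "\<phi> N = \<phi> N'" "\<psi> N = \<psi> N'" for N N' a
    proof
      note N = intervalD[OF N] and N' = intervalD[OF N']
      fix y assume y: "y \<in> N a"
      then have "y \<in> \<psi> N' a" using incl eq by metis
      then obtain u v where uv: "y = u + v" "u \<in> N' a" "v \<in> boundaries (Suc n) I a" unfolding \<psi>_def by auto
      then obtain w where w: "w \<in> ann n I a" "v = D n w" by (auto simp: boundaries_Suc)
      have "v = y - u" using uv by simp
      then have "D n w \<in> N a" using w subspace_diff[OF N(1) y, of u] uv(2) le by (auto simp: le_fun_def)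
      then have "X n x w \<in> \<phi> N (a + x)" using w unfolding \<phi>_def by auto
      then have "X n x w \<in> \<phi> N' (a + x)" using eq by simp
      then obtain w' where w': "w' \<in> ann n I a" "D n w' \<in> N' a" "X n x w = X n x w'" unfolding \<phi>_def by auto
      have "w - w' \<in> ann n I a" using w w' subspace_diff[OF sub_ann[OF IQ]] by blast
      moreover have "X n x (w - w') = 0" using X_diff[OF x annD(1)[OF w(1)] annD(1)[OF w'(1)]] w' by simp
      ultimately have "w - w' \<in> ann n ?P a" using ann_extend x by blast
      then have "D n (w - w') \<in> N' a" using N'(2)[of a] by (auto simp: boundaries_Suc)
      then have "v \<in> N' a" using subspace_add[OF N'(1), of "D n (w - w')" a "D n w'"] w' w
          D_diff[OF annD(1)[OF w(1)] annD(1)[OF w'(1)]] by simp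
      then show "y \<in> N' a" using uv subspace_add[OF N'(1)] by blast
    qed
    have "N \<le> N' \<or> N' \<le> N" using \<open>r N N'\<close> r by auto
    then show "N = N'"
      using key[OF N N' _ eq] key[OF N' N _ eq[symmetric]] by (auto simp: le_fun_def fun_eq_iff)
  qed
qed

text \<open>Multiplication by x carries submodules of the cohomology of C[I] to submodules of that
  of C[I:x]; the image contains all boundaries by \<open>boundaries_surj\<close>. If I:x = I, this
  is an operation on the submodules of a single module.\<close>

lemma X_image_interval:
  assumes I: "monoid_ideal Q I" and x: "x \<in> Q" and N: "N \<in> Itv n (boundaries n I) (cycles n I)"
  shows "(\<lambda>a. X n x ` N (a - x)) \<in> Itv n (boundaries n (colon Q I x)) (cycles n (colon Q I x))"
proof (rule intervalI)
  note N = intervalD[OF N]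
  have IQ: "I \<subseteq> Q" using I by (simp add: monoid_ideal_def)
  fix a
  have NC: "N b \<subseteq> C n b" for b using N(3)[of b] cycles_C by blast
  show "subspace (X n x ` N (a - x))" by (rule sub_X_image[OF N(1) NC x])
  show "boundaries n (colon Q I x) a \<subseteq> X n x ` N (a - x)"
    using boundaries_surj[OF I x, of _ n "a - x"] N(2)[of "a - x"] by auto
  show "X n x ` N (a - x) \<subseteq> cycles n (colon Q I x) a"
  proof
    fix y assume "y \<in> X n x ` N (a - x)"
    then obtain z where z: "z \<in> N (a - x)" "y = X n x z" by auto
    then have "z \<in> cycles n I (a - x)" using N(3) by blast
    then show "y \<in> cycles n (colon Q I x) a"
      using X_ann_colon[of z n I "a - x" x] x z(2) D_X[OF x, of z n "a - x"] by (auto simp: cycles_def annD)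
  qed
  fix q y assume q: "q \<in> Q" and "y \<in> X n x ` N (a - x)"
  then obtain z where z: "z \<in> N (a - x)" "y = X n x z" by auto
  have "X n q y = X n x (X n q z)"
    using z X_X[OF q x, of z n "a - x"] X_X[OF x q, of z n "a - x"] NC by (auto simp: add.commute)
  moreover have "X n q z \<in> N (a + q - x)" using N(4)[OF q z(1)] by (simp add: algebra_simps)
  ultimately show "X n q y \<in> X n x ` N (a + q - x)" by blast
qed

text \<open>The same exact sequence gives \<open>H\<^sup>n C[I+x] \<rightarrow> H\<^sup>n C[I] \<rightarrow> H\<^sup>n C[I:x]\<close>.\<close>

lemma chain_H_middle:
  assumes I: "monoid_ideal Q I" and x: "x \<in> Q" and r: "r = (\<le>) \<or> r = (\<ge>)"
    and H: "chain_H r n (colon Q I x)" "chain_H r n (extend_ideal Q I x)"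
  shows "chain_H r n I"
proof -
  let ?P = "extend_ideal Q I x" and ?K = "colon Q I x"
  have IQ: "I \<subseteq> Q" and PQ: "?P \<subseteq> Q" and KQ: "?K \<subseteq> Q" and IP: "I \<subseteq> ?P"
    using I monoid_ideal_extend[OF I x] by (auto simp: monoid_ideal_def colon_def extend_ideal_def)
  \<comment> \<open>Here \<open>\<phi>\<close> is the image in the cohomology of C[I:x], and
    \<open>\<psi>\<close> the preimage in the cohomology of C[I+x].\<close>
  define \<phi> where "\<phi> N a = X n x ` N (a - x)" for N :: "'a \<Rightarrow> 'c set" and a
  define \<psi> where "\<psi> N a = N a \<inter> cycles n ?P a" for N :: "'a \<Rightarrow> 'c set" and a
  let ?S = "Itv n (boundaries n I) (cycles n I)"
  have mono: "\<phi> N \<le> \<phi> N'" "\<psi> N \<le> \<psi> N'" if "N \<le> N'" for N N'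
    using that unfolding \<phi>_def \<psi>_def le_fun_def by blast+
  show ?thesis unfolding chain_H_def
  proof (rule chain_condition_two[OF H[unfolded chain_H_def], of _ \<phi> \<psi>])
    fix N assume N: "N \<in> ?S"
    show "\<phi> N \<in> Itv n (boundaries n ?K) (cycles n ?K)"
      using X_image_interval[OF I x N] unfolding \<phi>_def .
    note N = intervalD[OF N]
    show "\<psi> N \<in> Itv n (boundaries n ?P) (cycles n ?P)"
    proof (rule intervalI)
      fix a
      show "subspace (\<psi> N a)" using subspace_inter[OF N(1) sub_cycles[OF PQ]] unfolding \<psi>_def by simp
      show "boundaries n ?P a \<subseteq> \<psi> N a"
        using boundaries_antimono[OF IP, of n a] N(2)[of a] boundaries_cycles[OF PQ] unfolding \<psi>_def by blast
      show "\<psi> N a \<subseteq> cycles n ?P a" unfolding \<psi>_def by blast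
      fix q y assume "q \<in> Q" "y \<in> \<psi> N a"
      then show "X n q y \<in> \<psi> N (a + q)" using N(4) X_cycles PQ unfolding \<psi>_def by blast
    qed
  next
    fix N N' assume N: "N \<in> ?S" and N': "N' \<in> ?S" and "r N N'"
    then show "r (\<phi> N) (\<phi> N')" "r (\<psi> N) (\<psi> N')" using mono r by auto
    assume eq: "\<phi> N = \<phi> N'" "\<psi> N = \<psi> N'"
    have key: "N a \<subseteq> N' a" if N: "N \<in> ?S" and N': "N' \<in> ?S" and le: "N' \<le> N" and eq: "\<phi> N = \<phi> N'" "\<psi> N = \<psi> N'" for N N' a
    proof
      note N = intervalD[OF N] and N' = intervalD[OF N']
      fix y assume y: "y \<in> N a"
      then have "X n x y \<in> \<phi> N (a + x)" unfolding \<phi>_def by auto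
      then have "X n x y \<in> \<phi> N' (a + x)" using eq by simp
      then obtain z where z: "z \<in> N' a" "X n x y = X n x z" unfolding \<phi>_def by auto
      have "z \<in> N a" using z le by (auto simp: le_fun_def)
      then have yz: "y - z \<in> N a" using y subspace_diff[OF N(1)] by blast
      then have c: "y - z \<in> cycles n I a" using N(3) by blast
      have "y \<in> C n a" "z \<in> C n a" using y z N(3)[of a] N'(3)[of a] cycles_C by blast+
      then have "X n x (y - z) = 0" using X_diff[OF x] z by auto
      then have "y - z \<in> cycles n ?P a" using c ann_extend[OF _ x] by (auto simp: cycles_def)
      then have "y - z \<in> \<psi> N a" using yz by (simp add: \<psi>_def)
      then have "y - z \<in> N' a" using eq by (simp add: \<psi>_def)
      then show "y \<in> N' a" using subspace_add[OF N'(1), of "y - z" a z] z by simp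
    qed
    have "N \<le> N' \<or> N' \<le> N" using \<open>r N N'\<close> r by auto
    then show "N = N'"
      using key[OF N N' _ eq] key[OF N' N _ eq[symmetric]] by (auto simp: le_fun_def fun_eq_iff)
  qed
qed

text \<open>Melkersson's argument: if \<open>x\<close> acts locally nilpotently on \<open>H\<close> and the kernel of \<open>x\<close> on \<open>H\<close> is
  artinian, then \<open>H\<close> is artinian.\<close>

lemma chain_H_nilpotent:
  assumes I: "monoid_ideal Q I" and x: "x \<in> Q" and c: "colon Q I x = I"
    and H: "chain_H (\<ge>) n (extend_ideal Q I x)"
    and nil: "\<And>y a. y \<in> cycles n I a \<Longrightarrow> \<exists>k. (X n x ^^ k) y = 0"
  shows "chain_H (\<ge>) n I"
  unfolding chain_H_def chain_condition_def
proof (intro allI impI)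
  let ?P = "extend_ideal Q I x" 
  have IQ: "I \<subseteq> Q" and PQ: "?P \<subseteq> Q" and IP: "I \<subseteq> ?P"
    using I monoid_ideal_extend[OF I x] by (auto simp: monoid_ideal_def colon_def extend_ideal_def)
  let ?S = "Itv n (boundaries n I) (cycles n I)"
  fix f :: "nat \<Rightarrow> 'a \<Rightarrow> 'c set"
  assume f: "\<forall>n'. f n' \<in> ?S" "\<forall>n. f n \<ge> f (Suc n)"
  \<comment> \<open>Since I:x = I, \<open>sh\<close> sends N to the submodule x N of the same
    module. \<open>U k N\<close> is the preimage of x^k N in the cohomology of C[I+x], where the
    descending chain condition is available.\<close>
  define sh where "sh N a = X n x ` N (a - x)" for N :: "'a \<Rightarrow> 'c set" and a
  define U where "U k N a = (sh ^^ k) N a \<inter> cycles n ?P a" for k N a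
  have shS: "sh N \<in> ?S" if "N \<in> ?S" for N
    using X_image_interval[OF I x that] unfolding sh_def c .
  have shkS: "(sh ^^ k) N \<in> ?S" if "N \<in> ?S" for k N
    using that by (induction k) (auto simp: shS)
  have sh_le: "sh N \<le> N" if "N \<in> ?S" for N
    unfolding sh_def le_fun_def using intervalD(4)[OF that x] by fastforce
  have sh_mono: "sh N \<le> sh N'" if "N \<le> N'" for N N'
    using that unfolding sh_def le_fun_def by blast
  have shk_mono: "(sh ^^ k) N \<le> (sh ^^ k) N'" if "N \<le> N'" for N N' k
    using that by (induction k) (auto simp: sh_mono)
  have US: "U k N \<in> Itv n (boundaries n ?P) (cycles n ?P)" if "N \<in> ?S" for k N
  proof (rule intervalI)
    note N = intervalD[OF shkS[OF that, of k]]
    fix a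
    show "subspace (U k N a)" using subspace_inter[OF N(1) sub_cycles[OF PQ]] unfolding U_def by simp
    show "boundaries n ?P a \<subseteq> U k N a"
      using boundaries_antimono[OF IP, of n a] N(2)[of a] boundaries_cycles[OF PQ] unfolding U_def by blast
    show "U k N a \<subseteq> cycles n ?P a" unfolding U_def by blast
    fix q y assume "q \<in> Q" "y \<in> U k N a"
    then show "X n q y \<in> U k N (a + q)" using N(4) X_cycles PQ unfolding U_def by blast
  qed
  have f_mono: "f j \<le> f i" if "i \<le> j" for i j
    using lift_Suc_antimono_le[of f, OF _ that] f(2) by auto
  have U_mono1: "U k (f j) \<le> U k (f i)" if "i \<le> j" for k i j
    using shk_mono[OF f_mono[OF that], of k] unfolding U_def le_fun_def by blast
  have U_mono2: "U (Suc k) (f j) \<le> U k (f j)" for k j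
    using sh_le[OF shkS[of "f j" k]] f(1) unfolding U_def le_fun_def by auto
  have U_mono2': "U k (f j) \<le> U i (f j)" if "i \<le> k" for k i j
    using lift_Suc_antimono_le[of "\<lambda>k. U k (f j)", OF U_mono2 that] .
  \<comment> \<open>\<open>U k (f j)\<close> decreases in k and in j, so stabilisation on the
    diagonal gives one common value for all k, j \<ge> m.\<close>
  have "\<exists>m. \<forall>j\<ge>m. U j (f j) = U m (f m)"
    by (rule chain_conditionD[OF H[unfolded chain_H_def]])
      (use f(1) US in blast, use U_mono1 U_mono2 order_trans in \<open>meson le_SucI order_refl\<close>)
  then obtain m where m: "\<And>j. j \<ge> m \<Longrightarrow> U j (f j) = U m (f m)" by blast
  have big: "U k (f j) = U m (f m)" if "k \<ge> m" "j \<ge> m" for k j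
  proof (rule antisym)
    have "U k (f j) \<le> U m (f j)" "U m (f j) \<le> U m (f m)" using that U_mono1 U_mono2' by auto
    then show "U k (f j) \<le> U m (f m)" by (rule order_trans)
    have "U (max k j) (f (max k j)) \<le> U k (f (max k j))" "U k (f (max k j)) \<le> U k (f j)"
      using U_mono1 U_mono2' by auto
    then show "U m (f m) \<le> U k (f j)" using m[of "max k j"] that by (auto intro: order_trans)
  qed
  \<comment> \<open>The rows k < m escape the diagonal argument. Each of them stabilises by itself,
    and \<open>t\<close> bounds these finitely many places together with \<open>m\<close>.\<close>
  have "\<forall>k. \<exists>p. \<forall>j\<ge>p. U k (f j) = U k (f p)"
  proof
    fix k show "\<exists>p. \<forall>j\<ge>p. U k (f j) = U k (f p)"
      by (rule chain_conditionD[OF H[unfolded chain_H_def]])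
        (use f(1) US in blast, use U_mono1 in \<open>meson le_SucI order_refl\<close>)
  qed
  then obtain p where p: "\<And>k j. j \<ge> p k \<Longrightarrow> U k (f j) = U k (f (p k))" by metis
  define t where "t = Max (insert m (p ` {..m}))"
  have tm: "t \<ge> m" and tp: "k \<le> m \<Longrightarrow> t \<ge> p k" for k unfolding t_def by (auto intro!: Max_ge simp del: Max_insert)
  have st: "U k (f j) = U k (f t)" if "j \<ge> t" for k j
  proof (cases "k \<ge> m")
    case True then show ?thesis using big[of k j] big[of k t] tm that by simp
  next
    case False
    then have "p k \<le> t" using tp[of k] by simp
    then show ?thesis using p[of k j] p[of k t] that by simp
  qed
  have shk: "(X n x ^^ k) y \<in> (sh ^^ k) N b" if "y \<in> N a" "b = ((\<lambda>a. a + x) ^^ k) a" for k y N a b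
    using that by (induction k arbitrary: b) (auto simp: sh_def)
  have shk': "\<exists>y\<in>N a. u = (X n x ^^ k) y" if "u \<in> (sh ^^ k) N (((\<lambda>a. a + x) ^^ k) a)" for k u N a
    using that
  proof (induction k arbitrary: u)
    case (Suc k)
    then have "u \<in> sh ((sh ^^ k) N) (((\<lambda>a. a + x) ^^ k) a + x)" by simp
    then obtain v where "v \<in> (sh ^^ k) N (((\<lambda>a. a + x) ^^ k) a)" "u = X n x v"
      unfolding sh_def[of "(sh ^^ k) N"] by auto
    then show ?case using Suc.IH[of v] by auto
  qed auto
  have Xk_C: "y \<in> C n a \<Longrightarrow> (X n x ^^ k) y \<in> C n (((\<lambda>a. a + x) ^^ k) a)" for y a k
    by (induction k) (auto simp: X_in x)
  have Xk_diff: "(X n x ^^ k) (y - z) = (X n x ^^ k) y - (X n x ^^ k) z"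
    if "y \<in> C n a" "z \<in> C n a" for y z a k
    using that by (induction k) (auto simp: X_diff[OF x Xk_C[of _ a] Xk_C[of _ a]])
  show "\<exists>m. \<forall>j\<ge>m. f j = f m"
  proof (intro exI allI impI)
    fix j assume j: "j \<ge> t"
    \<comment> \<open>If x^(k+1) kills y, then x^k y lies in \<open>U k (f t)\<close> =
      \<open>U k (f j)\<close>, so x^k y = x^k z with z in \<open>f j\<close>; now y - z is killed
      by x^k and the induction hypothesis applies.\<close>
    have "y \<in> f j a" if "y \<in> f t a" "(X n x ^^ k) y = 0" for y k a
      using that
    proof (induction k arbitrary: y)
      case 0
      then show ?case using f(1) subspace_0[OF intervalD(1)[of "f j"]] by force
    next
      case (Suc k)
      let ?b = "((\<lambda>a. a + x) ^^ k) a"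
      have 1: "(X n x ^^ k) y \<in> (sh ^^ k) (f t) ?b" using shk Suc.prems by blast
      then have "(X n x ^^ k) y \<in> cycles n I ?b" using intervalD(3)[OF shkS] f(1) by blast
      moreover have "X n x ((X n x ^^ k) y) = 0" using Suc.prems by simp
      ultimately have "(X n x ^^ k) y \<in> cycles n ?P ?b" using ann_extend[OF _ x] by (auto simp: cycles_def)
      with 1 have "(X n x ^^ k) y \<in> U k (f t) ?b" by (simp add: U_def)
      then have "(X n x ^^ k) y \<in> (sh ^^ k) (f j) ?b" using st[OF j, of k] unfolding U_def by (metis IntE)
      then obtain z where z: "z \<in> f j a" "(X n x ^^ k) y = (X n x ^^ k) z" using shk' by blast
      have zt: "z \<in> f t a" using z f_mono[OF j] by (auto simp: le_fun_def)
      have sub: "subspace (f t a)" "subspace (f j a)" and C: "f t a \<subseteq> C n a"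
        using f(1) intervalD(1) intervalD(3) cycles_C by blast+
      have "y - z \<in> f t a" using zt Suc.prems subspace_diff[OF sub(1)] by blast
      moreover have "(X n x ^^ k) (y - z) = 0" using Xk_diff[of y a z k] Suc.prems zt z C by auto
      ultimately have "y - z \<in> f j a" using Suc.IH by blast
      then show ?case using subspace_add[OF sub(2) _ z(1)] by force
    qed
    moreover have "\<exists>k. (X n x ^^ k) y = 0" if "y \<in> f t a" for y a
      using nil[of y a] intervalD(3)[of "f t"] f(1) that by blast
    ultimately have "f t a \<subseteq> f j a" for a by blast
    then show "f j = f t" using f_mono[OF j] by (auto simp: le_fun_def fun_eq_iff)
  qed
qed

end

text \<open>Vectors \<open>e\<^sub>n\<close> witnessing a strict descent \<open>N\<^sub>0 \<supset> N\<^sub>1 \<supset> \<dots>\<close> are linearly independent modulo \<open>B\<close>, so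
  their spans form a strictly ascending chain.\<close>

lemma (in vector_space) acc_imp_dcc:
  fixes B Z :: "'g::ab_group_add \<Rightarrow> 'b set"
  assumes "chain_condition (\<le>) (interval {} Y B Z)"
    and B: "\<And>a. subspace (B a)" and Z: "\<And>a. subspace (Z a)" and BZ: "\<And>a. B a \<subseteq> Z a"
  shows "chain_condition (\<ge>) (interval {} Y B Z)"
  unfolding chain_condition_def
proof (intro allI impI)
  fix f :: "nat \<Rightarrow> 'g \<Rightarrow> 'b set"
  assume f: "\<forall>n. f n \<in> interval {} Y B Z" "\<forall>n. f n \<ge> f (Suc n)"
  have mono: "f j \<le> f i" if "i \<le> j" for i j
    using lift_Suc_antimono_le[of f, OF _ that] f(2) by auto
  show "\<exists>n. \<forall>m\<ge>n. f m = f n"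
  proof (rule ccontr)
    assume "\<not> ?thesis"
    then have "\<forall>n. \<exists>m>n. \<exists>a y. y \<in> f n a \<and> y \<notin> f m a"
      using mono by (metis le_funI le_neq_implies_less subsetI subset_antisym order_antisym)
    then obtain h a y where h: "\<And>n. h n > n" "\<And>n. y n \<in> f n (a n)" "\<And>n. y n \<notin> f (h n) (a n)" by metis
    define s where "s i = (h ^^ i) 0" for i
    define e where "e n = y (s n)" for n
    define d where "d n = a (s n)" for n
    have e: "e n \<in> f (s n) (d n)" "e n \<notin> f (s (Suc n)) (d n)" for n
      using h by (auto simp: e_def d_def s_def)
    have ss: "f (s (Suc n)) b \<subseteq> f (s n) b" for n b
      using mono[of "s n" "s (Suc n)"] h(1)[of "s n"] by (auto simp: s_def le_fun_def)
    have sub: "subspace (f n b)" "B b \<subseteq> f n b" "f n b \<subseteq> Z b" for n b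
      using f(1) by (auto simp: interval_def)
    define K where "K n b = span (B b \<union> e ` {j. j < n \<and> d j = b})" for n b
    have K_eq: "K (Suc n) b = (if d n = b then span (insert (e n) (B b \<union> e ` {j. j < n \<and> d j = b})) else K n b)" for n b
      unfolding K_def by (auto intro!: arg_cong[of _ _ span] simp: less_Suc_eq)
    \<comment> \<open>This is the independence of the witnesses modulo \<open>B\<close>: in an
      element of \<open>K (Suc n)\<close> that lies in the chain at \<open>s (Suc n)\<close>, the
      coefficient of \<open>e n\<close> vanishes, because \<open>e n\<close> has left the chain
      there.\<close>
    have key: "K n b \<inter> f (s n) b \<subseteq> B b" for n b
    proof (induction n arbitrary: b)
      case 0
      have "K 0 b = B b" using B[of b] by (simp add: K_def span_eq_iff)
      then show ?case by auto
    next
      case (Suc n)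
      show ?case
      proof
        fix v assume v: "v \<in> K (Suc n) b \<inter> f (s (Suc n)) b"
        show "v \<in> B b"
        proof (cases "d n = b")
          case False
          then show ?thesis using v Suc[of b] ss[of n b] by (auto simp: K_eq)
        next
          case True
          then obtain c where c: "v - scale c (e n) \<in> K n b"
            using v unfolding K_eq by (auto simp: span_breakdown_eq K_def)
          have "v \<in> f (s n) b" using v ss by blast
          moreover have "scale c (e n) \<in> f (s n) b" using e(1)[of n] True sub(1) subspace_scale by blast
          ultimately have "v - scale c (e n) \<in> f (s n) b" using sub(1) subspace_diff by blast
          then have u: "v - scale c (e n) \<in> B b" using c Suc[of b] by blast
          then have "v - scale c (e n) \<in> f (s (Suc n)) b" using sub(2) by blast
          then have "v - (v - scale c (e n)) \<in> f (s (Suc n)) b" using v sub(1) subspace_diff by blast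
          then have "scale c (e n) \<in> f (s (Suc n)) b" by simp
          then have "scale (inverse c) (scale c (e n)) \<in> f (s (Suc n)) b" using sub(1) subspace_scale by blast
          then have "c = 0" using e(2)[of n] True by (cases "c = 0") auto
          then show ?thesis using u by simp
        qed
      qed
    qed
    have "\<exists>n. \<forall>m\<ge>n. K m = K n"
    proof (rule chain_conditionD[OF assms(1)])
      fix n
      have eZ: "e j \<in> Z (d j)" for j using e(1)[of j] sub(3) by blast
      have "B b \<subseteq> K n b" for b unfolding K_def by (meson Un_upper1 span_superset subset_trans)
      moreover have "K n b \<subseteq> Z b" for b
        unfolding K_def using eZ BZ[of b] by (intro span_minimal[OF _ Z]) auto
      ultimately show "K n \<in> interval {} Y B Z" unfolding interval_def by (auto simp: K_def)
      show "K n \<le> K (Suc n)" unfolding le_fun_def K_def by (auto intro!: span_mono)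
    qed
    then obtain n where "K (Suc n) = K n" by (meson le_SucI order_refl)
    moreover have "e n \<in> K (Suc n) (d n)" unfolding K_def by (rule span_base) auto
    ultimately have "e n \<in> B (d n)" using key[of n "d n"] e(1)[of n] by auto
    then show False using e(2)[of n] sub(2) by blast
  qed
qed


context baer_complex
begin

lemma chain_H_0: "(\<And>a. C 0 a = {0}) \<Longrightarrow> I \<subseteq> Q \<Longrightarrow> chain_H r 0 I"
  unfolding chain_H_def
proof (rule chain_condition_singleton[where x = "\<lambda>a. {0}"], rule subsetI)
  fix N assume C: "\<And>a. C 0 a = {0}" and N: "N \<in> Itv 0 (boundaries 0 I) (cycles 0 I)"
  note N = intervalD[OF N]
  have "N a = {0}" for a using N(3)[of a] cycles_C[of 0 I a] C[of a] subspace_0[OF N(1)[of a]] by blast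
  then show "N \<in> {\<lambda>a. {0}}" by auto
qed

text \<open>Induction on the cohomological degree and on the number of generators of \<open>I\<close>.\<close>

lemma chain_H_all:
  assumes C0: "\<And>a. C 0 a = {0}" and r: "r = (\<le>) \<or> r = (\<ge>)"
    and H: "\<And>n. chain_H r n {}" and I: "monoid_ideal Q I"
  shows "chain_H r n I"
  using I
proof (induction n arbitrary: I)
  \<comment> \<open>The complex starts with the zero space, so degree 0 requires no exact
    sequence.\<close>
  case 0
  then show ?case using chain_H_0 C0 by (auto simp: monoid_ideal_def)
next
  case (Suc n)
  define gen where "gen F = {f + b | f b. f \<in> F \<and> b \<in> Q}" for F
  obtain F where F: "finite F" "F \<subseteq> I" "I = gen F" using ideal_fg[OF Suc.prems] unfolding gen_def by blast
  then have "F \<subseteq> Q" using Suc.prems by (auto simp: monoid_ideal_def)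
  with \<open>finite F\<close> have "monoid_ideal Q (gen F) \<and> chain_H r (Suc n) (gen F)"
  proof (induction F rule: finite_induct)
    case empty
    then show ?case using H monoid_ideal_empty by (simp add: gen_def)
  next
    case (insert x F)
    then have IH: "monoid_ideal Q (gen F)" "chain_H r (Suc n) (gen F)" "x \<in> Q" by auto
    have "gen (insert x F) = extend_ideal Q (gen F) x" unfolding gen_def extend_ideal_def by auto
    \<comment> \<open>The colon ideal may need more generators than \<open>gen F\<close>; it is
      covered by the outer hypothesis, which concerns all ideals in the lower degree.\<close>
    then show ?case
      using monoid_ideal_extend[OF IH(1,3)] chain_H_extend_ideal[OF IH(1,3) r Suc.IH[OF monoid_ideal_colon[OF IH(1)]] IH(2)] by simp
  qed
  then show ?case using F by simp
qed

text \<open>Levels of \<open>l\<close> take the place of the powers of the maximal ideal;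
  \<open>torsion_iff\<close> proves that they define the same torsion in the modules of the
  resolution.\<close>

definition tors :: "nat \<Rightarrow> 'a \<Rightarrow> 'c set" where
  "tors n a = {y \<in> C n a. \<exists>N. \<forall>q\<in>Q. l q \<ge> N \<longrightarrow> X n q y = 0}"

lemma torsI: "y \<in> C n a \<Longrightarrow> (\<And>q. q \<in> Q \<Longrightarrow> l q \<ge> N \<Longrightarrow> X n q y = 0) \<Longrightarrow> y \<in> tors n a"
  by (auto simp: tors_def)

lemma torsE:
  assumes "y \<in> tors n a" obtains N where "y \<in> C n a" "\<And>q. q \<in> Q \<Longrightarrow> l q \<ge> N \<Longrightarrow> X n q y = 0"
  using assms by (auto simp: tors_def)

lemma tors_C: "y \<in> tors n a \<Longrightarrow> y \<in> C n a" by (simp add: tors_def)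

lemma sub_tors: "subspace (tors n a)"
  unfolding subspace_def
proof (intro conjI ballI allI)
  show "0 \<in> tors n a" by (rule torsI[of _ _ _ 0]) auto
next
  fix x y assume "x \<in> tors n a" "y \<in> tors n a"
  then obtain N M where N: "x \<in> C n a" "\<And>q. q \<in> Q \<Longrightarrow> l q \<ge> N \<Longrightarrow> X n q x = 0"
    and M: "y \<in> C n a" "\<And>q. q \<in> Q \<Longrightarrow> l q \<ge> M \<Longrightarrow> X n q y = 0" by (elim torsE) blast
  show "x + y \<in> tors n a"
    by (rule torsI[of _ _ _ "max N M"]) (use N M in \<open>auto simp: X_add intro: subspace_add[OF sub_C]\<close>)
next
  fix c x assume "x \<in> tors n a"
  then obtain N where N: "x \<in> C n a" "\<And>q. q \<in> Q \<Longrightarrow> l q \<ge> N \<Longrightarrow> X n q x = 0" by (elim torsE) blast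
  show "c *s x \<in> tors n a"
    by (rule torsI[of _ _ _ N]) (use N in \<open>auto simp: X_scale intro: subspace_scale[OF sub_C]\<close>)
qed

lemma X_tors: assumes "q \<in> Q" "x \<in> tors n a" shows "X n q x \<in> tors n (a + q)"
proof -
  obtain N where N: "x \<in> C n a" "\<And>q. q \<in> Q \<Longrightarrow> l q \<ge> N \<Longrightarrow> X n q x = 0" using assms(2) by (elim torsE) blast
  show ?thesis
  proof (rule torsI)
    fix p assume "p \<in> Q" "l p \<ge> N"
    then show "X n p (X n q x) = 0"
      using X_X[of p q x n a] X_X[of q p x n a] N assms by (simp add: add.commute)
  qed (use N assms X_in in auto)
qed

lemma D_tors: assumes "x \<in> tors n a" shows "D n x \<in> tors (Suc n) a"
proof -
  obtain N where N: "x \<in> C n a" "\<And>q. q \<in> Q \<Longrightarrow> l q \<ge> N \<Longrightarrow> X n q x = 0" using assms by (elim torsE) blast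
  show ?thesis by (rule torsI[of _ _ _ N]) (use N D_in in \<open>auto simp: D_X[symmetric]\<close>)
qed

text \<open>A family with torsion values on a finitely generated ideal vanishes from some level
  \<open>M\<close> on, so it extends by zero to the union of \<open>I\<close> with that level set.
  An element representing the extended family is killed by the level set, hence is torsion.\<close>

lemma baer_tors: "baer_complex G l scale tors X D"
proof (unfold_locales, goal_cases)
  case (12 I f n a)
  then have I: "monoid_ideal Q I" and f: "\<And>q. q \<in> I \<Longrightarrow> f q \<in> tors n (a + q)"
    and fX: "\<And>q b. q \<in> I \<Longrightarrow> b \<in> Q \<Longrightarrow> f (q + b) = X n b (f q)" by auto
  obtain F where F: "finite F" "F \<subseteq> I" "I = {f + b | f b. f \<in> F \<and> b \<in> Q}" using ideal_fg[OF I] .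
  have "\<forall>g\<in>I. \<exists>N. \<forall>q\<in>Q. l q \<ge> N \<longrightarrow> X n q (f g) = 0" using f by (auto simp: tors_def)
  then obtain N where N: "\<And>g q. g \<in> I \<Longrightarrow> q \<in> Q \<Longrightarrow> l q \<ge> N g \<Longrightarrow> X n q (f g) = 0" by metis
  \<comment> \<open>If g + b has level at least \<open>N g + l g\<close>, then l b \<ge>
    \<open>N g\<close>, and b kills \<open>f g\<close>.\<close>
  define M where "M = Max (insert 0 ((\<lambda>g. N g + l g) ` F))"
  have M: "N g + l g \<le> M" if "g \<in> F" for g unfolding M_def using F that by (auto intro!: Max_ge simp del: Max_insert)
  have f0: "f q = 0" if q: "q \<in> I" and lq: "l q \<ge> M" for q
  proof -
    obtain g b where gb: "q = g + b" "g \<in> F" "b \<in> Q" using q F by auto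
    then have "l b \<ge> N g" using M[of g] lq by (simp add: l_add)
    moreover have "g \<in> I" using gb(2) F(2) by blast
    ultimately show ?thesis using N[of g b] gb(1,3) fX[of g b] by simp
  qed
  let ?L = "{q \<in> Q. l q \<ge> M}"
  define f' where "f' q = (if q \<in> I then f q else 0)" for q
  have "\<exists>y\<in>C n a. \<forall>q\<in>I \<union> ?L. X n q y = f' q"
  proof (rule baer)
    show "monoid_ideal Q (I \<union> ?L)" using I monoid_ideal_level by (rule monoid_ideal_union)
    fix q show "q \<in> I \<union> ?L \<Longrightarrow> f' q \<in> C n (a + q)" using f tors_C by (auto simp: f'_def)
    fix b assume q: "q \<in> I \<union> ?L" and b: "b \<in> Q"
    have QI: "q \<in> Q" using q I by (auto simp: monoid_ideal_def)
    show "f' (q + b) = X n b (f' q)"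
    proof (cases "q \<in> I")
      case True
      then have "q + b \<in> I" using I b by (auto simp: monoid_ideal_def)
      then show ?thesis using True fX b by (simp add: f'_def)
    next
      case False
      then have "l (q + b) \<ge> M" using q l_nonneg[OF b] by (auto simp: l_add)
      then show ?thesis using False f0 b by (auto simp: f'_def)
    qed
  qed
  then obtain y where y: "y \<in> C n a" "\<And>q. q \<in> I \<union> ?L \<Longrightarrow> X n q y = f' q" by blast
  have "y \<in> tors n a" by (rule torsI[of _ _ _ M]) (use y f0 in \<open>auto simp: f'_def\<close>)
  then show ?case using y(2) by (intro bexI[of _ y]) (auto simp: f'_def)
qed (blast intro: sub_tors X_tors D_tors X_add X_scale X_0 X_X D_add D_scale D_X D_D dest: tors_C)+

interpretation T: baer_complex G l scale tors X D
  by (rule baer_tors)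

lemma ann_tors_max: "T.ann n (Q - {0}) a = ann n (Q - {0}) a"
proof -
  \<comment> \<open>The level 1 serves to exclude q = 0, whose level is 0.\<close>
  have "y \<in> tors n a" if "y \<in> ann n (Q - {0}) a" for y
    by (rule torsI[of _ _ _ 1]) (use that in \<open>auto simp: ann_def\<close>)
  then show ?thesis by (auto simp: ann_def T.ann_def dest: tors_C)
qed

lemma X_power: "y \<in> C n a \<Longrightarrow> x \<in> Q \<Longrightarrow> \<exists>q\<in>Q. l q = real k * l x \<and> (X n x ^^ k) y = X n q y"
proof (induction k)
  case 0 then show ?case by (intro bexI[of _ 0]) (auto simp: X_0)
next
  case (Suc k)
  then obtain q where "q \<in> Q" "l q = real k * l x" "(X n x ^^ k) y = X n q y" by blast
  moreover from this have "X n (x + q) y = X n x (X n q y)" using Suc.prems X_X by blast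
  ultimately show ?case using Suc.prems(2) by (intro bexI[of _ "x + q"]) (auto simp: l_add distrib_right)
qed

text \<open>Noetherian induction on \<open>I\<close>; choose a nonzero \<open>x \<notin> I\<close>. The base case, where no such \<open>x\<close> exists, is
  the maximal ideal.\<close>

lemma artinian_tors:
  assumes C0: "\<And>a. C 0 a = {0}" and H: "\<And>n. chain_H (\<le>) n {}" and I: "monoid_ideal Q I"
  shows "T.chain_H (\<ge>) n I"
  using I
proof (induction I rule: ideal_induct)
  case (step I)
  note I = step.hyps
  have IQ: "I \<subseteq> Q" using I by (simp add: monoid_ideal_def)
  consider "0 \<in> I" | "I = Q - {0}" | x where "x \<in> Q" "x \<noteq> 0" "x \<notin> I" using IQ by blast
  then show ?case
  proof cases
    \<comment> \<open>Here I is the unit ideal, and 0 acts as the identity, so C[I] is zero.\<close>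
    case 1
    have "N a = {0}" if N: "N \<in> T.Itv n (T.boundaries n I) (T.cycles n I)" for N a
    proof -
      have "y = 0" if "y \<in> N a" for y
        using T.intervalD(3)[OF N, of a] that 1 T.X_0[of y n a] by (auto simp: T.cycles_def T.ann_def)
      then show ?thesis using subspace_0[OF T.intervalD(1)[OF N]] by blast
    qed
    then show ?thesis unfolding T.chain_H_def
      by (intro chain_condition_singleton[where x = "\<lambda>a. {0}"]) (auto simp: fun_eq_iff)
  next
    case 2
    have eq: "T.boundaries n I = boundaries n I" "T.cycles n I = cycles n I"
      unfolding 2 by (auto simp: fun_eq_iff T.boundaries_def boundaries_def T.cycles_def cycles_def ann_tors_max split: nat.split)
    \<comment> \<open>Nonzero elements of Q kill C[m], so every graded subspace is a submodule. The
      noetherian condition thereby becomes one on graded vector spaces, where it implies the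
      artinian one.\<close>
    have "Itv n (boundaries n I) (cycles n I) = interval {} (X n) (boundaries n I) (cycles n I)"
    proof (intro equalityI subsetI)
      fix N assume N: "N \<in> interval {} (X n) (boundaries n I) (cycles n I)"
      note N' = intervalD[OF N]
      show "N \<in> Itv n (boundaries n I) (cycles n I)"
      proof (rule intervalI)
        fix a q y assume q: "q \<in> Q" and y: "y \<in> N a"
        have "y \<in> cycles n I a" using y N' by blast
        then have "y \<in> C n a" "q \<noteq> 0 \<Longrightarrow> X n q y = 0" using q unfolding 2 by (auto simp: cycles_def ann_def)
        then show "X n q y \<in> N (a + q)" using y X_0 subspace_0[OF N'(1)] by (cases "q = 0") auto
      qed (use N' in auto)
    qed (auto simp: interval_def)
    then have "chain_condition (\<ge>) (Itv n (boundaries n I) (cycles n I))"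
      using chain_H_all[OF C0 _ H I, of n] acc_imp_dcc[of "X n" "boundaries n I" "cycles n I"]
        sub_boundaries[OF IQ] sub_cycles[OF IQ] boundaries_cycles[OF IQ] by (simp add: chain_H_def)
    then show ?thesis unfolding T.chain_H_def eq .
  next
    case 3
    have "I \<subset> extend_ideal Q I x"
    proof -
      have "x + 0 \<in> extend_ideal Q I x" unfolding extend_ideal_def by blast
      then show ?thesis using 3 by (auto simp: extend_ideal_def)
    qed
    then have P: "T.chain_H (\<ge>) n (extend_ideal Q I x)" using step.IH monoid_ideal_extend[OF I 3(1)] by blast
    show ?thesis
    proof (cases "colon Q I x = I")
      case True
      show ?thesis
      proof (rule T.chain_H_nilpotent[OF I 3(1) True P])
        fix y a assume "y \<in> T.cycles n I a"
        then have "y \<in> tors n a" by (auto simp: T.cycles_def T.ann_def)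
        then obtain N where N: "y \<in> C n a" "\<And>q. q \<in> Q \<Longrightarrow> l q \<ge> N \<Longrightarrow> X n q y = 0" by (elim torsE) blast
        obtain k where "real k * l x \<ge> N" using l_pos_Q[OF 3(1,2)]
          by (metis ex_less_of_nat_mult less_imp_le)
        then show "\<exists>k. (X n x ^^ k) y = 0" using X_power[OF N(1) 3(1), of k] N(2) by metis
      qed
    next
      case False
      then have "I \<subset> colon Q I x" using colon_mono[OF I 3(1)] by blast
      then have "T.chain_H (\<ge>) n (colon Q I x)" using step.IH monoid_ideal_colon[OF I] by blast
      then show ?thesis using T.chain_H_middle[OF I 3(1)] P by blast
    qed
  qed
qed

end

section \<open>Relative dimension\<close>

definition (in vector_space) adjoin :: "'b set \<Rightarrow> 'b \<Rightarrow> 'b set" where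
  "adjoin Y y = {u + scale c y | u c. u \<in> Y}"

text \<open>The dimension of Z/B, witnessed by a flag from B to Z that grows by one vector at a
  time. Being a relation, it also expresses that the dimension is finite.\<close>

inductive (in vector_space) rdim :: "'b set \<Rightarrow> 'b set \<Rightarrow> nat \<Rightarrow> bool" for B where
  rdim_0: "rdim B B 0"
| rdim_Suc: "rdim B Y n \<Longrightarrow> y \<notin> Y \<Longrightarrow> rdim B (adjoin Y y) (Suc n)"

context vector_space
begin

lemma adjoinI: "u \<in> Y \<Longrightarrow> u + scale c y \<in> adjoin Y y"
  by (auto simp: adjoin_def)

lemma adjoin_sup: "Y \<subseteq> adjoin Y y"
  using adjoinI[of _ Y 0 y] by auto

lemma adjoin_self: "subspace Y \<Longrightarrow> y \<in> adjoin Y y"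
  using adjoinI[of 0 Y 1 y] subspace_0[of Y] by auto

lemma adjoin_min: "subspace Z \<Longrightarrow> Y \<subseteq> Z \<Longrightarrow> y \<in> Z \<Longrightarrow> adjoin Y y \<subseteq> Z"
  by (auto simp: adjoin_def intro: subspace_add subspace_scale)

lemma subspace_adjoin: assumes "subspace Y" shows "subspace (adjoin Y y)"
  unfolding subspace_def
proof (intro conjI ballI allI)
  show "0 \<in> adjoin Y y" using adjoin_sup subspace_0[OF assms] by blast
next
  fix u v assume "u \<in> adjoin Y y" "v \<in> adjoin Y y"
  then obtain u' v' c d where *: "u = u' + scale c y" "v = v' + scale d y" "u' \<in> Y" "v' \<in> Y" by (auto simp: adjoin_def)
  then have "u + v = (u' + v') + scale (c + d) y" by (simp add: algebra_simps)
  then show "u + v \<in> adjoin Y y" using adjoinI[of "u' + v'" Y] * subspace_add[OF assms] by metis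
next
  fix e u assume "u \<in> adjoin Y y"
  then obtain u' c where *: "u = u' + scale c y" "u' \<in> Y" by (auto simp: adjoin_def)
  then have "scale e u = scale e u' + scale (e * c) y" by (simp add: algebra_simps)
  then show "scale e u \<in> adjoin Y y" using adjoinI[of "scale e u'" Y] * subspace_scale[OF assms] by metis
qed

lemma subspace_scaleD: "subspace Y \<Longrightarrow> scale c y \<in> Y \<Longrightarrow> c \<noteq> 0 \<Longrightarrow> y \<in> Y"
  using subspace_scale[of Y "scale c y" "inverse c"] by simp

lemma subspace_addD: "subspace Y \<Longrightarrow> u + v \<in> Y \<Longrightarrow> u \<in> Y \<Longrightarrow> v \<in> Y"
  using subspace_diff[of Y "u + v" u] by simp

lemma rdim_subspace: "rdim B Z n \<Longrightarrow> subspace B \<Longrightarrow> subspace Z"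
  by (induction rule: rdim.induct) (auto simp: subspace_adjoin)

lemma rdim_sup: "rdim B Z n \<Longrightarrow> B \<subseteq> Z"
  by (induction rule: rdim.induct) (use adjoin_sup in blast)+

text \<open>Intersect \<open>Y\<close> with the last but one space of the flag: either
  \<open>Y\<close> is contained in it, or \<open>Y\<close> is the intersection together with one
  further vector. The strict inequality for proper subspaces yields the uniqueness of the
  dimension.\<close>

lemma rdim_sub:
  assumes "rdim B Z n" "subspace B" "subspace Y" "B \<subseteq> Y" "Y \<subseteq> Z"
  shows "\<exists>m\<le>n. rdim B Y m \<and> (Y \<noteq> Z \<longrightarrow> m < n)"
  using assms(1) assms(3-)
proof (induction arbitrary: Y rule: rdim.induct)
  case rdim_0
  then show ?case using rdim.rdim_0 by auto
next
  case (rdim_Suc Z n z)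
  have Z: "subspace Z" "B \<subseteq> Z" using rdim_subspace rdim_sup rdim_Suc.hyps(1) assms(2) by auto
  obtain m where m: "m \<le> n" "rdim B (Y \<inter> Z) m" "Y \<inter> Z \<noteq> Z \<longrightarrow> m < n"
    using rdim_Suc.IH[of "Y \<inter> Z"] rdim_Suc.prems subspace_inter[OF _ Z(1)] Z(2) by auto
  show ?case
  proof (cases "Y \<subseteq> Z")
    case True
    then have "Y \<inter> Z = Y" by blast
    then show ?thesis using m by (intro exI[of _ m]) auto
  next
    case False
    then obtain y where y: "y \<in> Y" "y \<notin> Z" by blast
    have "Y = adjoin (Y \<inter> Z) y"
    proof
      show "adjoin (Y \<inter> Z) y \<subseteq> Y" using adjoin_min rdim_Suc.prems(1) y by blast
      show "Y \<subseteq> adjoin (Y \<inter> Z) y"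
      proof
        fix v assume v: "v \<in> Y"
        obtain u c u' c' where uc: "v = u + scale c z" "u \<in> Z" "y = u' + scale c' z" "u' \<in> Z"
          using v y rdim_Suc.prems(3) unfolding adjoin_def by blast
        then have c': "c' \<noteq> 0" using y by auto
        \<comment> \<open>This multiple of \<open>y\<close> cancels the \<open>z\<close>-component
          of \<open>v\<close>.\<close>
        let ?e = "c / c'"
        have eq: "v - scale ?e y = u - scale ?e u'" using c' uc by (simp add: scale_right_distrib)
        have "v - scale ?e y \<in> Z" unfolding eq using Z uc by (intro subspace_diff subspace_scale) auto
        moreover have "v - scale ?e y \<in> Y" using v y rdim_Suc.prems(1) by (simp add: subspace_diff subspace_scale)
        ultimately have "(v - scale ?e y) + scale ?e y \<in> adjoin (Y \<inter> Z) y" by (intro adjoinI) auto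
        then show "v \<in> adjoin (Y \<inter> Z) y" by simp
      qed
    qed
    then have *: "rdim B Y (Suc m)" using rdim.rdim_Suc[OF m(2), of y] y by auto
    moreover have "m < n" if "Y \<noteq> adjoin Z z"
    proof (rule ccontr)
      assume "\<not> m < n"
      then have "Z \<subseteq> Y" using m by blast
      have "z \<in> Y"
      proof -
        obtain u' c' where uc: "y = u' + scale c' z" "u' \<in> Z" using y rdim_Suc.prems(3) unfolding adjoin_def by blast
        then have "c' \<noteq> 0" using y by auto
        moreover have "scale c' z \<in> Y" using uc y subspace_addD[OF rdim_Suc.prems(1), of u' "scale c' z"] \<open>Z \<subseteq> Y\<close> by auto
        ultimately show ?thesis using subspace_scaleD[OF rdim_Suc.prems(1)] by blast
      qed
      then have "adjoin Z z \<subseteq> Y" using adjoin_min rdim_Suc.prems(1) \<open>Z \<subseteq> Y\<close> by blast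
      then show False using that rdim_Suc.prems(3) by blast
    qed
    ultimately show ?thesis using m(1) by (intro exI[of _ "Suc m"]) auto
  qed
qed

lemma rdim_le: "rdim B Z n \<Longrightarrow> rdim B Z m \<Longrightarrow> subspace B \<Longrightarrow> n \<le> m"
proof (induction arbitrary: m rule: rdim.induct)
  case (rdim_Suc Y n y)
  have "Y \<noteq> adjoin Y y" using rdim_Suc adjoin_self rdim_subspace by blast
  then obtain m' where "m' < m" "rdim B Y m'"
    using rdim_sub[OF rdim_Suc.prems(1,2) rdim_subspace[OF rdim_Suc.hyps(1) rdim_Suc.prems(2)]
        rdim_sup[OF rdim_Suc.hyps(1)] adjoin_sup] by blast
  then show ?case using rdim_Suc.IH[of m'] rdim_Suc.prems by simp
qed simp

lemma rdim_unique: "rdim B Z n \<Longrightarrow> rdim B Z m \<Longrightarrow> subspace B \<Longrightarrow> n = m"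
  using rdim_le by (metis order_antisym)

lemma rdim_trans: "rdim Y Z m \<Longrightarrow> rdim B Y n \<Longrightarrow> rdim B Z (n + m)"
  by (induction rule: rdim.induct) (auto intro: rdim.intros)

text \<open>\<open>f\<close> induces an isomorphism from the quotient of the two preimages onto Y/B,
  surjective by the last assumption.\<close>

lemma rdim_preimage:
  assumes "rdim B Y n" "subspace B" "subspace Z"
    and add: "\<And>x y. x \<in> Z \<Longrightarrow> y \<in> Z \<Longrightarrow> f (x + y) = f x + f y"
    and scal: "\<And>c x. x \<in> Z \<Longrightarrow> f (scale c x) = scale c (f x)"
    and Y: "Y \<subseteq> {f x + b | x b. x \<in> Z \<and> b \<in> B}"
  shows "rdim {x \<in> Z. f x \<in> B} {x \<in> Z. f x \<in> Y} n"
  using assms(1) Y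
proof (induction rule: rdim.induct)
  case rdim_0
  show ?case by (rule rdim.rdim_0)
next
  case (rdim_Suc Y n y)
  have Y: "subspace Y" "B \<subseteq> Y" using rdim_subspace rdim_sup rdim_Suc.hyps(1) assms(2) by auto
  obtain z b where z: "y = f z + b" "z \<in> Z" "b \<in> B"
    using rdim_Suc.prems adjoin_self[OF Y(1)] by blast
  have fz: "f z \<notin> Y" using subspace_add[OF Y(1)] z Y(2) rdim_Suc.hyps(2) by blast
  have comb: "f (x + scale c z) = f x + scale c (f z)" "x + scale c z \<in> Z" if "x \<in> Z" for x c
    using add[of x "scale c z"] scal[of z c] that z subspace_add[OF assms(3)] subspace_scale[OF assms(3)] by auto
  have "{x \<in> Z. f x \<in> adjoin Y y} = adjoin {x \<in> Z. f x \<in> Y} z"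
  proof (intro equalityI subsetI)
    fix x assume "x \<in> {x \<in> Z. f x \<in> adjoin Y y}"
    then obtain u c where x: "x \<in> Z" "f x = u + scale c y" "u \<in> Y" by (auto simp: adjoin_def)
    have "f (x + scale (- c) z) = u + scale c b"
      unfolding comb[OF x(1)] x(2) z(1) by (simp add: scale_right_distrib)
    then have "f (x + scale (- c) z) \<in> Y"
      using x z Y subspace_add[OF Y(1)] subspace_scale[OF Y(1)] by auto
    then have "(x + scale (- c) z) + scale c z \<in> adjoin {x \<in> Z. f x \<in> Y} z"
      using comb(2)[OF x(1), of "- c"] by (intro adjoinI) blast
    then show "x \<in> adjoin {x \<in> Z. f x \<in> Y} z" by simp
  next
    fix x assume "x \<in> adjoin {x \<in> Z. f x \<in> Y} z"
    then obtain u c where x: "x = u + scale c z" "u \<in> Z" "f u \<in> Y" by (auto simp: adjoin_def)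
    have "f x = (f u - scale c b) + scale c y"
      unfolding x(1) comb(1)[OF x(2)] z(1) by (simp add: scale_right_distrib)
    moreover have "f u - scale c b \<in> Y"
      using x z Y subspace_diff[OF Y(1)] subspace_scale[OF Y(1)] by auto
    ultimately have "f x \<in> adjoin Y y" by (simp only: adjoinI)
    then show "x \<in> {x \<in> Z. f x \<in> adjoin Y y}" using comb(2)[OF x(2)] x(1) by simp
  qed
  moreover have "rdim {x \<in> Z. f x \<in> B} {x \<in> Z. f x \<in> Y} n"
    using rdim_Suc.IH rdim_Suc.prems adjoin_sup by blast
  ultimately show ?case using rdim.rdim_Suc[of _ _ n z] fz by simp
qed

lemma rdim_zero_iff: "rdim B Z n \<Longrightarrow> subspace B \<Longrightarrow> n = 0 \<longleftrightarrow> Z = B"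
  by (metis rdim.rdim_0 rdim_unique rdim.cases Zero_not_Suc)

text \<open>Either failure produces a strictly descending chain: infinitely many nonzero degrees are
  removed one by one, and for infinite dimension in one degree one takes the spans of the tails of a
  sequence that is independent modulo B.\<close>

lemma dcc_finite:
  fixes B Z :: "'g::ab_group_add \<Rightarrow> 'b set"
  assumes dcc: "chain_condition (\<ge>) (interval {} Y B Z)"
    and B: "\<And>a. subspace (B a)" and Z: "\<And>a. subspace (Z a)" and BZ: "\<And>a. B a \<subseteq> Z a"
  shows "finite {a. B a \<noteq> Z a}" and "\<exists>n. rdim (B a) (Z a) n"
proof -
  show "finite {a. B a \<noteq> Z a}"
  proof (rule ccontr)
    assume "\<not> ?thesis"
    then obtain d :: "nat \<Rightarrow> 'g" where d: "inj d" "range d \<subseteq> {a. B a \<noteq> Z a}"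
      using infinite_countable_subset by blast
    define f where "f n a = (if a \<in> d ` {n..} then Z a else B a)" for n a
    have "\<exists>n. \<forall>m\<ge>n. f m = f n"
      by (rule chain_conditionD[OF dcc])
        (use B Z BZ in \<open>auto simp: interval_def f_def le_fun_def\<close>)
    then obtain n where "f (Suc n) = f n" by (meson le_SucI order_refl)
    moreover have "f n (d n) = Z (d n)" by (auto simp: f_def)
    moreover have "d n \<notin> d ` {Suc n..}" using d(1) by (auto dest: injD)
    then have "f (Suc n) (d n) = B (d n)" by (simp add: f_def)
    ultimately show False using d(2) by (metis (mono_tags, lifting) mem_Collect_eq range_subsetD)
  qed
next
  show "\<exists>n. rdim (B a) (Z a) n"
  proof (rule ccontr)
    assume no: "\<not> ?thesis"
    have "\<exists>e. e \<in> Z a \<and> e \<notin> V" if "rdim (B a) V n" "V \<subseteq> Z a" for V n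
      using no that by (metis subsetI subset_antisym)
    then obtain c where c: "\<And>V n. rdim (B a) V n \<Longrightarrow> V \<subseteq> Z a \<Longrightarrow> c V \<in> Z a \<and> c V \<notin> V" by metis
    \<comment> \<open>No space of finite dimension over \<open>B a\<close> exhausts
      \<open>Z a\<close>, so a further vector can always be adjoined.\<close>
    define V where "V n = ((\<lambda>V. adjoin V (c V)) ^^ n) (B a)" for n
    define e where "e n = c (V n)" for n
    have V: "rdim (B a) (V n) n \<and> V n \<subseteq> Z a" for n
    proof (induction n)
      case 0
      then show ?case using BZ rdim_0 by (simp add: V_def)
    next
      case (Suc n)
      then show ?case using c[of "V n" n] rdim_Suc[of "B a" "V n" n "c (V n)"] adjoin_min[OF Z] by (auto simp: V_def)
    qed
    have e: "e n \<in> Z a" "e n \<notin> V n" for n using c V unfolding e_def by blast+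
    have VS: "V (Suc n) = adjoin (V n) (e n)" for n by (simp add: V_def e_def)
    have subV: "subspace (V n)" for n using V rdim_subspace B by blast
    have V_mono: "V i \<subseteq> V j" if "i \<le> j" for i j
      using lift_Suc_mono_le[of V, OF _ that] VS adjoin_sup by auto
    have eV: "e i \<in> V j" if "i < j" for i j
      using V_mono[of "Suc i" j] that VS[of i] adjoin_self[OF subV[of i]] by auto
    define f where "f n b = (if b = a then span (B a \<union> e ` {n..}) else B b)" for n b
    have "\<exists>n. \<forall>m\<ge>n. f m = f n"
    proof (rule chain_conditionD[OF dcc])
      fix n
      have "B a \<subseteq> span (B a \<union> e ` {n..})" by (meson Un_upper1 span_superset subset_trans)
      moreover have "span (B a \<union> e ` {n..}) \<subseteq> Z a" by (rule span_minimal[OF _ Z]) (use e BZ in auto)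
      ultimately show "f n \<in> interval {} Y B Z" using B BZ unfolding interval_def by (auto simp: f_def)
      have "span (B a \<union> e ` {Suc n..}) \<subseteq> span (B a \<union> e ` {n..})" by (rule span_mono) auto
      then show "f n \<ge> f (Suc n)" unfolding le_fun_def f_def by auto
    qed
    then obtain n where "f (Suc n) = f n" by (meson le_SucI order_refl)
    then have "f (Suc n) a = f n a" by simp
    moreover have "e n \<in> f n a" unfolding f_def by (auto intro: span_base)
    ultimately have "e n \<in> span (B a \<union> e ` {Suc n..})" by (simp add: f_def)
    then obtain t r where tr: "finite t" "t \<subseteq> B a \<union> e ` {Suc n..}" "e n = (\<Sum>a\<in>t. scale (r a) a)"
      unfolding span_explicit by blast
    \<comment> \<open>A linear relation involves finitely many vectors, so the tail may be cut at
      some \<open>m\<close>.\<close>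
    have "\<exists>m. t \<subseteq> B a \<union> e ` {n<..<m}" using tr(1,2)
    proof (induction t rule: finite_induct)
      case (insert x t)
      then obtain m where m: "t \<subseteq> B a \<union> e ` {n<..<m}" by auto
      have "x \<in> B a \<or> x \<in> e ` {Suc n..}" using insert.prems by blast
      then have "x \<in> B a \<or> (\<exists>i>n. x = e i)" by (auto simp: Suc_le_eq)
      then consider "x \<in> B a" | i where "i > n" "x = e i" by blast
      then show ?case
      proof cases
        case 1 then show ?thesis using m by auto
      next
        case 2
        have "t \<subseteq> B a \<union> e ` {n<..<max m (Suc i)}" using m by fastforce
        then show ?thesis using 2 by (intro exI[of _ "max m (Suc i)"]) auto
      qed
    qed simp
    then obtain m where "t \<subseteq> B a \<union> e ` {n<..<m}" by blast
    then have "e n \<in> span (B a \<union> e ` {n<..<m})"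
      unfolding tr(3) by (intro span_sum span_scale span_base) auto
    moreover have "e n \<notin> span (B a \<union> e ` {n<..<m})"
    proof (induction m)
      case 0
      have "B a \<subseteq> V n" using V rdim_sup by blast
      then have "span (B a) \<subseteq> V n" by (rule span_minimal[OF _ subV])
      then show ?case using e(2)[of n] by auto
    next
      case (Suc m)
      show ?case
      proof (cases "m > n")
        case False
        then have "{n<..<Suc m} = {n<..<m}" by auto
        then show ?thesis using Suc by simp
      next
        case True
        then have eq: "B a \<union> e ` {n<..<Suc m} = insert (e m) (B a \<union> e ` {n<..<m})"
          by (auto simp: less_Suc_eq)
        show ?thesis
        proof
          assume "e n \<in> span (B a \<union> e ` {n<..<Suc m})"
          then obtain c where c: "e n - scale c (e m) \<in> span (B a \<union> e ` {n<..<m})"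
            unfolding eq span_breakdown_eq by blast
          have "span (B a \<union> e ` {n<..<m}) \<subseteq> V m"
            using V[of m] rdim_sup[of "B a" "V m" m] eV by (intro span_minimal[OF _ subV]) auto
          then have "e n - scale c (e m) \<in> V m" using c by blast
          then have "e n - (e n - scale c (e m)) \<in> V m" using eV[OF True] subspace_diff[OF subV] by blast
          then have "scale c (e m) \<in> V m" by simp
          then have "c = 0" using subspace_scaleD[OF subV] e(2) by blast
          then show False using c Suc by simp
        qed
      qed
    qed
    ultimately show False by blast
  qed
qed

text \<open>The vectors of the flag form a basis modulo \<open>B\<close>: the coefficient of the
  last one is forced because it lies outside the preceding space, the others by induction.
  Extensional coefficient functions match \<open>component_basis\<close>.\<close>

lemma rdim_basis:
  assumes "rdim B Z n" "subspace B"
  shows "\<exists>F. finite F \<and> card F = n \<and> F \<subseteq> Z \<and> (\<forall>z\<in>Z. \<exists>!c. c \<in> F \<rightarrow>\<^sub>E UNIV \<and> z - (\<Sum>f\<in>F. scale (c f) f) \<in> B)"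
  using assms(1)
proof (induction rule: rdim.induct)
  case rdim_0
  then show ?case by (intro exI[of _ "{}"]) auto
next
  case (rdim_Suc Y n y)
  then obtain F where F: "finite F" "card F = n" "F \<subseteq> Y"
    and ex: "\<And>z. z \<in> Y \<Longrightarrow> \<exists>!c. c \<in> F \<rightarrow>\<^sub>E UNIV \<and> z - (\<Sum>f\<in>F. scale (c f) f) \<in> B" by auto
  have Y: "subspace Y" "B \<subseteq> Y" using rdim_subspace rdim_sup rdim_Suc.hyps(1) assms(2) by auto
  have yF: "y \<notin> F" using F rdim_Suc.hyps by auto
  have sumY: "(\<Sum>f\<in>F. scale (c f) f) \<in> Y" for c
    using F(3) by (intro subspace_sum[OF Y(1)] subspace_scale[OF Y(1)]) auto
  have "\<exists>!c. c \<in> insert y F \<rightarrow>\<^sub>E UNIV \<and> z - (\<Sum>f\<in>insert y F. scale (c f) f) \<in> B" if zY: "z \<in> adjoin Y y" for z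
  proof -
    obtain u k where z: "z = u + scale k y" "u \<in> Y" using zY by (auto simp: adjoin_def)
    obtain c where c: "c \<in> F \<rightarrow>\<^sub>E UNIV" "u - (\<Sum>f\<in>F. scale (c f) f) \<in> B"
      and uniq: "\<And>c'. c' \<in> F \<rightarrow>\<^sub>E UNIV \<Longrightarrow> u - (\<Sum>f\<in>F. scale (c' f) f) \<in> B \<Longrightarrow> c' = c"
      using ex[OF z(2)] by blast
    have sum_eq: "(\<Sum>f\<in>insert y F. scale (c' f) f) = scale (c' y) y + (\<Sum>f\<in>F. scale (c' f) f)" for c'
      using F(1) yF by simp
    have upd: "(\<Sum>f\<in>F. scale ((c'(y := v)) f) f) = (\<Sum>f\<in>F. scale (c' f) f)" for c' v
      using yF by (intro sum.cong) auto
    show ?thesis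
    proof (rule ex1I[of _ "c(y := k)"], intro conjI)
      show "c(y := k) \<in> insert y F \<rightarrow>\<^sub>E UNIV" using c(1) by (auto simp: PiE_def extensional_def)
      show "z - (\<Sum>f\<in>insert y F. scale ((c(y := k)) f) f) \<in> B"
        unfolding sum_eq upd using c(2) z(1) by (simp add: algebra_simps)
    next
      fix c' assume c': "c' \<in> insert y F \<rightarrow>\<^sub>E UNIV \<and> z - (\<Sum>f\<in>insert y F. scale (c' f) f) \<in> B"
      then have 1: "u + scale (k - c' y) y - (\<Sum>f\<in>F. scale (c' f) f) \<in> B"
        unfolding sum_eq z(1) by (simp add: algebra_simps)
      then have "u + scale (k - c' y) y - (\<Sum>f\<in>F. scale (c' f) f) \<in> Y" using Y(2) by blast
      then have "u - (\<Sum>f\<in>F. scale (c' f) f) + scale (k - c' y) y \<in> Y" by (simp only: diff_add_eq)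
      then have "scale (k - c' y) y \<in> Y" using subspace_addD[OF Y(1)] subspace_diff[OF Y(1) z(2) sumY] by blast
      then have k: "c' y = k" using subspace_scaleD[OF Y(1)] rdim_Suc.hyps(2) by fastforce
      have eq: "c'(y := undefined) = c"
      proof (rule uniq)
        show "c'(y := undefined) \<in> F \<rightarrow>\<^sub>E UNIV" using c' yF by (auto simp: PiE_def extensional_def)
        show "u - (\<Sum>f\<in>F. scale ((c'(y := undefined)) f) f) \<in> B" unfolding upd using 1 k by simp
      qed
      show "c' = c(y := k)"
      proof
        fix x show "c' x = (c(y := k)) x" using k fun_cong[OF eq, of x] by (cases "x = y") auto
      qed
    qed
  qed
  moreover have "insert y F \<subseteq> adjoin Y y" using F(3) adjoin_sup[of Y y] adjoin_self[OF Y(1), of y] by auto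
  ultimately show ?case using F yF by (intro exI[of _ "insert y F"]) auto
qed

end


section \<open>Hilbert series of artinian modules\<close>

text \<open>The coefficients of a series multiplied by the product of the factors 1 -
  t^(-g).\<close>

fun iter_diff :: "'g::ab_group_add list \<Rightarrow> ('g \<Rightarrow> int) \<Rightarrow> 'g \<Rightarrow> int" where
  "iter_diff [] h = h"
| "iter_diff (g # gs) h = iter_diff gs (\<lambda>a. h a - h (a + g))"

lemma iter_diff_shift: "iter_diff gs (\<lambda>a. h a - k (a + g)) a = iter_diff gs h a - iter_diff gs k (a + g)"
proof (induction gs arbitrary: h k)
  case (Cons g' gs)
  show ?case
    using Cons.IH[of "\<lambda>a. h a - h (a + g')" "\<lambda>a. k a - k (a + g')"] by (simp add: algebra_simps)
qed simp

context graded_complex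
begin

text \<open>Induction on the generators: multiplication by \<open>g\<close> on \<open>Z/B\<close> has kernel \<open>K/B\<close> and cokernel \<open>Z/Y\<close>.
  Truncation at a level of \<open>l\<close> is a submodule, so the chain condition bounds the degrees from above and
  dimensions can be found by descending induction on the level.\<close>

lemma hilbert_serre:
  assumes "set gs \<subseteq> G"
    and B: "\<And>a. subspace (B a)" and Z: "\<And>a. subspace (Z a)"
    and BZ: "\<And>a. B a \<subseteq> Z a" and ZC: "\<And>a. Z a \<subseteq> C n a"
    and XB: "\<And>g a x. g \<in> set gs \<Longrightarrow> x \<in> B a \<Longrightarrow> X n g x \<in> B (a + g)"
    and XZ: "\<And>g a x. g \<in> set gs \<Longrightarrow> x \<in> Z a \<Longrightarrow> X n g x \<in> Z (a + g)"
    and dcc: "chain_condition (\<ge>) (interval (set gs) (X n) B Z)"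
  shows "\<exists>h. (\<forall>a. rdim (B a) (Z a) (h a)) \<and>
    (\<exists>F. finite F \<and> (\<forall>a. h a \<noteq> 0 \<longrightarrow> (\<exists>f\<in>F. f - a \<in> Q))) \<and>
    finite {a. iter_diff gs (\<lambda>a. int (h a)) a \<noteq> 0}"
  using assms
proof (induction gs arbitrary: B Z)
  case Nil
  have dcc: "chain_condition (\<ge>) (interval {} (X n) B Z)" using Nil by simp
  from dcc_finite[OF this Nil.prems(2-4)]
  have fin: "finite {a. B a \<noteq> Z a}" and ex: "\<And>a. \<exists>n. rdim (B a) (Z a) n" by auto
  from ex obtain h where h: "\<And>a. rdim (B a) (Z a) (h a)" by metis
  have supp: "{a. h a \<noteq> 0} = {a. B a \<noteq> Z a}" using rdim_zero_iff[OF h Nil.prems(2)] by auto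
  have "\<forall>a. h a \<noteq> 0 \<longrightarrow> (\<exists>f\<in>{a. B a \<noteq> Z a}. f - a \<in> Q)"
  proof (intro allI impI)
    fix a assume "h a \<noteq> 0"
    then have "a \<in> {a. B a \<noteq> Z a}" using supp by blast
    then show "\<exists>f\<in>{a. B a \<noteq> Z a}. f - a \<in> Q" by (rule bexI[rotated]) simp
  qed
  then show ?case
    using h fin supp by (intro exI[of _ h] conjI allI exI[of _ "{a. B a \<noteq> Z a}"]) simp_all
next
  case (Cons g gs)
  note B = Cons.prems(2) and Z = Cons.prems(3) and BZ = Cons.prems(4) and ZC = Cons.prems(5)
    and XB = Cons.prems(6) and XZ = Cons.prems(7) and dcc = Cons.prems(8)
  have gG: "g \<in> G" and gQ: "g \<in> Q" and gsQ: "\<And>h. h \<in> set gs \<Longrightarrow> h \<in> Q" using Cons.prems(1) G_Q by auto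
  have lg: "l g > 0" using l_pos gG by blast
  have addZ: "X n g (x + y) = X n g x + X n g y" if "x \<in> Z a" "y \<in> Z a" for x y a
    using that ZC[of a] X_add[OF gQ] by blast
  have scaleZ: "X n g (c *s x) = c *s X n g x" if "x \<in> Z a" for c x a
    using that ZC[of a] X_scale[OF gQ] by blast
  have commZ: "X n h (X n g x) = X n g (X n h x)" if "x \<in> Z a" "h \<in> set gs" for x h a
    using that ZC[of a] X_X[OF gQ gsQ, of h x n a] X_X[OF gsQ gQ, of h x n a] by (auto simp: add.commute)
  define K where "K a = {z \<in> Z a. X n g z \<in> B (a + g)}" for a
  define Y where "Y a = {X n g x + b | x b. x \<in> Z (a - g) \<and> b \<in> B a}" for a
  have XgZ: "X n g x \<in> Z a" if "x \<in> Z (a - g)" for x a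
    using XZ[of g x "a - g"] that by simp
  have BK: "B a \<subseteq> K a" and KZ: "K a \<subseteq> Z a" for a using BZ XB by (auto simp: K_def)
  have subK: "subspace (K a)" for a
    using Z[of a] B[of "a + g"] unfolding K_def subspace_def by (auto simp: addZ scaleZ X_zero[OF gQ])
  have subI: "subspace (X n g ` Z (a - g))" for a by (rule sub_X_image[OF Z ZC gQ])
  have Y_alt: "Y a = {u + b | u b. u \<in> X n g ` Z (a - g) \<and> b \<in> B a}" for a unfolding Y_def by auto
  have subY: "subspace (Y a)" for a unfolding Y_alt by (rule subspace_sums[OF subI B])
  have BY: "B a \<subseteq> Y a" for a unfolding Y_alt using subspace_0[OF subI] by force
  have YZ: "Y a \<subseteq> Z a" for a
    unfolding Y_def using XgZ BZ subspace_add[OF Z] by blast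
  have XgY: "X n g x \<in> Y (a + g)" if "x \<in> Z a" for x a
    using that subspace_0[OF B[of "a + g"]] unfolding Y_def by force
  have "\<exists>h. (\<forall>a. rdim (B a) (K a) (h a)) \<and>
    (\<exists>F. finite F \<and> (\<forall>a. h a \<noteq> 0 \<longrightarrow> (\<exists>f\<in>F. f - a \<in> Q))) \<and>
    finite {a. iter_diff gs (\<lambda>a. int (h a)) a \<noteq> 0}"
  proof (rule Cons.IH)
    \<comment> \<open>\<open>g\<close> maps \<open>K\<close> into \<open>B\<close>, so between
      \<open>B\<close> and \<open>K\<close> stability under \<open>gs\<close> entails stability
      under \<open>g\<close>.\<close>
    show "chain_condition (\<ge>) (interval (set gs) (X n) B K)"
    proof (rule chain_condition_inj[OF dcc, of _ "\<lambda>N. N"])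
      fix N assume "N \<in> interval (set gs) (X n) B K"
      then show "N \<in> interval (set (g # gs)) (X n) B Z"
        unfolding interval_def K_def by (fastforce simp: subset_iff)
    qed auto
    show "X n h x \<in> K (a + h)" if "h \<in> set gs" "x \<in> K a" for h a x
    proof -
      have "X n g x \<in> B (a + g)" "x \<in> Z a" using that by (auto simp: K_def)
      then have "X n h (X n g x) \<in> B (a + g + h)" "X n h x \<in> Z (a + h)" using XB[of h] XZ[of h] that by auto
      then show ?thesis using commZ[OF \<open>x \<in> Z a\<close> that(1)] by (auto simp: K_def add.assoc add.commute[of g])
    qed
  qed (use Cons.prems BK KZ subK in \<open>auto simp: subset_iff\<close>)
  then obtain k Fk where k: "\<And>a. rdim (B a) (K a) (k a)"
    and Fk: "finite Fk" "\<And>a. k a \<noteq> 0 \<Longrightarrow> \<exists>f\<in>Fk. f - a \<in> Q"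
    and fk: "finite {a. iter_diff gs (\<lambda>a. int (k a)) a \<noteq> 0}" by blast
  have "\<exists>h. (\<forall>a. rdim (Y a) (Z a) (h a)) \<and>
    (\<exists>F. finite F \<and> (\<forall>a. h a \<noteq> 0 \<longrightarrow> (\<exists>f\<in>F. f - a \<in> Q))) \<and>
    finite {a. iter_diff gs (\<lambda>a. int (h a)) a \<noteq> 0}"
  proof (rule Cons.IH)
    \<comment> \<open>\<open>g\<close> maps \<open>Z\<close> into \<open>Y\<close>, so stability
      under \<open>g\<close> is again automatic.\<close>
    show "chain_condition (\<ge>) (interval (set gs) (X n) Y Z)"
    proof (rule chain_condition_inj[OF dcc, of _ "\<lambda>N. N"])
      fix N assume N: "N \<in> interval (set gs) (X n) Y Z"
      note N = intervalD[OF N]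
      show "N \<in> interval (set (g # gs)) (X n) B Z"
      proof (rule intervalI)
        fix h x a assume "h \<in> set (g # gs)" "x \<in> N a"
        then show "X n h x \<in> N (a + h)"
          using N(4)[of h x a] XgY[of x a] N(2)[of "a + g"] N(3)[of a] by auto
      qed (use N BY in blast)+
    qed auto
    show "X n h y \<in> Y (a + h)" if "h \<in> set gs" "y \<in> Y a" for h a y
    proof -
      obtain x b where xb: "y = X n g x + b" "x \<in> Z (a - g)" "b \<in> B a" using \<open>y \<in> Y a\<close> by (auto simp: Y_def)
      have "X n h x \<in> Z (a + h - g)" using XZ[of h x "a - g"] xb that by (simp add: algebra_simps)
      moreover have "X n h b \<in> B (a + h)" using XB that xb by auto
      moreover have "X n h y = X n g (X n h x) + X n h b"
        using X_add[OF gsQ[OF that(1)], of "X n g x" n a b] XgZ[OF xb(2)] BZ[of a] ZC[of a] xb commZ[OF xb(2) that(1)]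
        by (auto simp: subset_iff)
      ultimately show ?thesis unfolding Y_def by blast
    qed
  qed (use Cons.prems YZ BY subY in \<open>auto simp: subset_iff\<close>)
  then obtain c where c: "\<And>a. rdim (Y a) (Z a) (c a)"
    and fc: "finite {a. iter_diff gs (\<lambda>a. int (c a)) a \<noteq> 0}" by blast
  define T where "T j a = (if l a \<ge> real j then Z a else B a)" for j :: nat and a
  have "\<exists>j. \<forall>m\<ge>j. T m = T j"
  proof (rule chain_conditionD[OF dcc])
    fix j
    show "T j \<in> interval (set (g # gs)) (X n) B Z"
    proof (rule intervalI)
      fix h x a assume h: "h \<in> set (g # gs)" and x: "x \<in> T j a"
      have "h \<in> Q" using h Cons.prems(1) G_Q by blast
      then have "l (a + h) \<ge> l a" using l_nonneg by (simp add: l_add)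
      moreover have "x \<in> B a \<Longrightarrow> X n h x \<in> Z (a + h)" using XB[OF h] BZ by blast
      ultimately show "X n h x \<in> T j (a + h)"
        using x XB[OF h] XZ[OF h] unfolding T_def by (auto split: if_splits)
    qed (use B Z BZ in \<open>auto simp: T_def\<close>)
    show "T j \<ge> T (Suc j)" using BZ unfolding T_def le_fun_def by auto
  qed
  then obtain j where j: "\<And>m. m \<ge> j \<Longrightarrow> T m = T j" by blast
  have top: "Z a = B a" if a: "l a \<ge> real j" for a
  proof -
    obtain m :: nat where m: "l a < real m" using reals_Archimedean2 by blast
    then have "T m a = B a" by (simp add: T_def)
    moreover have "T j a = Z a" using a by (simp add: T_def)
    moreover have "m \<ge> j" using m a by linarith
    ultimately show ?thesis using j by metis
  qed
  \<comment> \<open>\<open>r\<close> is the rank of multiplication by g, read off at both ends: as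
    dimension of Z/K in degree a and of Y/B in degree a + g.\<close>
  have pre: "\<exists>r. rdim (K a) (Z a) r \<and> rdim (B (a + g)) (Z (a + g)) (r + c (a + g))"
    if hh: "rdim (B (a + g)) (Z (a + g)) h" for a h
  proof -
    obtain r where r: "rdim (B (a + g)) (Y (a + g)) r" using rdim_sub[OF hh B subY BY YZ] by blast
    have "rdim {x \<in> Z a. X n g x \<in> B (a + g)} {x \<in> Z a. X n g x \<in> Y (a + g)} r"
      by (rule rdim_preimage[OF r B Z addZ scaleZ]) (auto simp: Y_def)
    moreover have "{x \<in> Z a. X n g x \<in> Y (a + g)} = Z a" using XgY by blast
    ultimately show ?thesis using rdim_trans[OF c r] by (auto simp: K_def)
  qed
  have bound: "\<exists>m::nat. l a + real m * l g \<ge> real j" for a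
  proof -
    obtain m :: nat where "real m * l g > real j - l a" using ex_less_of_nat_mult[OF lg] by blast
    then show ?thesis by (intro exI[of _ m]) linarith
  qed
  \<comment> \<open>\<open>m\<close> is a number of steps by \<open>g\<close> after which level
    \<open>j\<close> is reached, where Z/B vanishes.\<close>
  have "\<exists>h. rdim (B a) (Z a) h" if "l a + real m * l g \<ge> real j" for a and m :: nat
    using that
  proof (induction m arbitrary: a)
    case 0
    then show ?case using top[of a] rdim_0[of "B a"] by auto
  next
    case (Suc m)
    have "real j \<le> l (a + g) + real m * l g" using Suc.prems by (simp add: l_add algebra_simps)
    then obtain h where "rdim (B (a + g)) (Z (a + g)) h" using Suc.IH by blast
    then show ?case using pre rdim_trans k by blast
  qed
  then have "\<forall>a. \<exists>h. rdim (B a) (Z a) h" using bound by blast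
  then obtain h where h: "\<And>a. rdim (B a) (Z a) (h a)" by metis
  have rel: "\<exists>r. h a = k a + r \<and> h (a + g) = r + c (a + g)" for a
  proof -
    obtain r where r: "rdim (K a) (Z a) r" "rdim (B (a + g)) (Z (a + g)) (r + c (a + g))"
      using pre[OF h[of "a + g"]] by blast
    have "h a = k a + r" by (rule rdim_unique[OF h rdim_trans[OF r(1) k] B])
    moreover have "h (a + g) = r + c (a + g)" by (rule rdim_unique[OF h r(2) B])
    ultimately show ?thesis by blast
  qed
  \<comment> \<open>If \<open>k a = 0\<close>, then h a = r \<le> h (a + g), so a nonzero value
    moves up by \<open>g\<close> until it meets the support of the kernel. Hence the bound
    \<open>Fk\<close> for the kernel serves for Z/B too.\<close>
  have supp: "\<exists>f\<in>Fk. f - a \<in> Q" if "h a \<noteq> 0" "l a + real m * l g \<ge> real j" for a and m :: nat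
    using that
  proof (induction m arbitrary: a)
    case 0
    then show ?case using top[of a] rdim_zero_iff[OF h B] by auto
  next
    case (Suc m)
    show ?case
    proof (cases "k a = 0")
      case True
      then have "h (a + g) \<noteq> 0" using rel[of a] Suc.prems by auto
      moreover have "real j \<le> l (a + g) + real m * l g" using Suc.prems by (simp add: l_add algebra_simps)
      ultimately obtain f where f: "f \<in> Fk" "f - (a + g) \<in> Q" using Suc.IH by blast
      then have "(f - (a + g)) + g \<in> Q" using gQ by blast
      then show ?thesis using f by auto
    qed (use Fk in blast)
  qed
  \<comment> \<open>The alternating sum of dimensions in 0 -> K/B -> Z/B -> Z/B -> Z/Y -> 0, whose
    middle map raises degrees by g.\<close>
  have "iter_diff (g # gs) (\<lambda>a. int (h a)) a = iter_diff gs (\<lambda>a. int (k a)) a - iter_diff gs (\<lambda>a. int (c a)) (a + g)" for a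
  proof -
    have "int (h a) - int (h (a + g)) = int (k a) - int (c (a + g))" for a using rel[of a] by auto
    then have "iter_diff (g # gs) (\<lambda>a. int (h a)) a = iter_diff gs (\<lambda>a. int (k a) - int (c (a + g))) a" by simp
    also have "\<dots> = iter_diff gs (\<lambda>a. int (k a)) a - iter_diff gs (\<lambda>a. int (c a)) (a + g)"
      by (rule iter_diff_shift)
    finally show ?thesis .
  qed
  then have "{a. iter_diff (g # gs) (\<lambda>a. int (h a)) a \<noteq> 0} \<subseteq>
      {a. iter_diff gs (\<lambda>a. int (k a)) a \<noteq> 0} \<union> (\<lambda>b. b - g) ` {a. iter_diff gs (\<lambda>a. int (c a)) a \<noteq> 0}"
    by (auto simp: image_iff) (metis add_diff_cancel_right')
  then have "finite {a. iter_diff (g # gs) (\<lambda>a. int (h a)) a \<noteq> 0}" using fk fc finite_subset by blast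
  moreover have "\<forall>a. h a \<noteq> 0 \<longrightarrow> (\<exists>f\<in>Fk. f - a \<in> Q)" using supp bound by blast
  ultimately show ?case using h Fk(1) by blast
qed

end

section \<open>Pointed cones and rational functions\<close>

lemma real_vec_add: "real_vec (a + b) = real_vec a + real_vec b"
  and real_vec_minus: "real_vec (- a) = - real_vec a"
  and real_vec_0: "real_vec 0 = 0"
  by (simp_all add: real_vec_def vec_eq_iff)

lemma real_vec_eq_0_iff: "real_vec a = 0 \<longleftrightarrow> a = 0"
  by (simp add: real_vec_def vec_eq_iff)

text \<open>All nonzero elements of the cone are positive under \<open>v\<close>, so 0 is not inside
  a segment of the cone. A nonzero point a is the midpoint of 0 and 2a, so it is no face.\<close>

lemma pointed_cone_hull:
  fixes A :: "(real ^ 'd) set"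
  assumes "\<And>x. x \<in> A \<Longrightarrow> v \<bullet> x > 0"
  shows "pointed_cone (convex_cone hull A)"
proof -
  let ?C = "convex_cone hull A"
  have "convex_cone {x. x = 0 \<or> v \<bullet> x > 0}"
    unfolding convex_cone_iff by (auto simp: inner_simps intro: add_pos_pos mult_pos_pos) 
  then have "?C \<subseteq> {x. x = 0 \<or> v \<bullet> x > 0}" by (intro hull_minimal) (use assms in auto)
  then have pos: "x = 0 \<or> v \<bullet> x > 0" if "x \<in> ?C" for x using that by blast
  have "{0} face_of ?C"
    unfolding face_of_def
  proof (intro conjI ballI impI)
    fix a b x assume ab: "a \<in> ?C" "b \<in> ?C" and "x \<in> {0}" "x \<in> open_segment a b"
    then obtain u where u: "a \<noteq> b" "0 < u" "u < 1" "(1 - u) *\<^sub>R a + u *\<^sub>R b = 0"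
      unfolding in_segment by auto
    have "(1 - u) * (v \<bullet> a) + u * (v \<bullet> b) = v \<bullet> ((1 - u) *\<^sub>R a + u *\<^sub>R b)" by (simp add: inner_simps)
    then have s: "(1 - u) * (v \<bullet> a) + u * (v \<bullet> b) = 0" using u(4) by simp
    have n: "v \<bullet> a \<ge> 0" "v \<bullet> b \<ge> 0" using pos[OF ab(1)] pos[OF ab(2)] by auto
    then have "(1 - u) * (v \<bullet> a) \<ge> 0" "u * (v \<bullet> b) \<ge> 0" using u by auto
    with s have "(1 - u) * (v \<bullet> a) = 0" "u * (v \<bullet> b) = 0" by linarith+
    then have "v \<bullet> a = 0" "v \<bullet> b = 0" using u by auto
    then show "a \<in> {0}" "b \<in> {0}" using pos[OF ab(1)] pos[OF ab(2)] by auto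
  qed (auto simp: convex_cone_hull_contains_0)
  moreover have "F = {0}" if F: "F face_of ?C" "aff_dim F = 0" for F
  proof -
    obtain a where a: "F = {a}" using F aff_dim_eq_0 by blast
    show ?thesis
    proof (rule ccontr)
      assume "F \<noteq> {0}"
      then have "a \<noteq> 0" using a by simp
      have "a \<in> ?C" using F a face_of_imp_subset by blast
      then have "2 *\<^sub>R a \<in> ?C" by (intro convex_cone_hull_mul) auto
      moreover have "a \<in> open_segment 0 (2 *\<^sub>R a)"
        unfolding in_segment using \<open>a \<noteq> 0\<close> by (intro conjI exI[of _ "1/2"]) simp_all
      ultimately have "0 \<in> F" using F(1) a convex_cone_hull_contains_0[of A] unfolding face_of_def by blast
      then show False using a \<open>a \<noteq> 0\<close> by simp
    qed
  qed
  moreover have "aff_dim {0::real ^ 'd} = 0" by simp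
  ultimately show ?thesis unfolding pointed_cone_def by blast
qed

text \<open>If 0 were a convex combination of \<open>A\<close>, some nonzero vector and its negative
  would both lie in the cone, with 0 between them, against {0} being a face. So 0 can be strictly
  separated from the compact convex hull of \<open>A\<close>.\<close>

lemma pointed_functional:
  fixes A B :: "(real ^ 'd) set"
  assumes "pointed_cone (convex_cone hull B)" "finite A" "0 \<notin> A" "A \<subseteq> B"
  shows "\<exists>v. \<forall>x\<in>A. v \<bullet> x > 0"
proof -
  let ?C = "convex_cone hull B"
  have face: "{0} face_of ?C" using assms(1) unfolding pointed_cone_def by blast
  have "0 \<notin> convex hull A"
  proof
    assume "0 \<in> convex hull A"
    then obtain u where u: "\<forall>x\<in>A. 0 \<le> u x" "sum u A = 1" "(\<Sum>x\<in>A. u x *\<^sub>R x) = 0"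
      unfolding convex_hull_finite[OF assms(2)] by auto
    have "\<exists>x\<in>A. u x \<noteq> 0"
    proof (rule ccontr)
      assume "\<not> ?thesis"
      then have "sum u A = 0" by (intro sum.neutral) auto
      then show False using u(2) by simp
    qed
    then obtain x where x: "x \<in> A" "u x > 0" using u(1) by (metis order_le_less)
    have inC: "y \<in> ?C" if "y \<in> A" for y using that assms(4) by (intro hull_inc) blast
    have sumC: "(\<Sum>x\<in>S. u x *\<^sub>R x) \<in> ?C" if "S \<subseteq> A" for S
      using finite_subset[OF that assms(2)] that
      by (induction S rule: finite_induct)
        (auto simp: convex_cone_hull_contains_0 u(1) inC intro!: convex_cone_hull_add convex_cone_hull_mul)
    have "(\<Sum>x\<in>A. u x *\<^sub>R x) = u x *\<^sub>R x + (\<Sum>x\<in>A - {x}. u x *\<^sub>R x)"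
      using assms(2) x(1) by (rule sum.remove)
    then have "(\<Sum>x\<in>A - {x}. u x *\<^sub>R x) = - (u x *\<^sub>R x)" using u(3) by (simp add: eq_neg_iff_add_eq_0 add.commute)
    then have c: "- (u x *\<^sub>R x) \<in> ?C" using sumC[of "A - {x}"] by auto
    have c': "u x *\<^sub>R x \<in> ?C" using x inC by (intro convex_cone_hull_mul) auto
    have x0: "u x *\<^sub>R x \<noteq> 0" using x assms(3) by auto
    have "u x *\<^sub>R x \<noteq> - (u x *\<^sub>R x)"
    proof
      assume "u x *\<^sub>R x = - (u x *\<^sub>R x)"
      then have "2 *\<^sub>R (u x *\<^sub>R x) = 0" unfolding scaleR_2 by (metis add.right_inverse)
      then show False using x0 by simp
    qed
    then have "0 \<in> open_segment (u x *\<^sub>R x) (- (u x *\<^sub>R x))"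
      unfolding in_segment by (intro conjI exI[of _ "1/2"]) simp_all
    then have "u x *\<^sub>R x \<in> {0}" using face c c' unfolding face_of_def by blast
    then show False using x0 by simp
  qed
  moreover have "closed (convex hull A)" using assms(2) by (simp add: compact_imp_closed finite_imp_compact_convex_hull)
  ultimately obtain v b where "b > 0" "\<forall>x\<in>convex hull A. v \<bullet> x > b"
    using separating_hyperplane_closed_0[of "convex hull A"] by auto
  then show ?thesis by (metis hull_inc less_trans)
qed

abbreviation keys :: "('g \<Rightarrow>\<^sub>0 'k::zero) \<Rightarrow> 'g set" where "keys \<equiv> Poly_Mapping.keys"
abbreviation lookup :: "('g \<Rightarrow>\<^sub>0 'k::zero) \<Rightarrow> 'g \<Rightarrow> 'k" where "lookup \<equiv> Poly_Mapping.lookup"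
abbreviation mon :: "'g \<Rightarrow> 'k \<Rightarrow> 'g \<Rightarrow>\<^sub>0 'k::zero" where "mon \<equiv> Poly_Mapping.single"

definition poly_act :: "(rat, 'd) laurent \<Rightarrow> (int ^ 'd \<Rightarrow> rat) \<Rightarrow> int ^ 'd \<Rightarrow> rat" where
  "poly_act q S a = (\<Sum>b\<in>keys q. lookup q b * S (a - b))"

definition denom :: "(int ^ 'd) list \<Rightarrow> (rat, 'd) laurent" where
  "denom gs = foldr (\<lambda>g q. q * (1 - mon (- g) 1)) gs 1"

lemma lookup_mult_single:
  fixes f :: "('a::ab_group_add) \<Rightarrow>\<^sub>0 ('b::comm_ring_1)"
  shows "lookup (f * mon c r) k = lookup f (k - c) * r"
proof -
  have "(\<Sum>q. lookup (mon c r) q when k = x + q) = (r when x = k - c)" for x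
  proof -
    have "(\<Sum>q. lookup (mon c r) q when k = x + q)
        = (\<Sum>q. (r when k = x + q) when c = q)"
      by (intro Sum_any.cong) (simp add: lookup_single when_def)
    also have "\<dots> = (r when k = x + c)" by simp
    finally show ?thesis by (auto simp: when_def algebra_simps)
  qed
  then show ?thesis by (simp add: lookup_mult mult_when)
qed

lemma lookup_denom_Cons:
  "lookup (denom (g # gs)) b = lookup (denom gs) b - lookup (denom gs) (b + g)"
proof -
  have "denom (g # gs) = denom gs - denom gs * mon (- g) 1"
    by (simp add: denom_def algebra_simps)
  then show ?thesis by (simp add: lookup_minus lookup_mult_single)
qed

lemma poly_act_superset:
  "finite A \<Longrightarrow> keys q \<subseteq> A \<Longrightarrow> poly_act q S a = (\<Sum>b\<in>A. lookup q b * S (a - b))"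
  unfolding poly_act_def by (rule sum.mono_neutral_left) (auto simp: in_keys_iff)

lemma poly_act_denom_Cons:
  "poly_act (denom (g # gs)) S a = poly_act (denom gs) S a - poly_act (denom gs) S (a + g)"
proof -
  let ?q = "denom gs"
  \<comment> \<open>\<open>A\<close> contains the exponents of \<open>denom gs\<close> and of its
    shift, so that both sums run over one index set.\<close>
  define A where "A = keys ?q \<union> (\<lambda>b. b - g) ` keys ?q"
  have A: "finite A" "keys ?q \<subseteq> A" "keys ?q \<subseteq> (\<lambda>b. b + g) ` A"
    unfolding A_def by (auto simp: image_Un image_image)
  have "keys (denom (g # gs)) \<subseteq> A"
  proof
    fix b assume "b \<in> keys (denom (g # gs))"
    then have "b \<in> keys ?q \<or> b + g \<in> keys ?q"
      by (auto simp: in_keys_iff lookup_denom_Cons)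
    then show "b \<in> A" unfolding A_def by (metis UnI1 UnI2 add_diff_cancel_right' imageI)
  qed
  then have "poly_act (denom (g # gs)) S a = (\<Sum>b\<in>A. (lookup ?q b - lookup ?q (b + g)) * S (a - b))"
    using poly_act_superset[OF A(1)] by (simp add: lookup_denom_Cons)
  also have "\<dots> = (\<Sum>b\<in>A. lookup ?q b * S (a - b)) - (\<Sum>b\<in>A. lookup ?q (b + g) * S (a - b))"
    by (simp add: algebra_simps sum_subtractf)
  also have "(\<Sum>b\<in>A. lookup ?q b * S (a - b)) = poly_act ?q S a"
    using poly_act_superset[OF A(1,2)] by simp
  also have "(\<Sum>b\<in>A. lookup ?q (b + g) * S (a - b)) = (\<Sum>b\<in>(\<lambda>b. b + g) ` A. lookup ?q b * S (a + g - b))"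
    by (subst sum.reindex) (auto simp: inj_on_def)
  also have "\<dots> = poly_act ?q S (a + g)"
    using poly_act_superset[OF _ A(3)] A(1) by simp
  finally show ?thesis .
qed

text \<open>Where the iterated difference has finite support, this says that the series times
  \<open>denom gs\<close> is a Laurent polynomial.\<close>

lemma poly_act_denom: "poly_act (denom gs) (\<lambda>a. of_int (h a)) a = of_int (iter_diff gs h a)"
proof (induction gs arbitrary: h a)
  case Nil
  then show ?case by (simp add: poly_act_def denom_def)
next
  case (Cons g gs)
  have "iter_diff (g # gs) h a = iter_diff gs h a - iter_diff gs h (a + g)"
    using iter_diff_shift[of gs h h g a] by simp
  then show ?case by (simp add: poly_act_denom_Cons Cons.IH)
qed

text \<open>The constant term stays 1 under multiplication by 1 - t^(-g), because all other
  exponents are negative under \<open>m\<close> and cannot interfere with it.\<close>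

lemma denom_nonzero:
  fixes gs :: "(int ^ 'd) list" and m :: "int ^ 'd \<Rightarrow> real"
  assumes "\<And>g. g \<in> set gs \<Longrightarrow> m g > 0" "\<And>a b. m (a + b) = m a + m b"
  shows "denom gs \<noteq> 0"
proof -
  have m0: "m 0 = 0" using assms(2)[of 0 0] by simp
  have "lookup (denom gs) 0 = 1 \<and> (\<forall>b. lookup (denom gs) b \<noteq> 0 \<longrightarrow> b = 0 \<or> m b < 0)"
    using assms(1)
  proof (induction gs)
    case Nil
    then show ?case by (auto simp: denom_def lookup_one when_def)
  next
    case (Cons g gs)
    then have IH: "lookup (denom gs) 0 = 1" "\<And>b. lookup (denom gs) b \<noteq> 0 \<Longrightarrow> b = 0 \<or> m b < 0"
      and g: "m g > 0" by auto
    have "lookup (denom gs) g = 0" using IH(2)[of g] g m0 by force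
    moreover have "b = 0 \<or> m b < 0" if "lookup (denom gs) (b + g) \<noteq> 0" for b
      using IH(2)[OF that] assms(2)[of b g] g m0 by auto
    moreover have "lookup (denom gs) b \<noteq> 0 \<or> lookup (denom gs) (b + g) \<noteq> 0"
      if "lookup (denom (g # gs)) b \<noteq> 0" for b
      using that by (auto simp: lookup_denom_Cons)
    ultimately show ?case using IH by (metis add_0 diff_zero lookup_denom_Cons)
  qed
  then show ?thesis by auto
qed

text \<open>The translate is chosen far in the direction \<open>e\<close>, so that the differences \<open>f - b\<close> can be added to the
  generators of the cone without destroying pointedness.\<close>

lemma rational_series:
  fixes h :: "int ^ 'd \<Rightarrow> nat" and v :: "real ^ 'd"
  assumes G: "\<And>g. g \<in> set gs \<Longrightarrow> v \<bullet> real_vec g > 0" and e: "v \<bullet> real_vec e > 0"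
    and fin: "finite {a. iter_diff gs (\<lambda>a. int (h a)) a \<noteq> 0}"
    and F: "finite F" "\<And>a. h a \<noteq> 0 \<Longrightarrow> \<exists>f\<in>F. f - a \<in> additive_submonoid hull (set gs)"
  shows "formal_sum_of_rational_functions (\<lambda>a. of_nat (h a))"
proof -
  interpret pos_monoid "set gs" "\<lambda>a. v \<bullet> real_vec a"
    by unfold_locales (auto simp: real_vec_add inner_simps G)
  let ?p = "Abs_poly_mapping (\<lambda>a. rat_of_int (iter_diff gs (\<lambda>a. int (h a)) a))"
  have p: "lookup ?p a = rat_of_int (iter_diff gs (\<lambda>a. int (h a)) a)" for a
    using fin by simp
  have act: "poly_act (denom gs) (\<lambda>a. of_nat (h a)) a = lookup ?p a" for a
    unfolding p using poly_act_denom[of gs "\<lambda>a. int (h a)" a] by simp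
  obtain N :: nat where N: "\<And>f. f \<in> F \<Longrightarrow> v \<bullet> real_vec f < real N * (v \<bullet> real_vec e)"
  proof -
    obtain M where M: "\<And>f. f \<in> F \<Longrightarrow> v \<bullet> real_vec f \<le> M"
      using F(1) by (metis (no_types, lifting) Max_ge finite_imageI imageI)
    obtain N :: nat where "real N * (v \<bullet> real_vec e) > M" using ex_less_of_nat_mult[OF e] by blast
    then show ?thesis using that M by (meson le_less_trans)
  qed
  define b where "b = (\<chi> j. int N * e $ j)"
  have b: "real_vec b = real N *\<^sub>R real_vec e" by (simp add: b_def real_vec_def vec_eq_iff)
  define A where "A = uminus ` set gs \<union> (\<lambda>f. f - b) ` F"
  have "pointed_cone (real_cone A)"
    unfolding real_cone_def
  proof (rule pointed_cone_hull[where v = "- v"])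
    fix x assume "x \<in> real_vec ` A"
    then consider g where "g \<in> set gs" "x = real_vec (- g)" | f where "f \<in> F" "x = real_vec (f - b)"
      unfolding A_def by blast
    then show "- v \<bullet> x > 0"
    proof cases
      case 1 then show ?thesis using G by (simp add: real_vec_minus)
    next
      case 2
      have "real_vec (f - b) = real_vec f - real_vec b" using real_vec_add[of "f - b" b] by simp
      then show ?thesis using N[OF 2(1)] 2 b by (simp add: inner_simps)
    qed
  qed
  \<comment> \<open>Write a - b = (f - b) - (f - a): the first term is a generator of the cone, and
    f - a lies in the monoid.\<close>
  moreover have "real_vec (a - b) \<in> real_cone A" if ha: "rat_of_nat (h a) \<noteq> 0" for a
  proof -
    have "real_vec (- q) \<in> real_cone A" if "q \<in> Q" for q
      using that
    proof (induction rule: Q_induct)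
      case zero then show ?case by (simp add: real_cone_def real_vec_0 convex_cone_hull_contains_0)
    next
      case (add g q)
      have "real_vec (- g) \<in> real_cone A" unfolding real_cone_def A_def using add by (intro hull_inc) auto
      then have "real_vec (- g) + real_vec (- q) \<in> real_cone A"
        using add.IH convex_cone_hull_add unfolding real_cone_def by blast
      then show ?case by (simp add: real_vec_add[symmetric] add.commute)
    qed
    moreover obtain f where f: "f \<in> F" "f - a \<in> Q" using F(2)[of a] ha unfolding Q_def by auto
    moreover have "real_vec (f - b) \<in> real_cone A" unfolding real_cone_def A_def using f by (intro hull_inc) auto
    ultimately have "real_vec (f - b) + real_vec (- (f - a)) \<in> real_cone A"
      using convex_cone_hull_add unfolding real_cone_def by blast
    then show ?thesis by (simp add: real_vec_add[symmetric])
  qed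
  moreover have "finite A" unfolding A_def using F(1) by simp
  moreover have "denom gs \<noteq> 0"
    using denom_nonzero[of gs "\<lambda>a. v \<bullet> real_vec a"] G l_add by blast
  ultimately have "expansion_of ?p (denom gs) (\<lambda>a. of_nat (h a))"
    unfolding expansion_of_def using act unfolding poly_act_def by blast
  then have "\<exists>p q. expansion_of p q (\<lambda>a. of_nat (h a))" by blast
  then show ?thesis unfolding formal_sum_of_rational_functions_def
    by (intro exI[of _ 1] exI[of _ "\<lambda>_ a. of_nat (h a)"]) auto
qed

section \<open>Finitely generated graded modules are noetherian\<close>

context graded_complex
begin

text \<open>The graded submodule generated by \<open>Y\<close>. Generators carry their degree, since
  the spaces of different degrees are not disjoint as sets.\<close>

definition gspan :: "nat \<Rightarrow> ('g \<times> 'w) set \<Rightarrow> 'g \<Rightarrow> 'w set" where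
  "gspan n Y a = span {X n (a - b) y | b y. (b, y) \<in> Y \<and> a - b \<in> Q}"

lemma gspan_C:
  assumes "\<And>b y. (b, y) \<in> Y \<Longrightarrow> y \<in> C n b" shows "gspan n Y a \<subseteq> C n a"
  unfolding gspan_def
proof (rule span_minimal[OF _ sub_C], clarify)
  fix b y assume "(b, y) \<in> Y" "a - b \<in> Q"
  then show "X n (a - b) y \<in> C n a" using X_in[of "a - b" y n b] assms by simp
qed

lemma X_gspan:
  assumes Y: "\<And>b y. (b, y) \<in> Y \<Longrightarrow> y \<in> C n b" and q: "q \<in> Q" and x: "x \<in> gspan n Y a"
  shows "X n q x \<in> gspan n Y (a + q)"
proof -
  have "x \<in> {x \<in> C n a. X n q x \<in> gspan n Y (a + q)}"
    using x unfolding gspan_def[of n Y a]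
  proof (rule subsetD[OF span_minimal, rotated 2])
    have "subspace (gspan n Y (a + q))" by (simp add: gspan_def)
    then show "subspace {x \<in> C n a. X n q x \<in> gspan n Y (a + q)}"
      using sub_C[of n a] unfolding subspace_def by (auto simp: X_add[OF q] X_scale[OF q] X_zero[OF q])
    show "{X n (a - b) y |b y. (b, y) \<in> Y \<and> a - b \<in> Q} \<subseteq> {x \<in> C n a. X n q x \<in> gspan n Y (a + q)}"
    proof clarify
      fix b y assume bY: "(b, y) \<in> Y" "a - b \<in> Q"
      have eq: "X n q (X n (a - b) y) = X n (a + q - b) y"
        using X_X[OF q bY(2) Y[OF bY(1)]] by (simp add: algebra_simps)
      have "a + q - b = q + (a - b)" by simp
      then have "a + q - b \<in> Q" using q bY(2) Q_add by metis
      then have "X n (a + q - b) y \<in> gspan n Y (a + q)" unfolding gspan_def using bY(1) by (intro span_base) blast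
      then show "X n (a - b) y \<in> C n a \<and> X n q (X n (a - b) y) \<in> gspan n Y (a + q)"
        using eq X_in[OF bY(2) Y[OF bY(1)]] by simp
    qed
  qed
  then show ?thesis by blast
qed

text \<open>The last generator \<open>y\<close> spans a cyclic module over the span of the others. A
  graded submodule leaves there the ideal \<open>\<psi>\<close> of those q for which it contains X q
  y up to the others; such ideals satisfy the ascending chain condition.\<close>

lemma noetherian_gspan:
  assumes "finite Y" "\<And>b y. (b, y) \<in> Y \<Longrightarrow> y \<in> C n b"
  shows "chain_condition (\<le>) (Itv n (\<lambda>a. {0}) (gspan n Y))"
  using assms
proof (induction Y rule: finite_induct)
  case empty
  have "N = (\<lambda>a. {0})" if N: "N \<in> Itv n (\<lambda>a. {0}) (gspan n {})" for N
  proof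
    fix a show "N a = {0}" using intervalD(2,3)[OF N, of a] by (auto simp: gspan_def)
  qed
  then show ?case by (intro chain_condition_singleton[where x = "\<lambda>a. {0}"]) blast
next
  case (insert z Y)
  obtain b y where z: "z = (b, y)" by (cases z)
  have y: "y \<in> C n b" and Y: "\<And>b y. (b, y) \<in> Y \<Longrightarrow> y \<in> C n b" using insert.prems z by auto
  let ?Y = "insert z Y"
  have sub: "subspace (gspan n Y a)" for a by (simp add: gspan_def)
  have in_iff: "x \<in> gspan n ?Y a \<longleftrightarrow> (if a - b \<in> Q then \<exists>c. x - c *s X n (a - b) y \<in> gspan n Y a else x \<in> gspan n Y a)" for x a
  proof -
    have "{X n (a - b') y' |b' y'. (b', y') \<in> ?Y \<and> a - b' \<in> Q} = (if a - b \<in> Q then insert (X n (a - b) y) else (\<lambda>x. x))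
        {X n (a - b') y' |b' y'. (b', y') \<in> Y \<and> a - b' \<in> Q}"
      by (auto simp: z)
    then show ?thesis unfolding gspan_def by (simp add: span_breakdown_eq)
  qed
  let ?S = "Itv n (\<lambda>a. {0}) (gspan n ?Y)"
  define \<phi> where "\<phi> N a = N a \<inter> gspan n Y a" for N :: "'g \<Rightarrow> 'w set" and a
  define \<psi> where "\<psi> N = {q \<in> Q. \<exists>u\<in>gspan n Y (b + q). X n q y + u \<in> N (b + q)}" for N :: "'g \<Rightarrow> 'w set"
  show ?case
  proof (rule chain_condition_two[OF insert.IH[OF Y] chain_condition_ideals, of _ \<phi> \<psi>])
    fix N assume "N \<in> ?S"
    note N = intervalD[OF this]
    show "\<phi> N \<in> Itv n (\<lambda>a. {0}) (gspan n Y)"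
      by (rule intervalI) (use N subspace_inter[OF N(1) sub] X_gspan[OF Y] sub[THEN subspace_0] in \<open>auto simp: \<phi>_def\<close>)
    show "\<psi> N \<in> {I. monoid_ideal Q I}"
      unfolding monoid_ideal_def mem_Collect_eq
    proof (intro conjI ballI)
      fix q r assume "q \<in> \<psi> N" and r: "r \<in> Q"
      then obtain u where q: "q \<in> Q" "u \<in> gspan n Y (b + q)" "X n q y + u \<in> N (b + q)" by (auto simp: \<psi>_def)
      have "u \<in> C n (b + q)" using q gspan_C[of Y n, OF Y] by blast
      then have "X n r (X n q y + u) = X n (q + r) y + X n r u"
        using X_add[OF r X_in[OF q(1) y]] X_X[OF r q(1) y] by (simp add: add.commute)
      moreover have "X n r (X n q y + u) \<in> N (b + q + r)" using N(4) r q by blast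
      moreover have "X n r u \<in> gspan n Y (b + q + r)" using X_gspan[OF Y r q(2)] by simp
      ultimately show "q + r \<in> \<psi> N" using q r unfolding \<psi>_def by (auto simp: add.assoc)
    qed (auto simp: \<psi>_def)
  next
    fix N N' assume N: "N \<in> ?S" and N': "N' \<in> ?S" and le: "N \<le> N'"
    show "\<phi> N \<le> \<phi> N'" "\<psi> N \<le> \<psi> N'" using le unfolding \<phi>_def \<psi>_def le_fun_def by blast+
    assume eq: "\<phi> N = \<phi> N'" "\<psi> N = \<psi> N'"
    note N = intervalD[OF N] and N' = intervalD[OF N']
    have "x \<in> N a" if x: "x \<in> N' a" for a x
    proof (cases "x \<in> gspan n Y a")
      case True
      then have "x \<in> \<phi> N' a" using x by (simp add: \<phi>_def)
      then show ?thesis using eq(1) by (metis IntE \<phi>_def)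
    next
      case False
      have "x \<in> gspan n ?Y a" using N'(3) x by blast
      then obtain c where q: "a - b \<in> Q" and c: "x - c *s X n (a - b) y \<in> gspan n Y a"
        using False in_iff[of x a] by (auto split: if_splits)
      have c0: "c \<noteq> 0" using c False by auto
      \<comment> \<open>Rescaled so that \<open>y\<close> has coefficient 1, as in the definition of
        \<open>\<psi>\<close>.\<close>
      let ?u = "inverse c *s (x - c *s X n (a - b) y)"
      have "?u \<in> gspan n Y (b + (a - b))" using c subspace_scale[OF sub] by simp
      moreover have "X n (a - b) y + ?u = inverse c *s x" using c0 by (simp add: scale_right_diff_distrib)
      then have "X n (a - b) y + ?u \<in> N' (b + (a - b))" using x subspace_scale[OF N'(1)] by simp
      ultimately have "a - b \<in> \<psi> N'" using q unfolding \<psi>_def by blast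
      then have "a - b \<in> \<psi> N" using eq by simp
      then obtain v where v: "v \<in> gspan n Y a" "X n (a - b) y + v \<in> N a" unfolding \<psi>_def by auto
      have vc: "c *s (X n (a - b) y + v) \<in> N a" using v subspace_scale[OF N(1)] by blast
      then have "c *s (X n (a - b) y + v) \<in> N' a" using le by (auto simp: le_fun_def)
      then have "x - c *s (X n (a - b) y + v) \<in> N' a" using x subspace_diff[OF N'(1)] by blast
      moreover have eq': "x - c *s (X n (a - b) y + v) = (x - c *s X n (a - b) y) - c *s v"
        by (simp add: scale_right_distrib)
      have "x - c *s (X n (a - b) y + v) \<in> gspan n Y a"
        unfolding eq' by (rule subspace_diff[OF sub c subspace_scale[OF sub v(1)]])
      ultimately have "x - c *s (X n (a - b) y + v) \<in> \<phi> N' a" by (simp add: \<phi>_def)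
      then have "x - c *s (X n (a - b) y + v) \<in> N a" using eq(1) by (metis IntE \<phi>_def)
      then show ?thesis using vc subspace_add[OF N(1), of "x - c *s (X n (a - b) y + v)" a "c *s (X n (a - b) y + v)"] by simp
    qed
    then show "N = N'" using le by (auto simp: le_fun_def fun_eq_iff)
  qed
qed

end

context baer_complex
begin

interpretation T: baer_complex G l scale tors X D
  by (rule baer_tors)

lemma hilbert_function_tors:
  assumes C0: "\<And>a. C 0 a = {0}" and H: "\<And>n. chain_H (\<le>) n {}" and gs: "set gs = G"
  shows "\<exists>h. (\<forall>a. rdim (T.boundaries n {} a) (T.cycles n {} a) (h a)) \<and>
    (\<exists>F. finite F \<and> (\<forall>a. h a \<noteq> 0 \<longrightarrow> (\<exists>f\<in>F. f - a \<in> Q))) \<and>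
    finite {a. iter_diff gs (\<lambda>a. int (h a)) a \<noteq> 0}"
proof (rule T.hilbert_serre)
  have dcc: "chain_condition (\<ge>) (Itv n (T.boundaries n {}) (T.cycles n {}))"
    using artinian_tors[OF C0 H monoid_ideal_empty] unfolding T.chain_H_def .
  \<comment> \<open>Stability under the generators gives stability under all of Q, so the artinian
    condition on Q-submodules is the one that \<open>hilbert_serre\<close> asks for.\<close>
  have "N \<in> Itv n (T.boundaries n {}) (T.cycles n {})"
    if N: "N \<in> interval (set gs) (X n) (T.boundaries n {}) (T.cycles n {})" for N
  proof (rule intervalI)
    note N' = intervalD[OF N]
    fix a q x assume q: "q \<in> Q" and x: "x \<in> N a"
    have NC: "N a \<subseteq> C n a" for a using N'(3)[of a] T.cycles_C[of n "{}" a] tors_C by blast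
    show "X n q x \<in> N (a + q)" using q
    proof (induction rule: Q_induct)
      case zero
      have "x \<in> C n a" using x NC by blast
      then show ?case using x X_0 by simp
    next
      case (add g q)
      have "x \<in> C n a" using x NC by blast
      then have "X n (g + q) x = X n g (X n q x)" using X_X[OF G_Q] add by blast
      then show ?case using N'(4)[of g "X n q x" "a + q"] add gs by (simp add: add.assoc add.commute[of g])
    qed
  qed (use intervalD[OF N] in auto)
  then show "chain_condition (\<ge>) (interval (set gs) (X n) (T.boundaries n {}) (T.cycles n {}))"
    by (intro chain_condition_inj[OF dcc, of _ "\<lambda>N. N"]) auto
qed (use gs T.sub_boundaries T.sub_cycles T.boundaries_cycles T.cycles_C T.X_boundaries T.X_cycles G_Q in auto)

end

section \<open>Embedding modules into a vector space\<close>

text \<open>Extend a basis of \<open>B\<close> to the whole space, kill the basis of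
  \<open>B\<close> and fix the added vectors. The image is a copy of the quotient inside the same
  type.\<close>

lemma (in vector_space) exists_linear_with_kernel:
  assumes "subspace B"
  shows "\<exists>p. (\<forall>x y. p (x + y) = p x + p y) \<and> (\<forall>c x. p (scale c x) = scale c (p x)) \<and>
    (\<forall>x. p x = 0 \<longleftrightarrow> x \<in> B)"
proof -
  interpret vector_space_pair scale scale by unfold_locales
  obtain b where b: "b \<subseteq> B" "independent b" "B \<subseteq> span b"
    using maximal_independent_subset[of B] by blast
  have spb: "span b = B" using b span_minimal[OF b(1) assms] by blast
  define E where "E = extend_basis b"
  have E: "independent E" "b \<subseteq> E" "span E = UNIV"
    using b(2) independent_extend_basis extend_basis_superset span_extend_basis by (auto simp: E_def)
  define g where "g v = (if v \<in> b then 0 else v)" for v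
  define p where "p = construct E g"
  have lin: "Vector_Spaces.linear scale scale p" unfolding p_def by (rule linear_construct[OF E(1)])
  have add: "p (x + y) = p x + p y" and scl: "p (scale c x) = scale c (p x)" for x y c
    using linear_add[OF lin] linear_scale[OF lin] by auto
  have pE: "v \<in> E \<Longrightarrow> p v = g v" for v unfolding p_def by (rule construct_basis[OF E(1)])
  have 1: "p x = 0" if "x \<in> span b" for x
    by (rule linear_eq_0_on_span[OF lin _ that]) (use pE E(2) in \<open>auto simp: g_def\<close>)
  have 2: "p x = x" if "x \<in> span (E - b)" for x
    by (rule linear_eq_on_span[OF lin linear_id _ that, unfolded id_apply]) (use pE in \<open>auto simp: g_def\<close>)
  have "x \<in> B" if "p x = 0" for x
  proof -
    have "E = b \<union> (E - b)" using E(2) by blast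
    then have "x \<in> span (b \<union> (E - b))" using E(3) by auto
    then obtain u w where x: "x = u + w" "u \<in> span b" "w \<in> span (E - b)" unfolding span_Un by blast
    then have "w = 0" using that 1 2 add by simp
    then show ?thesis using x spb by simp
  qed
  then show ?thesis using add scl 1 spb by (intro exI[of _ p]) auto
qed

definition fscale :: "'k::field \<Rightarrow> ('m \<Rightarrow> 'k) \<Rightarrow> 'm \<Rightarrow> 'k" where
  "fscale c f = (\<lambda>x. c * f x)"

interpretation fvs: vector_space fscale
  by unfold_locales (auto simp: fscale_def fun_eq_iff algebra_simps)

lemma carrier_semigroup_ring: "carrier (semigroup_ring Q) = {f. keys f \<subseteq> Q}"
  and mult_semigroup_ring: "mult (semigroup_ring Q) = (*)"
  and one_semigroup_ring: "one (semigroup_ring Q) = 1"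
  and zero_semigroup_ring: "zero (semigroup_ring Q) = 0"
  and add_semigroup_ring: "add (semigroup_ring Q) = (+)"
  by (simp_all add: semigroup_ring_def)

lemmas semigroup_ring_simps = carrier_semigroup_ring mult_semigroup_ring one_semigroup_ring zero_semigroup_ring add_semigroup_ring


lemma poly_mapping_keys_induct [consumes 1, case_names zero single add]:
  fixes f :: "'a \<Rightarrow>\<^sub>0 'b::ab_group_add"
  assumes "keys f \<subseteq> I"
    and "P 0" "\<And>q c. q \<in> I \<Longrightarrow> P (mon q c)"
    and add: "\<And>f g. keys f \<subseteq> I \<Longrightarrow> keys g \<subseteq> I \<Longrightarrow> P f \<Longrightarrow> P g \<Longrightarrow> P (f + g)"
  shows "P f"
proof -
  have "P f" if "finite A" "keys f \<subseteq> A" "A \<subseteq> I" for A f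
    using that
  proof (induction A arbitrary: f rule: finite_induct)
    case empty
    then show ?case using assms(2) by simp
  next
    case (insert q A)
    let ?g = "f - mon q (lookup f q)"
    have "lookup ?g x = (if x = q then 0 else lookup f x)" for x
      by (auto simp: lookup_minus lookup_single when_def)
    then have "x \<noteq> q \<and> x \<in> keys f" if "x \<in> keys ?g" for x
      using that by (auto simp: in_keys_iff split: if_splits)
    then have k: "keys ?g \<subseteq> A"
      using insert.prems by blast
    then have "P ?g" using insert.IH insert.prems by blast
    moreover have "keys (mon q (lookup f q)) \<subseteq> I" using insert.prems by auto
    ultimately have "P (?g + mon q (lookup f q))"
      using k insert.prems assms(3) by (intro add) auto
    then show ?case by simp
  qed
  then show ?thesis using assms(1) finite_keys by blast
qed

context graded_module
begin

lemma zero_in_Q: "0 \<in> Q"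
  using R.one_closed by (simp add: semigroup_ring_simps)

lemma mon_R: "q \<in> Q \<Longrightarrow> mon q c \<in> carrier (semigroup_ring Q)"
  by (simp add: semigroup_ring_simps)

lemma const_R [simp, intro]: "mon 0 c \<in> carrier (semigroup_ring Q)"
  using mon_R zero_in_Q by blast

definition ev :: "('m \<Rightarrow> 'k) \<Rightarrow> 'm" where
  "ev f = (\<Oplus>\<^bsub>M\<^esub>x\<in>{x. f x \<noteq> 0}. mon 0 (f x) \<odot>\<^bsub>M\<^esub> x)"

lemma ev_superset:
  assumes "finite A" "{x. f x \<noteq> 0} \<subseteq> A" "A \<subseteq> carrier M"
  shows "ev f = (\<Oplus>\<^bsub>M\<^esub>x\<in>A. mon 0 (f x) \<odot>\<^bsub>M\<^esub> x)"
  unfolding ev_def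
proof (rule M.add.finprod_mono_neutral_cong_left)
  fix x assume "x \<in> A - {x. f x \<noteq> 0}"
  then have "x \<in> carrier M" "f x = 0" using assms by auto
  then show "mon 0 (f x) \<odot>\<^bsub>M\<^esub> x = \<zero>\<^bsub>M\<^esub>" using smult_l_null[of x] by (simp add: semigroup_ring_simps)
qed (use assms in auto)

lemma ev_add:
  assumes "finite {x. f x \<noteq> 0}" "{x. f x \<noteq> 0} \<subseteq> carrier M" "finite {x. g x \<noteq> 0}" "{x. g x \<noteq> 0} \<subseteq> carrier M"
  shows "ev (f + g) = ev f \<oplus>\<^bsub>M\<^esub> ev g"
proof -
  let ?A = "{x. f x \<noteq> 0} \<union> {x. g x \<noteq> 0}"
  have A: "finite ?A" "?A \<subseteq> carrier M" using assms by auto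
  have "ev (f + g) = (\<Oplus>\<^bsub>M\<^esub>x\<in>?A. mon 0 ((f + g) x) \<odot>\<^bsub>M\<^esub> x)"
    using A by (intro ev_superset) auto
  also have "\<dots> = (\<Oplus>\<^bsub>M\<^esub>x\<in>?A. mon 0 (f x) \<odot>\<^bsub>M\<^esub> x \<oplus>\<^bsub>M\<^esub> mon 0 (g x) \<odot>\<^bsub>M\<^esub> x)"
  proof (rule M.add.finprod_cong')
    fix x assume "x \<in> ?A"
    then have "x \<in> carrier M" using A by blast
    then show "mon 0 ((f + g) x) \<odot>\<^bsub>M\<^esub> x = mon 0 (f x) \<odot>\<^bsub>M\<^esub> x \<oplus>\<^bsub>M\<^esub> mon 0 (g x) \<odot>\<^bsub>M\<^esub> x"
      using smult_l_distr[of "mon 0 (f x)" "mon 0 (g x)" x] by (simp add: semigroup_ring_simps(5) single_add)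
  qed (use A in auto)
  also have "\<dots> = (\<Oplus>\<^bsub>M\<^esub>x\<in>?A. mon 0 (f x) \<odot>\<^bsub>M\<^esub> x) \<oplus>\<^bsub>M\<^esub> (\<Oplus>\<^bsub>M\<^esub>x\<in>?A. mon 0 (g x) \<odot>\<^bsub>M\<^esub> x)"
    using A by (intro M.add.finprod_multf) auto
  also have "(\<Oplus>\<^bsub>M\<^esub>x\<in>?A. mon 0 (f x) \<odot>\<^bsub>M\<^esub> x) = ev f" using A by (intro ev_superset[symmetric]) auto
  also have "(\<Oplus>\<^bsub>M\<^esub>x\<in>?A. mon 0 (g x) \<odot>\<^bsub>M\<^esub> x) = ev g" using A by (intro ev_superset[symmetric]) auto
  finally show ?thesis .
qed

lemma ev_scale:
  assumes "finite {x. f x \<noteq> 0}" "{x. f x \<noteq> 0} \<subseteq> carrier M"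
  shows "ev (fscale c f) = mon 0 c \<odot>\<^bsub>M\<^esub> ev f"
proof -
  let ?A = "{x. f x \<noteq> 0}"
  have "ev (fscale c f) = (\<Oplus>\<^bsub>M\<^esub>x\<in>?A. mon 0 (c * f x) \<odot>\<^bsub>M\<^esub> x)"
    using ev_superset[of ?A "fscale c f"] assms by (auto simp: fscale_def)
  also have "\<dots> = (\<Oplus>\<^bsub>M\<^esub>x\<in>?A. mon 0 c \<odot>\<^bsub>M\<^esub> (mon 0 (f x) \<odot>\<^bsub>M\<^esub> x))"
  proof (rule M.add.finprod_cong')
    fix x assume "x \<in> ?A"
    then have "x \<in> carrier M" using assms by blast
    then show "mon 0 (c * f x) \<odot>\<^bsub>M\<^esub> x = mon 0 c \<odot>\<^bsub>M\<^esub> (mon 0 (f x) \<odot>\<^bsub>M\<^esub> x)"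
      using smult_assoc1[of "mon 0 c" "mon 0 (f x)" x] by (simp add: semigroup_ring_simps(2) mult_single)
  qed (use assms in auto)
  also have "\<dots> = mon 0 c \<odot>\<^bsub>M\<^esub> ev f"
    unfolding ev_def using assms by (intro finsum_smult_ldistr[symmetric]) auto
  finally show ?thesis .
qed

text \<open>Linear algebra is available for type classes only. A module is therefore embedded into
  \<open>'m \<Rightarrow> 'k\<close>: the finitely supported functions on it, modulo linear relations, form a space isomorphic
  to it, and the quotient is realised by a linear map whose kernel is the space of relations.\<close>

lemma embedding_exists:
  "\<exists>\<phi> :: 'm \<Rightarrow> 'm \<Rightarrow> 'k. inj_on \<phi> (carrier M) \<and>
     (\<forall>x\<in>carrier M. \<forall>y\<in>carrier M. \<phi> (x \<oplus>\<^bsub>M\<^esub> y) = \<phi> x + \<phi> y) \<and>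
     (\<forall>c. \<forall>x\<in>carrier M. \<phi> (mon 0 c \<odot>\<^bsub>M\<^esub> x) = fscale c (\<phi> x))"
proof -
  define Fin :: "('m \<Rightarrow> 'k) set" where "Fin = {f. finite {x. f x \<noteq> 0} \<and> {x. f x \<noteq> 0} \<subseteq> carrier M}"
  have Fin_add: "f + g \<in> Fin" if "f \<in> Fin" "g \<in> Fin" for f g
  proof -
    have sub: "{x. (f + g) x \<noteq> 0} \<subseteq> {x. f x \<noteq> 0} \<union> {x. g x \<noteq> 0}" by auto
    have "finite ({x. f x \<noteq> 0} \<union> {x. g x \<noteq> 0})" using that by (simp add: Fin_def)
    then show ?thesis using that finite_subset[OF sub] sub unfolding Fin_def by blast
  qed
  have Fin_scale: "fscale c f \<in> Fin" if "f \<in> Fin" for c f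
  proof -
    have sub: "{x. fscale c f x \<noteq> 0} \<subseteq> {x. f x \<noteq> 0}" by (auto simp: fscale_def)
    then show ?thesis using that finite_subset[OF sub] unfolding Fin_def by blast
  qed
  have eva: "ev (f + g) = ev f \<oplus>\<^bsub>M\<^esub> ev g" if "f \<in> Fin" "g \<in> Fin" for f g
    using that ev_add by (auto simp: Fin_def)
  have evs: "ev (fscale c f) = mon 0 c \<odot>\<^bsub>M\<^esub> ev f" if "f \<in> Fin" for c f
    using that ev_scale by (auto simp: Fin_def)
  have evc: "ev f \<in> carrier M" if "f \<in> Fin" for f
    unfolding ev_def using that by (intro M.finsum_closed) (auto simp: Fin_def)
  let ?K = "{f \<in> Fin. ev f = \<zero>\<^bsub>M\<^esub>}"
  have "fvs.subspace ?K"
    unfolding fvs.subspace_def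
  proof (intro conjI ballI allI)
    show "0 \<in> ?K" by (auto simp: Fin_def ev_def)
  qed (auto simp: Fin_add Fin_scale eva evs)
  from fvs.exists_linear_with_kernel[OF this] obtain p :: "('m \<Rightarrow> 'k) \<Rightarrow> 'm \<Rightarrow> 'k"
    where p: "\<And>x y. p (x + y) = p x + p y" "\<And>c x. p (fscale c x) = fscale c (p x)" "\<And>x. p x = 0 \<longleftrightarrow> x \<in> ?K"
    by blast
  \<comment> \<open>\<open>p\<close> identifies two formal combinations exactly when they have the
    same value in \<open>M\<close>; so \<open>p\<close> composed with the point masses
    \<open>\<delta>\<close> is additive and injective, although \<open>\<delta>\<close> is not
    additive.\<close>
  have peq: "p f = p g \<longleftrightarrow> ev f = ev g" if fg: "f \<in> Fin" "g \<in> Fin" for f g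
  proof -
    have eq: "f - g = f + fscale (- 1) g" by (rule ext) (simp add: fscale_def)
    have mem: "f - g \<in> Fin" unfolding eq by (rule Fin_add[OF fg(1) Fin_scale[OF fg(2)]])
    have "p f = p g \<longleftrightarrow> p (f - g) = 0" using p(1)[of "f - g" g] by simp
    also have "\<dots> \<longleftrightarrow> ev (f - g) = \<zero>\<^bsub>M\<^esub>" unfolding p(3) using mem by blast
    also have "ev (f - g) = ev f \<oplus>\<^bsub>M\<^esub> mon 0 (- 1) \<odot>\<^bsub>M\<^esub> ev g" unfolding eq eva[OF fg(1) Fin_scale[OF fg(2)]] evs[OF fg(2)] ..
    also have "mon 0 (- 1) \<odot>\<^bsub>M\<^esub> ev g = \<ominus>\<^bsub>M\<^esub> ev g"
    proof -
      have "mon 0 (1::'k) \<odot>\<^bsub>M\<^esub> ev g = ev g" using smult_one[OF evc[OF fg(2)]] by (simp add: semigroup_ring_simps)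
      moreover have "mon 0 (1::'k) + mon 0 (- 1) = (0::(int ^ 'd) \<Rightarrow>\<^sub>0 'k)"
        by (metis add.right_inverse single_add single_zero)
      ultimately have "ev g \<oplus>\<^bsub>M\<^esub> mon 0 (- 1) \<odot>\<^bsub>M\<^esub> ev g = 0 \<odot>\<^bsub>M\<^esub> ev g"
        using smult_l_distr[OF const_R const_R evc[OF fg(2)], of 1 "- 1"] unfolding semigroup_ring_simps(5) by metis
      also have "\<dots> = \<zero>\<^bsub>M\<^esub>" using smult_l_null[OF evc[OF fg(2)]] by (simp add: semigroup_ring_simps)
      finally show ?thesis using evc[OF fg(2)] by (metis M.minus_equality M.a_comm const_R smult_closed)
    qed
    also have "ev f \<oplus>\<^bsub>M\<^esub> \<ominus>\<^bsub>M\<^esub> ev g = \<zero>\<^bsub>M\<^esub> \<longleftrightarrow> ev f = ev g"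
      using evc[OF fg(1)] evc[OF fg(2)] by (metis M.r_neg M.minus_equality M.minus_minus M.a_inv_closed)
    finally show ?thesis .
  qed
  define \<delta> :: "'m \<Rightarrow> 'm \<Rightarrow> 'k" where "\<delta> x y = (if y = x then 1 else 0)" for x y
  have \<delta>_Fin: "\<delta> x \<in> Fin" if "x \<in> carrier M" for x
    using that by (auto simp: Fin_def \<delta>_def)
  have ev_\<delta>: "ev (\<delta> x) = x" if x: "x \<in> carrier M" for x
  proof -
    have "ev (\<delta> x) = (\<Oplus>\<^bsub>M\<^esub>y\<in>{x}. mon 0 (\<delta> x y) \<odot>\<^bsub>M\<^esub> y)"
      using x by (intro ev_superset) (auto simp: \<delta>_def)
    also have "\<dots> = mon 0 (\<delta> x x) \<odot>\<^bsub>M\<^esub> x"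
      using x M.finsum_insert[of "{}" x "\<lambda>y. mon 0 (\<delta> x y) \<odot>\<^bsub>M\<^esub> y"] by simp
    also have "\<dots> = x" using smult_one[OF x] by (simp add: semigroup_ring_simps \<delta>_def)
    finally show ?thesis .
  qed
  show ?thesis
  proof (intro exI[of _ "\<lambda>x. p (\<delta> x)"] conjI ballI allI)
    show "inj_on (\<lambda>x. p (\<delta> x)) (carrier M)"
      by (rule inj_onI) (simp add: peq \<delta>_Fin ev_\<delta>)
  next
    fix x y assume "x \<in> carrier M" "y \<in> carrier M"
    then show "p (\<delta> (x \<oplus>\<^bsub>M\<^esub> y)) = p (\<delta> x) + p (\<delta> y)"
      unfolding p(1)[symmetric] by (subst peq) (auto simp: \<delta>_Fin Fin_add eva ev_\<delta>)
  next
    fix c x assume "x \<in> carrier M"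
    then show "p (\<delta> (mon 0 c \<odot>\<^bsub>M\<^esub> x)) = fscale c (p (\<delta> x))"
      unfolding p(2)[symmetric] by (subst peq) (auto simp: \<delta>_Fin Fin_scale evs ev_\<delta>)
  qed
qed

end

section \<open>Homogeneous components\<close>

locale decomposition =
  fixes U :: "'w::ab_group_add set" and V :: "'g::ab_group_add \<Rightarrow> 'w set"
  assumes U_0: "0 \<in> U" and U_add: "x \<in> U \<Longrightarrow> y \<in> U \<Longrightarrow> x + y \<in> U"
    and V_U: "V a \<subseteq> U" and V_0: "0 \<in> V a" and V_add: "x \<in> V a \<Longrightarrow> y \<in> V a \<Longrightarrow> x + y \<in> V a"
    and decomp: "x \<in> U \<Longrightarrow> \<exists>!c. (\<forall>a. c a \<in> V a) \<and> finite {a. c a \<noteq> 0} \<and> x = (\<Sum>a\<in>{a. c a \<noteq> 0}. c a)"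
begin

definition proj :: "'w \<Rightarrow> 'g \<Rightarrow> 'w" where
  "proj x = (THE c. (\<forall>a. c a \<in> V a) \<and> finite {a. c a \<noteq> 0} \<and> x = (\<Sum>a\<in>{a. c a \<noteq> 0}. c a))"

lemma proj:
  assumes "x \<in> U"
  shows "proj x a \<in> V a" "finite {a. proj x a \<noteq> 0}" "x = (\<Sum>a\<in>{a. proj x a \<noteq> 0}. proj x a)"
  using theI'[OF decomp[OF assms]] unfolding proj_def by auto

lemma proj_unique:
  assumes "x \<in> U" "\<And>a. c a \<in> V a" "finite A" "\<And>a. a \<notin> A \<Longrightarrow> c a = 0" "x = (\<Sum>a\<in>A. c a)"
  shows "proj x = c"
proof -
  have sub: "{a. c a \<noteq> 0} \<subseteq> A" using assms(4) by auto
  have "x = (\<Sum>a\<in>{a. c a \<noteq> 0}. c a)"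
    unfolding assms(5) by (rule sum.mono_neutral_right) (use assms(3) sub in auto)
  then show ?thesis unfolding proj_def
    by (intro the1_equality decomp assms(1)) (use assms finite_subset[OF sub] in auto)
qed

lemma proj_superset:
  assumes "x \<in> U" "finite A" "\<And>a. a \<notin> A \<Longrightarrow> proj x a = 0"
  shows "x = (\<Sum>a\<in>A. proj x a)"
proof -
  have "(\<Sum>a\<in>A. proj x a) = (\<Sum>a\<in>{a. proj x a \<noteq> 0}. proj x a)"
    by (rule sum.mono_neutral_right) (use assms in auto)
  then show ?thesis using proj(3)[OF assms(1)] by simp
qed

lemma proj_homogeneous: assumes "x \<in> V a" shows "proj x = (\<lambda>b. if b = a then x else 0)"
  by (rule proj_unique[where A = "{a}"]) (use assms V_U V_0 in auto)

lemma proj_add: assumes "x \<in> U" "y \<in> U" shows "proj (x + y) = (\<lambda>a. proj x a + proj y a)"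
proof (rule proj_unique)
  let ?A = "{a. proj x a \<noteq> 0} \<union> {a. proj y a \<noteq> 0}"
  show "finite ?A" using proj(2) assms by auto
  have "x = (\<Sum>a\<in>?A. proj x a)" "y = (\<Sum>a\<in>?A. proj y a)"
    using \<open>finite ?A\<close> assms by (auto intro!: proj_superset)
  then show "x + y = (\<Sum>a\<in>?A. proj x a + proj y a)" unfolding sum.distrib by simp
qed (use assms U_add V_add proj in auto)

end

text \<open>The translated images of the components of \<open>w\<close> decompose
  \<open>T w\<close>, and decompositions are unique. The case q = 0 covers differentials and
  scalars, general q the action of monomials.\<close>

lemma proj_map:
  assumes "decomposition U V" "decomposition U' V'"
    and add: "\<And>x y. x \<in> U \<Longrightarrow> y \<in> U \<Longrightarrow> T (x + y) = T x + T y"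
    and TU: "\<And>x. x \<in> U \<Longrightarrow> T x \<in> U'" and TV: "\<And>a x. x \<in> V a \<Longrightarrow> T x \<in> V' (a + q)" and w: "w \<in> U"
  shows "decomposition.proj V' (T w) (a + q) = T (decomposition.proj V w a)"
proof -
  interpret A: decomposition U V by fact
  interpret B: decomposition U' V' by fact
  have T0: "T 0 = 0" using add[OF A.U_0 A.U_0] by simp
  have U_sum: "(\<Sum>a\<in>S. f a) \<in> U \<and> T (\<Sum>a\<in>S. f a) = (\<Sum>a\<in>S. T (f a))" if "finite S" "\<And>a. f a \<in> U" for S f
    using that(1) by (induction S rule: finite_induct) (auto simp: A.U_0 T0 A.U_add add that(2))
  let ?S = "{a. A.proj w a \<noteq> 0}"
  have "B.proj (T w) = (\<lambda>b. T (A.proj w (b - q)))"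
  proof (rule B.proj_unique)
    show "finite ((\<lambda>a. a + q) ` ?S)" using A.proj(2)[OF w] by simp
    have "T w = (\<Sum>a\<in>?S. T (A.proj w a))"
      using U_sum[OF A.proj(2)[OF w], of "A.proj w"] A.proj[OF w] A.V_U by (metis subsetD)
    also have "\<dots> = (\<Sum>b\<in>(\<lambda>a. a + q) ` ?S. T (A.proj w (b - q)))"
      by (subst sum.reindex) (auto simp: inj_on_def)
    finally show "T w = (\<Sum>b\<in>(\<lambda>a. a + q) ` ?S. T (A.proj w (b - q)))" .
    show "T (A.proj w (b - q)) \<in> V' b" for b using TV[OF A.proj(1)[OF w], of "b - q"] by simp
    show "T (A.proj w (b - q)) = 0" if "b \<notin> (\<lambda>a. a + q) ` ?S" for b
    proof -
      have "A.proj w (b - q) = 0"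
      proof (rule ccontr)
        assume "A.proj w (b - q) \<noteq> 0"
        then have "(b - q) + q \<in> (\<lambda>a. a + q) ` ?S" by blast
        then show False using that by simp
      qed
      then show ?thesis using T0 by simp
    qed
  qed (use TU w in auto)
  then show ?thesis by simp
qed

section \<open>Graded modules as families of subspaces\<close>

locale embedded_module = graded_module Q M
  for Q :: "(int ^ 'd) set" and M :: "('k::field, 'd, 'm) zd_module" +
  fixes \<phi> :: "'m \<Rightarrow> 'm \<Rightarrow> 'k"
  assumes phi_inj: "inj_on \<phi> (carrier M)"
    and phi_add: "x \<in> carrier M \<Longrightarrow> y \<in> carrier M \<Longrightarrow> \<phi> (x \<oplus>\<^bsub>M\<^esub> y) = \<phi> x + \<phi> y"
    and phi_scale: "x \<in> carrier M \<Longrightarrow> \<phi> (mon 0 c \<odot>\<^bsub>M\<^esub> x) = fscale c (\<phi> x)"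
begin

definition U where "U = \<phi> ` carrier M"
definition V where "V a = \<phi> ` component M a"
definition \<psi> where "\<psi> = inv_into (carrier M) \<phi>"
definition act where "act q w = \<phi> (mon q 1 \<odot>\<^bsub>M\<^esub> \<psi> w)"

lemma phi_eq_iff: "x \<in> carrier M \<Longrightarrow> y \<in> carrier M \<Longrightarrow> \<phi> x = \<phi> y \<longleftrightarrow> x = y"
  using phi_inj by (auto simp: inj_on_def)

lemma psi_phi [simp]: "x \<in> carrier M \<Longrightarrow> \<psi> (\<phi> x) = x"
  unfolding \<psi>_def using phi_inj by (rule inv_into_f_f)

lemma psi_in: "w \<in> U \<Longrightarrow> \<psi> w \<in> carrier M" and phi_psi: "w \<in> U \<Longrightarrow> \<phi> (\<psi> w) = w"
  by (auto simp: U_def)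

lemma phi_zero [simp]: "\<phi> \<zero>\<^bsub>M\<^esub> = 0"
  using phi_add[of "\<zero>\<^bsub>M\<^esub>" "\<zero>\<^bsub>M\<^esub>"] by simp

lemma phi_eq_0_iff: "x \<in> carrier M \<Longrightarrow> \<phi> x = 0 \<longleftrightarrow> x = \<zero>\<^bsub>M\<^esub>"
  using phi_eq_iff[of x "\<zero>\<^bsub>M\<^esub>"] by simp

lemma phi_sum:
  assumes "finite A" "\<And>a. a \<in> A \<Longrightarrow> f a \<in> carrier M"
  shows "\<phi> (\<Oplus>\<^bsub>M\<^esub>a\<in>A. f a) = (\<Sum>a\<in>A. \<phi> (f a))"
  using assms
proof (induction A rule: finite_induct)
  case (insert a A)
  then have "(\<Oplus>\<^bsub>M\<^esub>a\<in>insert a A. f a) = f a \<oplus>\<^bsub>M\<^esub> (\<Oplus>\<^bsub>M\<^esub>a\<in>A. f a)"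
    by (intro M.finsum_insert) auto
  moreover have "(\<Oplus>\<^bsub>M\<^esub>a\<in>A. f a) \<in> carrier M" using insert by (intro M.finsum_closed) auto
  ultimately show ?case using insert phi_add by simp
qed simp

lemma component_carrier: "x \<in> component M a \<Longrightarrow> x \<in> carrier M"
  using additive_subgroup.a_subset[OF component_subgroup] by blast

lemma component_zero: "\<zero>\<^bsub>M\<^esub> \<in> component M a"
  using additive_subgroup.zero_closed[OF component_subgroup] .

lemma component_add: "x \<in> component M a \<Longrightarrow> y \<in> component M a \<Longrightarrow> x \<oplus>\<^bsub>M\<^esub> y \<in> component M a"
  using additive_subgroup.a_closed[OF component_subgroup] .

lemma component_const: "x \<in> component M a \<Longrightarrow> mon 0 c \<odot>\<^bsub>M\<^esub> x \<in> component M a"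
  using smult_component[OF zero_in_Q, of x a c] by simp

lemma V_U: "V a \<subseteq> U"
  using component_carrier by (auto simp: V_def U_def)

lemma psi_V: "w \<in> V a \<Longrightarrow> \<psi> w \<in> component M a"
  using component_carrier by (auto simp: V_def)

lemma subspace_U: "fvs.subspace U"
  unfolding fvs.subspace_def U_def
proof (intro conjI ballI allI)
  show "0 \<in> \<phi> ` carrier M" by (rule image_eqI[of _ _ "\<zero>\<^bsub>M\<^esub>"]) simp_all
qed (auto simp: phi_add[symmetric] phi_scale[symmetric] intro!: imageI)

lemma subspace_V: "fvs.subspace (V a)"
  unfolding fvs.subspace_def V_def
proof (intro conjI ballI allI)
  show "0 \<in> \<phi> ` component M a" by (rule image_eqI[of _ _ "\<zero>\<^bsub>M\<^esub>"]) (simp_all add: component_zero)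
qed (auto simp: phi_add[OF component_carrier component_carrier, symmetric]
      phi_scale[OF component_carrier, symmetric] intro!: imageI component_add component_const)

lemma decomposition: "decomposition U V"
proof
  fix w assume "w \<in> U"
  then obtain x where x: "x \<in> carrier M" "w = \<phi> x" by (auto simp: U_def)
  obtain c where c: "\<And>a. c a \<in> component M a" "finite {a. c a \<noteq> \<zero>\<^bsub>M\<^esub>}"
      "x = (\<Oplus>\<^bsub>M\<^esub>a\<in>{a. c a \<noteq> \<zero>\<^bsub>M\<^esub>}. c a)"
    and uniq: "\<And>c'. (\<And>a. c' a \<in> component M a) \<Longrightarrow> finite {a. c' a \<noteq> \<zero>\<^bsub>M\<^esub>} \<Longrightarrow>
      x = (\<Oplus>\<^bsub>M\<^esub>a\<in>{a. c' a \<noteq> \<zero>\<^bsub>M\<^esub>}. c' a) \<Longrightarrow> c' = c"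
    using component_decomposition[OF x(1)] by blast
  have supp: "{a. \<phi> (c a) \<noteq> 0} = {a. c a \<noteq> \<zero>\<^bsub>M\<^esub>}"
    using phi_eq_0_iff component_carrier[OF c(1)] by auto
  show "\<exists>!c. (\<forall>a. c a \<in> V a) \<and> finite {a. c a \<noteq> 0} \<and> w = (\<Sum>a\<in>{a. c a \<noteq> 0}. c a)"
  proof (rule ex1I[of _ "\<lambda>a. \<phi> (c a)"], intro conjI allI)
    show "\<phi> (c a) \<in> V a" for a using c(1) by (auto simp: V_def)
    show "finite {a. \<phi> (c a) \<noteq> 0}" unfolding supp by (rule c(2))
    show "w = (\<Sum>a\<in>{a. \<phi> (c a) \<noteq> 0}. \<phi> (c a))"
      unfolding supp x(2) using phi_sum[OF c(2), of c] component_carrier[OF c(1)] c(3) by simp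
  next
    fix c' assume c': "(\<forall>a. c' a \<in> V a) \<and> finite {a. c' a \<noteq> 0} \<and> w = (\<Sum>a\<in>{a. c' a \<noteq> 0}. c' a)"
    define e where "e a = \<psi> (c' a)" for a
    have e: "e a \<in> component M a" "\<phi> (e a) = c' a" for a
      using psi_V[of "c' a" a] phi_psi[of "c' a"] c' V_U by (auto simp: e_def)
    have supp': "{a. e a \<noteq> \<zero>\<^bsub>M\<^esub>} = {a. c' a \<noteq> 0}"
      using phi_eq_0_iff[OF component_carrier[OF e(1)]] e(2) by auto
    have "e = c"
    proof (rule uniq)
      show "x = (\<Oplus>\<^bsub>M\<^esub>a\<in>{a. e a \<noteq> \<zero>\<^bsub>M\<^esub>}. e a)"
      proof (rule phi_eq_iff[THEN iffD1])
        show "\<phi> x = \<phi> (\<Oplus>\<^bsub>M\<^esub>a\<in>{a. e a \<noteq> \<zero>\<^bsub>M\<^esub>}. e a)"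
          unfolding supp' using c' x(2) phi_sum[of "{a. c' a \<noteq> 0}" e] component_carrier[OF e(1)] e(2) by simp
        show "(\<Oplus>\<^bsub>M\<^esub>a\<in>{a. e a \<noteq> \<zero>\<^bsub>M\<^esub>}. e a) \<in> carrier M"
          using component_carrier[OF e(1)] by (intro M.finsum_closed) auto
      qed (rule x(1))
    qed (use e supp' c' in auto)
    then show "c' = (\<lambda>a. \<phi> (c a))" using e(2) by auto
  qed
qed (use subspace_U subspace_V V_U in \<open>auto simp: fvs.subspace_def\<close>)

sublocale dec: decomposition U V by (rule decomposition)

lemma act_phi: "x \<in> carrier M \<Longrightarrow> act q (\<phi> x) = \<phi> (mon q 1 \<odot>\<^bsub>M\<^esub> x)"
  by (simp add: act_def)

lemma act_U: "q \<in> Q \<Longrightarrow> w \<in> U \<Longrightarrow> act q w \<in> U"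
  unfolding act_def U_def using smult_closed[OF mon_R] psi_in by (auto simp: U_def)

lemma act_V: "q \<in> Q \<Longrightarrow> w \<in> V a \<Longrightarrow> act q w \<in> V (a + q)"
  using smult_component[of q "\<psi> w" a 1] psi_V[of w a] by (auto simp: V_def act_def add.commute)

lemma act_add: "q \<in> Q \<Longrightarrow> w \<in> U \<Longrightarrow> w' \<in> U \<Longrightarrow> act q (w + w') = act q w + act q w'"
  by (auto simp: U_def act_phi phi_add[symmetric] smult_r_distr mon_R)

lemma act_scale: assumes "q \<in> Q" "w \<in> U" shows "act q (fscale c w) = fscale c (act q w)"
proof -
  obtain x where x: "x \<in> carrier M" "w = \<phi> x" using assms by (auto simp: U_def)
  have "mon q 1 \<odot>\<^bsub>M\<^esub> (mon 0 c \<odot>\<^bsub>M\<^esub> x) = mon 0 c \<odot>\<^bsub>M\<^esub> (mon q 1 \<odot>\<^bsub>M\<^esub> x)"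
    using smult_assoc1[OF mon_R[OF assms(1)] const_R x(1), of 1 c] smult_assoc1[OF const_R mon_R[OF assms(1)] x(1), of c 1]
    by (simp add: semigroup_ring_simps mult_single)
  then show ?thesis using x assms by (simp add: phi_scale[symmetric] act_phi mon_R)
qed

lemma act_0: "w \<in> U \<Longrightarrow> act 0 w = w"
  using smult_one by (auto simp: U_def act_phi semigroup_ring_simps)

lemma act_act: assumes "q \<in> Q" "r \<in> Q" "w \<in> U" shows "act (q + r) w = act q (act r w)"
proof -
  obtain x where x: "x \<in> carrier M" "w = \<phi> x" using assms by (auto simp: U_def)
  then show ?thesis using smult_assoc1[OF mon_R[OF assms(1)] mon_R[OF assms(2)] x(1), of 1 1] assms
    by (simp add: act_phi semigroup_ring_simps mult_single mon_R)
qed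

lemma phi_mon: assumes "q \<in> Q" "x \<in> carrier M" shows "\<phi> (mon q c \<odot>\<^bsub>M\<^esub> x) = fscale c (act q (\<phi> x))"
proof -
  have "mon q c \<odot>\<^bsub>M\<^esub> x = mon 0 c \<odot>\<^bsub>M\<^esub> (mon q 1 \<odot>\<^bsub>M\<^esub> x)"
    using smult_assoc1[OF const_R mon_R[OF assms(1)] assms(2), of c 1] by (simp add: semigroup_ring_simps mult_single)
  then show ?thesis using assms by (simp add: phi_scale act_phi mon_R)
qed

lemma phi_smult_add:
  assumes "r \<in> carrier (semigroup_ring Q)" "s \<in> carrier (semigroup_ring Q)" "x \<in> carrier M"
  shows "\<phi> ((r + s) \<odot>\<^bsub>M\<^esub> x) = \<phi> (r \<odot>\<^bsub>M\<^esub> x) + \<phi> (s \<odot>\<^bsub>M\<^esub> x)"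
  using smult_l_distr[OF assms] assms by (simp add: semigroup_ring_simps(5) phi_add)

lemma phi_smult_zero: "x \<in> carrier M \<Longrightarrow> \<phi> (0 \<odot>\<^bsub>M\<^esub> x) = 0"
  using smult_l_null[of x] by (simp add: semigroup_ring_simps)

text \<open>\<open>r x\<close> is a linear combination of monomial multiples of \<open>x\<close>.
  With S = {0} this reduces annihilation to monomials.\<close>

lemma phi_smult_in_subspace:
  assumes "keys r \<subseteq> I" "I \<subseteq> Q" "x \<in> carrier M" "fvs.subspace S" "\<And>q. q \<in> I \<Longrightarrow> act q (\<phi> x) \<in> S"
  shows "\<phi> (r \<odot>\<^bsub>M\<^esub> x) \<in> S"
  using assms(1)
proof (induction r rule: poly_mapping_keys_induct)
  case zero
  show ?case unfolding phi_smult_zero[OF assms(3)] by (rule fvs.subspace_0[OF assms(4)])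
next
  case (single q c)
  then have "q \<in> Q" using assms(2) by blast
  then show ?case using phi_mon[of q x c] single assms(3,5) fvs.subspace_scale[OF assms(4)] by simp
next
  case (add r s)
  then have "r \<in> carrier (semigroup_ring Q)" "s \<in> carrier (semigroup_ring Q)" using assms(2) by (auto simp: semigroup_ring_simps)
  from phi_smult_add[OF this assms(3)] show ?case
    using fvs.subspace_add[OF assms(4) add.IH] by (simp only:)
qed

end

section \<open>Monomial ideals as test modules\<close>

text \<open>The monomial t^q is placed in degree q + a, so that homomorphisms of degree 0 correspond
  to families with \<open>f q\<close> in degree a + q.\<close>

definition shifted_ideal :: "(int ^ 'd) set \<Rightarrow> int ^ 'd \<Rightarrow> ('k::field, 'd, ('k, 'd) laurent) zd_module" where
  "shifted_ideal I a = \<lparr> carrier = {f. keys f \<subseteq> I}, mult = (*), one = 1, zero = 0, add = (+),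
     smult = (*), component = (\<lambda>b. {f. keys f \<subseteq> I \<inter> {b - a}}) \<rparr>"

lemma keys_mult_ideal:
  fixes f g :: "'g::ab_group_add \<Rightarrow>\<^sub>0 'k::field"
  assumes "monoid_ideal Q I" "keys f \<subseteq> Q" "keys g \<subseteq> I"
  shows "keys (f * g) \<subseteq> I"
proof
  fix k assume "k \<in> keys (f * g)"
  then obtain a b where "k = a + b" "a \<in> keys f" "b \<in> keys g"
    using keys_mult by blast
  then have "k = b + a" "a \<in> Q" "b \<in> I" using assms by (auto simp: add.commute)
  then show "k \<in> I" using assms(1) unfolding monoid_ideal_def by blast
qed

lemma keys_add_subset: "keys f \<subseteq> I \<Longrightarrow> keys g \<subseteq> I \<Longrightarrow> keys (f + g) \<subseteq> I"
  using keys_add[of f g] by blast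

lemma single_eq_0_iff: "mon k c = 0 \<longleftrightarrow> c = 0"
  by (metis lookup_single_eq lookup_zero single_zero)

lemma graded_module_shifted_ideal:
  fixes Q :: "(int ^ 'd) set"
  assumes R: "cring (semigroup_ring Q :: ('k::field, 'd) laurent ring)" and I: "monoid_ideal Q I"
  shows "graded_module Q (shifted_ideal I a :: ('k, 'd, ('k, 'd) laurent) zd_module)"
proof -
  let ?A = "shifted_ideal I a :: ('k, 'd, ('k, 'd) laurent) zd_module"
  have IQ: "I \<subseteq> Q" using I by (simp add: monoid_ideal_def)
  have ag: "abelian_group ?A"
  proof (rule abelian_groupI)
    fix x assume "x \<in> carrier ?A"
    then show "\<exists>y\<in>carrier ?A. y \<oplus>\<^bsub>?A\<^esub> x = \<zero>\<^bsub>?A\<^esub>"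
      by (intro bexI[of _ "- x"]) (auto simp: shifted_ideal_def)
  qed (auto simp: shifted_ideal_def add.assoc add.commute dest: subsetD[OF keys_add])
  have mod: "module (semigroup_ring Q) ?A"
    by (rule moduleI[OF R ag])
      (auto simp: shifted_ideal_def semigroup_ring_simps algebra_simps dest: subsetD[OF keys_mult_ideal[OF I]])
  interpret A: abelian_group ?A by fact
  have fs: "(\<Oplus>\<^bsub>?A\<^esub>b\<in>S. c b) = (\<Sum>b\<in>S. c b)" if "finite S" "\<And>b. keys (c b) \<subseteq> I" for S :: "(int ^ 'd) set" and c
    using that(1)
  proof (induction S rule: finite_induct)
    case empty
    show ?case using A.finsum_empty[of c] by (simp add: shifted_ideal_def)
  next
    case (insert b S)
    have "c \<in> insert b S \<rightarrow> carrier ?A" using that(2) by (auto simp: shifted_ideal_def)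
    then have "(\<Oplus>\<^bsub>?A\<^esub>b\<in>insert b S. c b) = c b \<oplus>\<^bsub>?A\<^esub> (\<Oplus>\<^bsub>?A\<^esub>b\<in>S. c b)"
      using insert by (intro A.finsum_insert) auto
    then show ?case using insert by (simp add: shifted_ideal_def)
  qed
  show ?thesis
  proof (intro graded_module.intro mod graded_module_axioms.intro)
    fix b
    show "additive_subgroup (component ?A b) ?A"
    proof (rule additive_subgroup.intro, rule A.add.subgroupI)
      fix x assume x: "x \<in> component ?A b"
      then have "- x \<in> component ?A b" "x \<in> carrier ?A" "- x \<in> carrier ?A" by (auto simp: shifted_ideal_def)
      moreover have "- x \<oplus>\<^bsub>?A\<^esub> x = \<zero>\<^bsub>?A\<^esub>" by (simp add: shifted_ideal_def)
      ultimately show "\<ominus>\<^bsub>?A\<^esub> x \<in> component ?A b"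
        using A.minus_equality[of "- x" x] by simp
    next
      show "component ?A b \<noteq> {}" by (auto simp: shifted_ideal_def intro!: exI[of _ 0])
    qed (auto simp: shifted_ideal_def dest: subsetD[OF keys_add])
  next
    fix b x and r :: 'k and c assume "b \<in> Q" "x \<in> component ?A c"
    then have "keys (mon b r * x) \<subseteq> I" "keys x \<subseteq> {c - a}"
      using keys_mult_ideal[OF I, of "mon b r" x] by (auto simp: shifted_ideal_def)
    moreover have "keys (mon b r * x) \<subseteq> {b + c - a}"
    proof
      fix k assume "k \<in> keys (mon b r * x)"
      then obtain u v where uv: "k = u + v" "u \<in> keys (mon b r)" "v \<in> keys x"
        using keys_mult by blast
      then have "u = b" "v = c - a" using \<open>keys x \<subseteq> {c - a}\<close> by (auto split: if_splits)
      then show "k \<in> {b + c - a}" using uv by simp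
    qed
    ultimately show "mon b r \<odot>\<^bsub>?A\<^esub> x \<in> component ?A (b + c)" by (auto simp: shifted_ideal_def)
  next
    fix x assume x: "x \<in> carrier ?A"
    define c where "c b = mon (b - a) (lookup x (b - a))" for b
    have supp: "{b. c b \<noteq> \<zero>\<^bsub>?A\<^esub>} = (\<lambda>k. k + a) ` keys x"
    proof -
      have "{b. c b \<noteq> \<zero>\<^bsub>?A\<^esub>} = {b. b - a \<in> keys x}"
        by (simp add: c_def shifted_ideal_def in_keys_iff single_eq_0_iff)
      also have "\<dots> = (\<lambda>k. k + a) ` keys x" by (force simp: image_iff)
      finally show ?thesis .
    qed
    have cI: "keys (c b) \<subseteq> I \<inter> {b - a}" for b
      using x by (auto simp: c_def shifted_ideal_def in_keys_iff subset_iff)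
    show "\<exists>!c. (\<forall>b. c b \<in> component ?A b) \<and> finite {b. c b \<noteq> \<zero>\<^bsub>?A\<^esub>} \<and>
        x = (\<Oplus>\<^bsub>?A\<^esub>b\<in>{b. c b \<noteq> \<zero>\<^bsub>?A\<^esub>}. c b)"
    proof (rule ex1I[of _ c], intro conjI allI)
      show "c b \<in> component ?A b" for b using cI by (simp add: shifted_ideal_def)
      show fin: "finite {b. c b \<noteq> \<zero>\<^bsub>?A\<^esub>}" unfolding supp by simp
      have "x = (\<Sum>b\<in>(\<lambda>k. k + a) ` keys x. c b)"
      proof (rule poly_mapping_eqI)
        fix k
        have "lookup (\<Sum>b\<in>(\<lambda>k. k + a) ` keys x. c b) k
            = (\<Sum>q\<in>keys x. lookup (mon q (lookup x q)) k)"
          unfolding lookup_sum by (subst sum.reindex) (auto simp: inj_on_def c_def)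
        also have "\<dots> = (\<Sum>q\<in>keys x. if q = k then lookup x q else 0)"
          by (intro sum.cong) (auto simp: lookup_single when_def)
        also have "\<dots> = lookup x k" by (simp add: in_keys_iff)
        finally show "lookup x k = lookup (\<Sum>b\<in>(\<lambda>k. k + a) ` keys x. c b) k" by simp
      qed
      then show "x = (\<Oplus>\<^bsub>?A\<^esub>b\<in>{b. c b \<noteq> \<zero>\<^bsub>?A\<^esub>}. c b)"
        using fs[OF fin, of c] cI unfolding supp by auto
    next
      fix c' assume c': "(\<forall>b. c' b \<in> component ?A b) \<and> finite {b. c' b \<noteq> \<zero>\<^bsub>?A\<^esub>} \<and>
        x = (\<Oplus>\<^bsub>?A\<^esub>b\<in>{b. c' b \<noteq> \<zero>\<^bsub>?A\<^esub>}. c' b)"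
      have k': "keys (c' b) \<subseteq> I" "keys (c' b) \<subseteq> {b - a}" for b
        using c' by (auto simp: shifted_ideal_def)
      let ?S = "{b. c' b \<noteq> 0}"
      have S: "{b. c' b \<noteq> \<zero>\<^bsub>?A\<^esub>} = ?S" by (simp add: shifted_ideal_def)
      have xs: "x = (\<Sum>b\<in>?S. c' b)" using c' fs[of ?S c'] k' unfolding S by auto
      show "c' = c"
      proof
        fix b
        show "c' b = c b"
        proof (rule poly_mapping_eqI)
          fix k
          have z: "lookup (c' b') k = 0" if "k \<noteq> b' - a" for b'
            using k'(2)[of b'] that by (auto simp: in_keys_iff)
          show "lookup (c' b) k = lookup (c b) k"
          proof (cases "k = b - a")
            case True
            have "lookup x k = (\<Sum>b'\<in>?S. lookup (c' b') k)"
              unfolding xs by (rule lookup_sum)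
            also have "\<dots> = (\<Sum>b'\<in>?S. if b' = b then lookup (c' b) k else 0)"
              using z True by (intro sum.cong) auto
            also have "\<dots> = lookup (c' b) k" using c' unfolding S by simp
            finally show ?thesis using True by (simp add: c_def)
          qed (use z in \<open>auto simp: c_def lookup_single when_def\<close>)
        qed
      qed
    qed
  qed
qed


text \<open>A family \<open>f\<close> as below is a homomorphism from the ideal \<open>I\<close>, shifted in degree, to \<open>M\<close>; its extension to
  \<open>k[Q]\<close> sends \<open>1\<close> to the required element.\<close>

lemma (in embedded_module) injective_baer:
  assumes inj: "graded_injective Q M" and Q: "monoid_ideal Q Q" and I: "monoid_ideal Q I"
    and f: "\<And>q. q \<in> I \<Longrightarrow> f q \<in> V (a + q)" and fX: "\<And>q b. q \<in> I \<Longrightarrow> b \<in> Q \<Longrightarrow> f (q + b) = act b (f q)"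
  shows "\<exists>y\<in>V a. \<forall>q\<in>I. act q y = f q"
proof -
  let ?A = "shifted_ideal I a :: ('k, 'd, ('k, 'd) laurent) zd_module"
  let ?B = "shifted_ideal Q a :: ('k, 'd, ('k, 'd) laurent) zd_module"
  have IQ: "I \<subseteq> Q" using I by (simp add: monoid_ideal_def)
  have cr: "cring (semigroup_ring Q :: ('k, 'd) laurent ring)" ..
  \<comment> \<open>The linear extension of \<open>f\<close> from monomials to polynomials;
    \<open>F_mult\<close> turns the compatibility \<open>fX\<close> into linearity over the
    ring.\<close>
  define F where "F g = (\<Sum>q\<in>keys g. fscale (lookup g q) (f q))" for g :: "('k, 'd) laurent"
  have F_sup: "F g = (\<Sum>q\<in>S. fscale (lookup g q) (f q))"
    if "finite S" "keys g \<subseteq> S" for g S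
    unfolding F_def by (rule sum.mono_neutral_left) (use that in \<open>auto simp: in_keys_iff\<close>)
  have F_add: "F (g + h) = F g + F h" for g h
  proof -
    let ?S = "keys g \<union> keys h"
    have "F (g + h) = (\<Sum>q\<in>?S. fscale (lookup (g + h) q) (f q))"
      by (rule F_sup) (use keys_add[of g h] in auto)
    also have "\<dots> = (\<Sum>q\<in>?S. fscale (lookup g q) (f q)) + (\<Sum>q\<in>?S. fscale (lookup h q) (f q))"
      unfolding lookup_add fvs.scale_left_distrib sum.distrib ..
    also have "(\<Sum>q\<in>?S. fscale (lookup g q) (f q)) = F g" by (rule F_sup[symmetric]) auto
    also have "(\<Sum>q\<in>?S. fscale (lookup h q) (f q)) = F h" by (rule F_sup[symmetric]) auto
    finally show ?thesis .
  qed
  have F_single: "F (mon q c) = fscale c (f q)" for q c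
  proof -
    have "F (mon q c) = (\<Sum>p\<in>{q}. fscale (lookup (mon q c) p) (f p))"
      by (rule F_sup) auto
    then show ?thesis by simp
  qed
  have F_0: "F 0 = 0" by (simp add: F_def)
  have F_U: "F g \<in> U" if "keys g \<subseteq> I" for g
    unfolding F_def using f V_U that
    by (intro fvs.subspace_sum[OF subspace_U] fvs.subspace_scale[OF subspace_U]) blast
  have F_V: "F g \<in> V b" if "keys g \<subseteq> I \<inter> {b - a}" for g b
    unfolding F_def
  proof (intro fvs.subspace_sum[OF subspace_V] fvs.subspace_scale[OF subspace_V])
    fix q assume "q \<in> keys g"
    then have "q \<in> I" "q = b - a" using that by auto
    then show "f q \<in> V b" using f[of q] by simp
  qed
  have F_mon: "F (mon b s * g) = fscale s (act b (F g))" if b: "b \<in> Q" and g: "keys g \<subseteq> I" for b s g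
    using g
  proof (induction g rule: poly_mapping_keys_induct)
    case zero
    have act0: "act b 0 = 0" using act_scale[OF b dec.U_0, of 0] by simp
    show ?case unfolding mult_zero_right F_0 act0 fvs.scale_zero_right ..
  next
    case (single q c)
    have "f q \<in> U" using f[OF single] V_U by blast
    then show ?case using fX[OF single b] act_scale[OF b, of "f q" c]
      by (simp add: mult_single F_single add.commute[of b])
  next
    case (add g h)
    show ?case
      by (simp only: distrib_left F_add act_add[OF b F_U[OF add(1)] F_U[OF add(2)]] fvs.scale_right_distrib add.IH)
  qed
  have F_mult: "F (r * g) = \<phi> (r \<odot>\<^bsub>M\<^esub> \<psi> (F g))" if r: "keys r \<subseteq> Q" and g: "keys g \<subseteq> I" for r g
    using r
  proof (induction r rule: poly_mapping_keys_induct)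
    case zero
    show ?case using phi_smult_zero[OF psi_in[OF F_U[OF g]]] by (simp only: mult_zero_left F_0)
  next
    case (single b s)
    show ?case unfolding F_mon[OF single g] phi_mon[OF single psi_in[OF F_U[OF g]]] phi_psi[OF F_U[OF g]] ..
  next
    case (add r s)
    have "\<phi> ((r + s) \<odot>\<^bsub>M\<^esub> \<psi> (F g)) = \<phi> (r \<odot>\<^bsub>M\<^esub> \<psi> (F g)) + \<phi> (s \<odot>\<^bsub>M\<^esub> \<psi> (F g))"
      by (rule phi_smult_add) (use add psi_in[OF F_U[OF g]] in \<open>auto simp: semigroup_ring_simps\<close>)
    then show ?case unfolding distrib_right F_add add.IH by simp
  qed
  define h where "h g = \<psi> (F g)" for g
  have phi_h: "\<phi> (h g) = F g" "h g \<in> carrier M" if "keys g \<subseteq> I" for g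
    using phi_psi[OF F_U[OF that]] psi_in[OF F_U[OF that]] by (auto simp: h_def)
  have h: "h \<in> graded_hom Q ?A M"
    unfolding graded_hom_def mem_Collect_eq
  proof (intro conjI ballI allI)
    show "h \<in> carrier ?A \<rightarrow> carrier M" using phi_h(2) by (auto simp: shifted_ideal_def)
  next
    fix x y assume "x \<in> carrier ?A" "y \<in> carrier ?A"
    then have xy: "keys x \<subseteq> I" "keys y \<subseteq> I" by (auto simp: shifted_ideal_def)
    have "\<phi> (h (x + y)) = \<phi> (h x \<oplus>\<^bsub>M\<^esub> h y)"
      unfolding phi_h(1)[OF keys_add_subset[OF xy]] phi_add[OF phi_h(2)[OF xy(1)] phi_h(2)[OF xy(2)]]
        phi_h(1)[OF xy(1)] phi_h(1)[OF xy(2)] by (rule F_add)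
    then show "h (x \<oplus>\<^bsub>?A\<^esub> y) = h x \<oplus>\<^bsub>M\<^esub> h y"
      using phi_eq_iff[of "h (x + y)" "h x \<oplus>\<^bsub>M\<^esub> h y"] phi_h(2) xy keys_add_subset[OF xy] by (simp add: shifted_ideal_def)
  next
    fix r x :: "('k, 'd) laurent" assume "r \<in> carrier (semigroup_ring Q)" "x \<in> carrier ?A"
    then have r: "keys r \<subseteq> Q" and x: "keys x \<subseteq> I" by (auto simp: shifted_ideal_def semigroup_ring_simps)
    have rx: "keys (r * x) \<subseteq> I" by (rule keys_mult_ideal[OF I r x])
    have "\<phi> (h (r * x)) = \<phi> (r \<odot>\<^bsub>M\<^esub> h x)" using phi_h(1)[OF rx] F_mult[OF r x] unfolding h_def by metis
    then show "h (r \<odot>\<^bsub>?A\<^esub> x) = r \<odot>\<^bsub>M\<^esub> h x"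
      using phi_eq_iff[of "h (r * x)" "r \<odot>\<^bsub>M\<^esub> h x"] phi_h(2)[OF rx] smult_closed[OF _ phi_h(2)[OF x], of r] r
      by (simp add: shifted_ideal_def semigroup_ring_simps)
  next
    fix b show "h ` component ?A b \<subseteq> component M b"
      using psi_V[OF F_V] by (auto simp: shifted_ideal_def h_def)
  qed
  have id: "(\<lambda>x. x) \<in> graded_hom Q ?A ?B"
    using IQ by (auto simp: graded_hom_def shifted_ideal_def)
  have "\<exists>g \<in> graded_hom Q ?B M. \<forall>x\<in>carrier ?A. g x = h x"
    using inj[unfolded graded_injective_def] id h
      graded_module_shifted_ideal[OF cr I, of a] graded_module_shifted_ideal[OF cr Q, of a]
    by (metis inj_on_id2)
  then obtain g where g: "g \<in> graded_hom Q ?B M" "\<And>x. x \<in> carrier ?A \<Longrightarrow> g x = h x" by blast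
  have "0 \<in> Q" by (rule zero_in_Q)
  then have 1: "1 \<in> component ?B a" "1 \<in> carrier ?B" by (auto simp: shifted_ideal_def)
  then have g1: "g 1 \<in> component M a" using g(1) unfolding graded_hom_def by blast
  have "act q (\<phi> (g 1)) = f q" if q: "q \<in> I" for q
  proof -
    have qQ: "q \<in> Q" using q IQ by blast
    have "g (r \<odot>\<^bsub>?B\<^esub> x) = r \<odot>\<^bsub>M\<^esub> g x" if "r \<in> carrier (semigroup_ring Q)" "x \<in> carrier ?B" for r x
      using g(1) that unfolding graded_hom_def by blast
    from this[OF mon_R[OF qQ, of 1] 1(2)] have "g (mon q 1) = mon q 1 \<odot>\<^bsub>M\<^esub> g 1"
      by (simp add: shifted_ideal_def)
    then have "act q (\<phi> (g 1)) = \<phi> (g (mon q 1))"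
      using act_phi[OF component_carrier[OF g1]] by simp
    also have "g (mon q 1) = h (mon q 1)" using g(2) q by (simp add: shifted_ideal_def)
    also have "\<phi> (h (mon q 1)) = f q" using phi_h(1)[of "mon q 1"] q by (simp add: F_single)
    finally show ?thesis .
  qed
  then show ?thesis using g1 by (intro bexI[of _ "\<phi> (g 1)"]) (auto simp: V_def)
qed

section \<open>Torsion with respect to the maximal monomial ideal\<close>

locale pointed_monoid = pos_monoid G l
  for G :: "(int ^ 'd) set" and l :: "int ^ 'd \<Rightarrow> real"
begin

definition power_ideal :: "'k itself \<Rightarrow> nat \<Rightarrow> ('k::field, 'd) laurent set" where
  "power_ideal _ n = max_monomial_ideal Q [^]\<^bsub>ideals_set (semigroup_ring Q)\<^esub> n"

lemma power_ideal_0: "power_ideal TYPE('k::field) 0 = carrier (semigroup_ring Q)"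
  and power_ideal_Suc: "power_ideal TYPE('k) (Suc n) =
    ideal_prod (semigroup_ring Q) (power_ideal TYPE('k) n) (max_monomial_ideal Q)"
  by (simp_all add: power_ideal_def nat_pow_def ideals_set_def)

lemma max_ideal_iff: "f \<in> max_monomial_ideal Q \<longleftrightarrow> keys f \<subseteq> Q - {0}"
proof -
  have "{a \<in> Q. - a \<notin> Q} = Q - {0}"
    using l_pos_Q l_nonneg l_minus by force
  then show ?thesis by (simp add: max_monomial_ideal_def)
qed

lemma level_bound: obtains \<delta> where "\<delta> > 0" "\<And>q. q \<in> Q \<Longrightarrow> q \<noteq> 0 \<Longrightarrow> l q \<ge> \<delta>"
proof -
  \<comment> \<open>The inserted 1 keeps the minimum meaningful when \<open>G\<close> is
    empty.\<close>
  define \<delta> where "\<delta> = Min (insert 1 (l ` G))"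
  have fin: "finite (insert 1 (l ` G))" using finite_G by simp
  have "\<delta> \<in> insert 1 (l ` G)" unfolding \<delta>_def using fin by (intro Min_in) auto
  then have "\<delta> > 0" using l_pos by auto
  moreover have "q = 0 \<or> l q \<ge> \<delta>" if "q \<in> Q" for q using that
  proof (induction rule: Q_induct)
    case (add g q)
    have "\<delta> \<le> l g" unfolding \<delta>_def using fin add by (intro Min_le) auto
    then show ?case using l_nonneg[OF add(2)] by (simp add: l_add)
  qed simp
  ultimately show ?thesis using that by blast
qed

text \<open>Each factor from the maximal ideal raises the level of the exponents by at least
  \<open>\<delta>\<close>.\<close>

lemma keys_power_ideal:
  assumes "\<And>q. q \<in> Q \<Longrightarrow> q \<noteq> 0 \<Longrightarrow> l q \<ge> \<delta>" "f \<in> power_ideal TYPE('k::field) n"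
  shows "keys f \<subseteq> {q \<in> Q. l q \<ge> real n * \<delta>}"
  using assms(2)
proof (induction n arbitrary: f)
  case 0
  then show ?case using l_nonneg by (auto simp: power_ideal_0 semigroup_ring_simps)
next
  case (Suc n)
  then have "f \<in> ideal_prod (semigroup_ring Q) (power_ideal TYPE('k) n) (max_monomial_ideal Q)"
    by (simp add: power_ideal_Suc)
  then show ?case
  proof (induction rule: ideal_prod.induct)
    case (prod i j)
    show ?case
    proof
      fix k assume "k \<in> keys (i \<otimes>\<^bsub>semigroup_ring Q\<^esub> j)"
      then have "k \<in> keys (i * j)" by (simp add: semigroup_ring_simps)
      then obtain a b where ab: "k = a + b" "a \<in> keys i" "b \<in> keys j"
        using keys_mult by blast
      have "a \<in> Q" "l a \<ge> real n * \<delta>" using Suc.IH[OF prod(1)] ab(2) by auto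
      moreover have "b \<in> Q" "l b \<ge> \<delta>" using prod(2) ab(3) assms(1) by (auto simp: max_ideal_iff)
      ultimately show "k \<in> {q \<in> Q. l q \<ge> real (Suc n) * \<delta>}" using ab(1) by (auto simp: l_add algebra_simps)
    qed
  next
    case (sum s t)
    then show ?case using keys_add[of s t] by (auto simp: semigroup_ring_simps)
  qed
qed

text \<open>A generator contributes at most \<open>L\<close> to the level, so an element of level
  above n L is a sum of at least n generators.\<close>

lemma mon_power_ideal:
  assumes "\<And>g. g \<in> G \<Longrightarrow> l g \<le> L" "q \<in> Q" "l q > real n * L" "L \<ge> 0"
  shows "mon q 1 \<in> power_ideal TYPE('k::field) n"
proof -
  \<comment> \<open>\<open>s\<close> counts generators in a representation of \<open>q\<close>;
    claiming membership for all n \<le> s avoids a separate argument that the powers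
    decrease.\<close>
  have "\<exists>s. l q \<le> real s * L \<and> (\<forall>n\<le>s. mon q 1 \<in> power_ideal TYPE('k) n)"
    using assms(2)
  proof (induction rule: Q_induct)
    case zero
    then show ?case by (intro exI[of _ 0]) (auto simp: power_ideal_0 semigroup_ring_simps)
  next
    case (add g q)
    then obtain s where s: "l q \<le> real s * L" "\<And>n. n \<le> s \<Longrightarrow> mon q 1 \<in> power_ideal TYPE('k) n" by auto
    show ?case
    proof (intro exI[of _ "Suc s"] conjI allI impI)
      show "l (g + q) \<le> real (Suc s) * L" using s(1) assms(1)[OF add(1)] by (simp add: l_add algebra_simps)
      fix n assume n: "n \<le> Suc s"
      show "mon (g + q) 1 \<in> power_ideal TYPE('k) n"
      proof (cases n)
        case 0
        then show ?thesis using add G_Q by (auto simp: power_ideal_0 semigroup_ring_simps)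
      next
        case (Suc m)
        have "g \<noteq> 0" using l_pos[OF add(1)] by auto
        then have "mon g (1::'k) \<in> max_monomial_ideal Q" using G_Q[OF add(1)] by (simp add: max_ideal_iff)
        moreover have "mon q 1 \<in> power_ideal TYPE('k) m" using s(2) n Suc by simp
        ultimately have "mon q 1 \<otimes>\<^bsub>semigroup_ring Q\<^esub> mon g (1::'k) \<in> power_ideal TYPE('k) n"
          unfolding Suc power_ideal_Suc by (intro ideal_prod.prod)
        then show ?thesis by (simp add: semigroup_ring_simps mult_single add.commute)
      qed
    qed
  qed
  then obtain s where s: "l q \<le> real s * L" "\<And>n. n \<le> s \<Longrightarrow> mon q 1 \<in> power_ideal TYPE('k) n" by auto
  have "n \<le> s"
  proof (rule ccontr)
    assume "\<not> n \<le> s"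
    then have "real s * L \<le> real n * L" using assms(4) by (intro mult_right_mono) auto
    then show False using s(1) assms(3) by linarith
  qed
  then show ?thesis using s(2) by blast
qed

text \<open>Powers of the maximal ideal and levels of \<open>l\<close> are cofinal, by
  \<open>keys_power_ideal\<close> in one direction and \<open>mon_power_ideal\<close> in the
  other.\<close>

lemma torsion_iff:
  fixes M :: "('k::field, 'd, 'm) zd_module"
  assumes "embedded_module Q M \<phi>" "x \<in> carrier M"
  shows "x \<in> carrier (torsion (semigroup_ring Q) (max_monomial_ideal Q) M) \<longleftrightarrow>
    (\<exists>N. \<forall>q\<in>Q. l q \<ge> N \<longrightarrow> embedded_module.act M \<phi> q (\<phi> x) = 0)"
proof -
  interpret E: embedded_module Q M \<phi> by fact
  have "x \<in> carrier (torsion (semigroup_ring Q) (max_monomial_ideal Q) M) \<longleftrightarrow>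
      (\<exists>n. \<forall>f\<in>power_ideal TYPE('k) n. f \<odot>\<^bsub>M\<^esub> x = \<zero>\<^bsub>M\<^esub>)"
    using assms(2) by (simp add: torsion_def Let_def power_ideal_def)
  also have "\<dots> \<longleftrightarrow> (\<exists>N. \<forall>q\<in>Q. l q \<ge> N \<longrightarrow> E.act q (\<phi> x) = 0)"
  proof
    assume "\<exists>n. \<forall>f\<in>power_ideal TYPE('k) n. f \<odot>\<^bsub>M\<^esub> x = \<zero>\<^bsub>M\<^esub>"
    then obtain n where n: "\<And>f. f \<in> power_ideal TYPE('k) n \<Longrightarrow> f \<odot>\<^bsub>M\<^esub> x = \<zero>\<^bsub>M\<^esub>" by blast
    define L where "L = Max (insert 0 (l ` G))"
    have L: "L \<ge> 0" "\<And>g. g \<in> G \<Longrightarrow> l g \<le> L" unfolding L_def using finite_G by (auto intro!: Max_ge simp del: Max_insert)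
    show "\<exists>N. \<forall>q\<in>Q. l q \<ge> N \<longrightarrow> E.act q (\<phi> x) = 0"
    \<comment> \<open>The added 1 provides the strict inequality that \<open>mon_power_ideal\<close>
      demands.\<close>
    proof (intro exI[of _ "real n * L + 1"] ballI impI)
      fix q assume q: "q \<in> Q" "l q \<ge> real n * L + 1"
      then have "mon q 1 \<odot>\<^bsub>M\<^esub> x = \<zero>\<^bsub>M\<^esub>" using n mon_power_ideal[OF L(2) q(1) _ L(1), of n] by simp
      then show "E.act q (\<phi> x) = 0" using E.act_phi[OF assms(2)] by (metis E.phi_zero)
    qed
  next
    assume "\<exists>N. \<forall>q\<in>Q. l q \<ge> N \<longrightarrow> E.act q (\<phi> x) = 0"
    then obtain N where N: "\<And>q. q \<in> Q \<Longrightarrow> l q \<ge> N \<Longrightarrow> E.act q (\<phi> x) = 0" by blast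
    obtain \<delta> where \<delta>: "\<delta> > 0" "\<And>q. q \<in> Q \<Longrightarrow> q \<noteq> 0 \<Longrightarrow> l q \<ge> \<delta>" using level_bound by blast
    obtain n :: nat where n: "real n * \<delta> > N" using ex_less_of_nat_mult[OF \<delta>(1)] by blast
    show "\<exists>n. \<forall>f\<in>power_ideal TYPE('k) n. f \<odot>\<^bsub>M\<^esub> x = \<zero>\<^bsub>M\<^esub>"
    proof (intro exI[of _ n] ballI)
      fix f :: "('k, 'd) laurent" assume f: "f \<in> power_ideal TYPE('k) n"
      have k: "keys f \<subseteq> {q \<in> Q. l q \<ge> real n * \<delta>}" using keys_power_ideal[OF \<delta>(2) f] by blast
      have "\<phi> (f \<odot>\<^bsub>M\<^esub> x) \<in> {0}"
        by (rule E.phi_smult_in_subspace[OF k _ assms(2)]) (use N n in \<open>auto simp: fvs.subspace_single_0\<close>)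
      moreover have "f \<odot>\<^bsub>M\<^esub> x \<in> carrier M" using k assms(2) by (intro E.smult_closed) (auto simp: semigroup_ring_simps)
      ultimately show "f \<odot>\<^bsub>M\<^esub> x = \<zero>\<^bsub>M\<^esub>" using E.phi_eq_0_iff by blast
    qed
  qed
  finally show ?thesis .
qed

end

section \<open>The complex of an injective resolution\<close>

locale embedded_resolution = pointed_monoid G l
  for G :: "(int ^ 'd) set" and l :: "int ^ 'd \<Rightarrow> real" +
  fixes J :: "nat \<Rightarrow> ('k::field, 'd, 'j) zd_module" and d :: "nat \<Rightarrow> 'j \<Rightarrow> 'j"
    and \<phi> :: "nat \<Rightarrow> 'j \<Rightarrow> 'j \<Rightarrow> 'k"
  assumes emb: "embedded_module Q (J n) (\<phi> n)"
    and inj: "graded_injective Q (J n)"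
    and d_hom: "d n \<in> graded_hom Q (J n) (J (Suc n))"
    and d_d: "x \<in> carrier (J n) \<Longrightarrow> d (Suc n) (d n x) = \<zero>\<^bsub>J (Suc (Suc n))\<^esub>"
begin

abbreviation "UJ n \<equiv> embedded_module.U (J n) (\<phi> n)"
abbreviation "VJ n \<equiv> embedded_module.V (J n) (\<phi> n)"
abbreviation "actJ n \<equiv> embedded_module.act (J n) (\<phi> n)"
abbreviation "psiJ n \<equiv> embedded_module.\<psi> (J n) (\<phi> n)"

definition dW :: "nat \<Rightarrow> ('j \<Rightarrow> 'k) \<Rightarrow> 'j \<Rightarrow> 'k" where
  "dW n w = \<phi> (Suc n) (d n (psiJ n w))"

lemma d_carrier: "x \<in> carrier (J n) \<Longrightarrow> d n x \<in> carrier (J (Suc n))"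
  using d_hom[of n] by (auto simp: graded_hom_def)

lemma d_component: "x \<in> component (J n) a \<Longrightarrow> d n x \<in> component (J (Suc n)) a"
  using d_hom[of n] unfolding graded_hom_def by blast

lemma dW_phi: "x \<in> carrier (J n) \<Longrightarrow> dW n (\<phi> n x) = \<phi> (Suc n) (d n x)"
  by (simp add: dW_def embedded_module.psi_phi[OF emb])

lemma UJ_E: assumes "w \<in> UJ n" obtains x where "x \<in> carrier (J n)" "w = \<phi> n x"
  using assms embedded_module.psi_in[OF emb assms] embedded_module.phi_psi[OF emb assms] by metis

lemma phi_UJ: "x \<in> carrier (J n) \<Longrightarrow> \<phi> n x \<in> UJ n"
  using embedded_module.U_def[OF emb] by blast

lemma dW_U: "w \<in> UJ n \<Longrightarrow> dW n w \<in> UJ (Suc n)"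
  by (elim UJ_E) (simp add: dW_phi phi_UJ d_carrier)

lemma dW_V: "w \<in> VJ n a \<Longrightarrow> dW n w \<in> VJ (Suc n) a"
  using embedded_module.psi_V[OF emb, of w n a] d_component
  by (auto simp: dW_def embedded_module.V_def[OF emb])

lemma dW_add: assumes "w \<in> UJ n" "w' \<in> UJ n" shows "dW n (w + w') = dW n w + dW n w'"
proof -
  interpret A: embedded_module Q "J n" "\<phi> n" by (rule emb)
  interpret B: embedded_module Q "J (Suc n)" "\<phi> (Suc n)" by (rule emb)
  obtain x y where x: "x \<in> carrier (J n)" "w = \<phi> n x" and y: "y \<in> carrier (J n)" "w' = \<phi> n y"
    using assms by (elim UJ_E)
  have "d n (x \<oplus>\<^bsub>J n\<^esub> y) = d n x \<oplus>\<^bsub>J (Suc n)\<^esub> d n y" using d_hom[of n] x y by (auto simp: graded_hom_def)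
  then show ?thesis unfolding x(2) y(2) A.phi_add[OF x(1) y(1), symmetric]
    using x y by (simp add: dW_phi B.phi_add d_carrier)
qed

lemma d_smult: "r \<in> carrier (semigroup_ring Q) \<Longrightarrow> x \<in> carrier (J n) \<Longrightarrow> d n (r \<odot>\<^bsub>J n\<^esub> x) = r \<odot>\<^bsub>J (Suc n)\<^esub> d n x"
  using d_hom[of n] by (auto simp: graded_hom_def)

lemma dW_scale: assumes "w \<in> UJ n" shows "dW n (fscale c w) = fscale c (dW n w)"
proof -
  interpret A: embedded_module Q "J n" "\<phi> n" by (rule emb)
  interpret B: embedded_module Q "J (Suc n)" "\<phi> (Suc n)" by (rule emb)
  obtain x where x: "x \<in> carrier (J n)" "w = \<phi> n x" using assms by (elim UJ_E)
  show ?thesis unfolding x(2) A.phi_scale[OF x(1), symmetric] dW_phi[OF x(1)] B.phi_scale[OF d_carrier[OF x(1)], symmetric]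
    using dW_phi[of "mon 0 c \<odot>\<^bsub>J n\<^esub> x" n] d_smult[OF A.const_R x(1)] x(1) by simp
qed

lemma dW_act: assumes "q \<in> Q" "w \<in> UJ n" shows "dW n (actJ n q w) = actJ (Suc n) q (dW n w)"
proof -
  interpret A: embedded_module Q "J n" "\<phi> n" by (rule emb)
  interpret B: embedded_module Q "J (Suc n)" "\<phi> (Suc n)" by (rule emb)
  obtain x where x: "x \<in> carrier (J n)" "w = \<phi> n x" using assms by (elim UJ_E)
  show ?thesis unfolding x(2) A.act_phi[OF x(1)] dW_phi[OF x(1)] B.act_phi[OF d_carrier[OF x(1)]]
    using dW_phi[of "mon q 1 \<odot>\<^bsub>J n\<^esub> x" n] d_smult[OF A.mon_R[OF assms(1)] x(1)]
      A.smult_closed[OF A.mon_R[OF assms(1)] x(1)] by simp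
qed

lemma dW_dW: assumes "w \<in> UJ n" shows "dW (Suc n) (dW n w) = 0"
  using assms d_d[of _ n] embedded_module.phi_zero[OF emb]
  by (elim UJ_E) (simp add: dW_phi d_carrier)

text \<open>The index is shifted by one: starting with the zero module spares the case distinction for the
  boundaries in degree \<open>0\<close>.\<close>

definition CJ where "CJ n a = (case n of 0 \<Rightarrow> {0} | Suc m \<Rightarrow> VJ m a)"
definition XJ where "XJ n q w = (case n of 0 \<Rightarrow> w | Suc m \<Rightarrow> actJ m q w)"
definition DJ where "DJ n w = (case n of 0 \<Rightarrow> 0 | Suc m \<Rightarrow> dW m w)"

lemma CJ_simps: "CJ 0 a = {0}" "CJ (Suc m) a = VJ m a"
  and XJ_simps: "XJ 0 q w = w" "XJ (Suc m) q w = actJ m q w"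
  and DJ_simps: "DJ 0 w = 0" "DJ (Suc m) w = dW m w"
  by (simp_all add: CJ_def XJ_def DJ_def)

lemma VJ_UJ: "w \<in> VJ n a \<Longrightarrow> w \<in> UJ n"
  using embedded_module.V_U[OF emb] by blast

lemma zero_VJ: "0 \<in> VJ n a"
  by (rule fvs.subspace_0[OF embedded_module.subspace_V[OF emb]])

lemma baer_complex_J: "baer_complex G l fscale CJ XJ DJ"
proof (unfold_locales, goal_cases)
  case (1 n a) show ?case by (cases n) (simp_all add: CJ_simps embedded_module.subspace_V[OF emb] fvs.subspace_single_0)
next
  case (2 q x n a) then show ?case by (cases n) (simp_all add: CJ_simps XJ_simps embedded_module.act_V[OF emb])
next
  case (3 q x n a y) then show ?case by (cases n) (auto simp: CJ_simps XJ_simps intro!: embedded_module.act_add[OF emb] VJ_UJ)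
next
  case (4 q x n a c) then show ?case by (cases n) (auto simp: CJ_simps XJ_simps intro!: embedded_module.act_scale[OF emb] VJ_UJ)
next
  case (5 x n a) then show ?case by (cases n) (auto simp: CJ_simps XJ_simps intro!: embedded_module.act_0[OF emb] VJ_UJ)
next
  case (6 q r x n a) then show ?case by (cases n) (auto simp: CJ_simps XJ_simps intro!: embedded_module.act_act[OF emb] VJ_UJ)
next
  case (7 x n a) then show ?case by (cases n) (auto simp: CJ_simps DJ_simps dW_V zero_VJ)
next
  case (8 x n a y) then show ?case by (cases n) (auto simp: CJ_simps DJ_simps intro!: dW_add VJ_UJ)
next
  case (9 x n a c) then show ?case by (cases n) (auto simp: CJ_simps DJ_simps intro!: dW_scale VJ_UJ)
next
  case (10 q x n a)
  have "actJ 0 q 0 = 0" if "q \<in> Q" for q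
    using embedded_module.act_scale[OF emb that, of 0 0 0] VJ_UJ[OF zero_VJ] by simp
  then show ?case using 10 by (cases n) (auto simp: CJ_simps DJ_simps XJ_simps intro!: dW_act VJ_UJ)
next
  case (11 x n a)
  have "dW 0 0 = 0" using dW_scale[OF VJ_UJ[OF zero_VJ], of 0 0] by simp
  then show ?case using 11 by (cases n) (auto simp: CJ_simps DJ_simps intro!: dW_dW VJ_UJ)
next
  case (12 I f n a)
  show ?case
  proof (cases n)
    case 0
    then have "f q = 0" if "q \<in> I" for q using 12(2)[OF that] by (simp add: CJ_simps)
    then show ?thesis by (simp add: 0 CJ_simps XJ_simps)
  next
    case (Suc m)
    show ?thesis
      using embedded_module.injective_baer[OF emb inj monoid_ideal_Q 12(1), of f m a] 12 unfolding Suc CJ_simps XJ_simps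
      by blast
  qed
qed

end

text \<open>As rewrite rules these eta-expand sums of elements of \<open>'m \<Rightarrow> 'k\<close> in argument position.\<close>

declare plus_fun_apply [simp del] zero_fun_apply [simp del]

context embedded_resolution
begin

interpretation C: baer_complex G l fscale CJ XJ DJ
  by (rule baer_complex_J)

interpretation T: baer_complex G l fscale C.tors XJ DJ
  by (rule C.baer_tors)

abbreviation "projJ n \<equiv> decomposition.proj (VJ n)"

lemma decJ: "decomposition (UJ n) (VJ n)"
  by (rule embedded_module.decomposition[OF emb])

lemma proj_dW: "w \<in> UJ n \<Longrightarrow> projJ (Suc n) (dW n w) a = dW n (projJ n w a)"
  using proj_map[OF decJ[of n] decJ[of "Suc n"], of "dW n" 0 w a] by (simp add: dW_add dW_U dW_V)

lemma proj_act: "q \<in> Q \<Longrightarrow> w \<in> UJ n \<Longrightarrow> projJ n (actJ n q w) (a + q) = actJ n q (projJ n w a)"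
  by (rule proj_map[OF decJ decJ])
    (auto intro: embedded_module.act_add[OF emb] embedded_module.act_U[OF emb] embedded_module.act_V[OF emb])

lemma proj_fscale: "w \<in> UJ n \<Longrightarrow> projJ n (fscale c w) a = fscale c (projJ n w a)"
  using proj_map[OF decJ[of n] decJ[of n], of "fscale c" 0 w a]
    fvs.subspace_scale[OF embedded_module.subspace_U[OF emb]] fvs.subspace_scale[OF embedded_module.subspace_V[OF emb]]
  by (simp add: fvs.scale_right_distrib)

lemma proj_V: "w \<in> UJ n \<Longrightarrow> projJ n w a \<in> VJ n a"
  by (rule decomposition.proj(1)[OF decJ])

lemma proj_id: "w \<in> VJ n a \<Longrightarrow> projJ n w a = w"
  using decomposition.proj_homogeneous[OF decJ] by simp

text \<open>Exactness leaves cohomology in index 1 only, where the cycles are generated by the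
  finitely many \<open>y g\<close> and hence lie in the graded span of their homogeneous
  components.\<close>

lemma noetherian_J:
  assumes exact: "\<And>n x. x \<in> carrier (J (Suc n)) \<Longrightarrow> d (Suc n) x = \<zero>\<^bsub>J (Suc (Suc n))\<^esub> \<Longrightarrow> x \<in> d n ` carrier (J n)"
    and fin: "finite S" and y: "\<And>g. g \<in> S \<Longrightarrow> y g \<in> carrier (J 0)"
    and gen: "\<And>x. x \<in> carrier (J 0) \<Longrightarrow> d 0 x = \<zero>\<^bsub>J (Suc 0)\<^esub> \<Longrightarrow>
      \<exists>c\<in>S \<rightarrow> carrier (semigroup_ring Q). \<phi> 0 x = (\<Sum>g\<in>S. \<phi> 0 (c g \<odot>\<^bsub>J 0\<^esub> y g))"
  shows "C.chain_H (\<le>) n {}"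
proof -
  have ker: "d n (psiJ n w) = \<zero>\<^bsub>J (Suc n)\<^esub>" if "w \<in> UJ n" "dW n w = 0" for n w
    using that embedded_module.phi_eq_0_iff[OF emb] d_carrier[OF embedded_module.psi_in[OF emb that(1)]]
    by (simp add: dW_def)
  consider "n = 0" | "n = Suc 0" | m where "n = Suc (Suc m)" by (metis not0_implies_Suc)
  then show ?thesis
  proof cases
    case 1
    then show ?thesis using C.chain_H_0[of "{}" "(\<le>)"] by (simp add: CJ_simps)
  next
    case 2
    interpret E: embedded_module Q "J 0" "\<phi> 0" by (rule emb)
    define Y where "Y = (\<Union>g\<in>S. (\<lambda>b. (b, projJ 0 (\<phi> 0 (y g)) b)) ` {b. projJ 0 (\<phi> 0 (y g)) b \<noteq> 0})"
    have yU: "\<phi> 0 (y g) \<in> UJ 0" if "g \<in> S" for g using y that phi_UJ by blast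
    have finY: "finite Y" unfolding Y_def using fin decomposition.proj(2)[OF decJ yU] by auto
    have YC: "v \<in> CJ n b" if "(b, v) \<in> Y" for b v
      using that proj_V[OF yU] unfolding Y_def 2 CJ_simps by auto
    have sub: "fvs.subspace (C.gspan n Y a)" for a by (simp add: C.gspan_def)
    \<comment> \<open>The \<open>y g\<close> need not be homogeneous. \<open>?P\<close> collects the
      elements all of whose components lie in \<open>gspan\<close>; it is a subspace that contains
      every monomial multiple of a \<open>y g\<close>, hence all combinations in
      \<open>gen\<close>.\<close>
    let ?P = "{z \<in> UJ 0. \<forall>a. projJ 0 z a \<in> C.gspan n Y a}"
    have proj0: "projJ 0 0 a = 0" for a using proj_id[OF zero_VJ] .
    have P: "fvs.subspace ?P"
      unfolding fvs.subspace_def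
    proof (intro conjI ballI allI)
      show "0 \<in> ?P" using proj0 fvs.subspace_0[OF sub] fvs.subspace_0[OF E.subspace_U] by auto
    next
      fix u v assume "u \<in> ?P" "v \<in> ?P"
      then show "u + v \<in> ?P"
        using decomposition.proj_add[OF decJ, of u 0 v] fvs.subspace_add[OF sub] fvs.subspace_add[OF E.subspace_U]
        by auto
    next
      fix c u assume "u \<in> ?P"
      then show "fscale c u \<in> ?P"
        using proj_fscale fvs.subspace_scale[OF sub] fvs.subspace_scale[OF E.subspace_U] by auto
    qed
    have actP: "actJ 0 q (\<phi> 0 (y g)) \<in> ?P" if q: "q \<in> Q" and g: "g \<in> S" for q g
    proof -
      have "projJ 0 (actJ 0 q (\<phi> 0 (y g))) a \<in> C.gspan n Y a" for a
      proof -
        let ?v = "projJ 0 (\<phi> 0 (y g)) (a - q)"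
        have eq: "projJ 0 (actJ 0 q (\<phi> 0 (y g))) a = XJ n (a - (a - q)) ?v"
          using proj_act[OF q yU[OF g], of "a - q"] by (simp add: 2 XJ_simps)
        show ?thesis
        proof (cases "?v = 0")
          case True
          then show ?thesis unfolding eq using C.X_zero[OF q, of n] fvs.subspace_0[OF sub] by simp
        next
          case False
          then have "(a - q, ?v) \<in> Y" using g unfolding Y_def by auto
          moreover have "a - (a - q) \<in> Q" using q by simp
          ultimately show ?thesis unfolding eq C.gspan_def by (intro fvs.span_base) blast
        qed
      qed
      then show ?thesis using E.act_U[OF q yU[OF g]] by blast
    qed
    have cyc: "C.cycles n {} a \<subseteq> C.gspan n Y a" for a
    proof
      fix w assume "w \<in> C.cycles n {} a"
      then have w: "w \<in> VJ 0 a" "dW 0 w = 0" unfolding 2 by (auto simp: C.cycles_def C.ann_def CJ_simps DJ_simps)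
      then have wU: "w \<in> UJ 0" using VJ_UJ by blast
      obtain c where c: "c \<in> S \<rightarrow> carrier (semigroup_ring Q)" "w = (\<Sum>g\<in>S. \<phi> 0 (c g \<odot>\<^bsub>J 0\<^esub> y g))"
        using gen[OF E.psi_in[OF wU] ker[OF wU w(2)]] unfolding E.phi_psi[OF wU] by blast
      have "\<phi> 0 (c g \<odot>\<^bsub>J 0\<^esub> y g) \<in> ?P" if "g \<in> S" for g
        by (rule E.phi_smult_in_subspace[of _ Q, OF _ _ y[OF that] P])
          (use c(1) that actP in \<open>auto simp: semigroup_ring_simps\<close>)
      then have "w \<in> ?P" unfolding c(2) by (intro fvs.subspace_sum[OF P])
      then have "projJ 0 w a \<in> C.gspan n Y a" by blast
      then show "w \<in> C.gspan n Y a" using proj_id[OF w(1)] by simp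
    qed
    have "C.boundaries n {} a = {0}" for a
      unfolding 2 C.boundaries_Suc by (auto simp: C.ann_def CJ_simps DJ_simps)
    then have "C.Itv n (C.boundaries n {}) (C.cycles n {}) \<subseteq> C.Itv n (\<lambda>a. {0}) (C.gspan n Y)"
      using cyc unfolding fvs.interval_def by (simp add: subset_iff) 
    then show ?thesis unfolding C.chain_H_def
      by (intro chain_condition_inj[OF C.noetherian_gspan[OF finY YC], of _ "\<lambda>N. N"]) auto
  next
    case 3
    have "C.cycles n {} a \<subseteq> C.boundaries n {} a" for a
    proof
      fix w assume "w \<in> C.cycles n {} a"
      then have w: "w \<in> VJ (Suc m) a" "dW (Suc m) w = 0" unfolding 3 by (auto simp: C.cycles_def C.ann_def CJ_simps DJ_simps)
      then have wU: "w \<in> UJ (Suc m)" using VJ_UJ by blast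
      obtain x where x: "x \<in> carrier (J m)" "psiJ (Suc m) w = d m x"
        using exact[OF embedded_module.psi_in[OF emb wU] ker[OF wU w(2)]] by blast
      have "w = dW m (\<phi> m x)" using x dW_phi[OF x(1)] embedded_module.phi_psi[OF emb wU] by simp
      \<comment> \<open>The primitive found by exactness may be inhomogeneous; its component of
        degree \<open>a\<close> is still a primitive, as the differential preserves degrees.\<close>
      then have "w = dW m (projJ m (\<phi> m x) a)" using proj_id[OF w(1)] proj_dW[OF phi_UJ[OF x(1)]] by simp
      moreover have "projJ m (\<phi> m x) a \<in> C.ann (Suc m) {} a"
        using proj_V[OF phi_UJ[OF x(1)]] by (simp add: C.ann_def CJ_simps)
      ultimately show "w \<in> C.boundaries n {} a" unfolding 3 C.boundaries_Suc by (auto simp: DJ_simps)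
    qed
    then have "N = C.boundaries n {}" if "N \<in> C.Itv n (C.boundaries n {}) (C.cycles n {})" for N
      using C.intervalD(2,3)[OF that] by (intro ext) blast
    then have "C.Itv n (C.boundaries n {}) (C.cycles n {}) \<subseteq> {C.boundaries n {}}" by blast
    then show ?thesis unfolding C.chain_H_def by (rule chain_condition_singleton)
  qed
qed

abbreviation "TJ n \<equiv> torsion (semigroup_ring Q) (max_monomial_ideal Q) (J n)"

definition torsW where "torsW n = {w \<in> UJ n. \<exists>N. \<forall>q\<in>Q. l q \<ge> N \<longrightarrow> actJ n q w = 0}"

lemma carrier_TJ: "carrier (TJ n) \<subseteq> carrier (J n)"
  and component_TJ: "component (TJ n) a = component (J n) a \<inter> carrier (TJ n)"
  and TJ_ops: "zero (TJ n) = zero (J n)" "add (TJ n) = add (J n)" "smult (TJ n) = smult (J n)"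
  by (auto simp: torsion_def Let_def)

lemma torsW_iff: "x \<in> carrier (J n) \<Longrightarrow> \<phi> n x \<in> torsW n \<longleftrightarrow> x \<in> carrier (TJ n)"
  using torsion_iff[OF emb] phi_UJ by (simp add: torsW_def)

lemma torsW_image: "torsW n = \<phi> n ` carrier (TJ n)"
proof (intro equalityI subsetI)
  fix w assume w: "w \<in> torsW n"
  then have "w \<in> UJ n" by (simp add: torsW_def)
  then obtain x where "x \<in> carrier (J n)" "w = \<phi> n x" by (rule UJ_E)
  then show "w \<in> \<phi> n ` carrier (TJ n)" using torsW_iff w by blast
next
  fix w assume "w \<in> \<phi> n ` carrier (TJ n)"
  then show "w \<in> torsW n" using torsW_iff carrier_TJ by blast
qed

lemma torsW_tors: "w \<in> VJ n a \<Longrightarrow> w \<in> torsW n \<longleftrightarrow> w \<in> C.tors (Suc n) a"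
  using VJ_UJ by (auto simp: torsW_def C.tors_def CJ_simps XJ_simps)

lemma subspace_torsW: "fvs.subspace (torsW n)"
proof -
  interpret E: embedded_module Q "J n" "\<phi> n" by (rule emb)
  note sub = E.subspace_U[unfolded fvs.subspace_def]
  show ?thesis
    unfolding fvs.subspace_def
  proof (intro conjI ballI allI)
    have "actJ n q 0 = 0" if "q \<in> Q" for q using E.act_scale[OF that, of 0 0] sub by simp
    then show "0 \<in> torsW n" using sub by (auto simp: torsW_def)
  next
    fix u v assume "u \<in> torsW n" "v \<in> torsW n"
    then obtain N M where "u \<in> UJ n" "v \<in> UJ n" "\<And>q. q \<in> Q \<Longrightarrow> l q \<ge> N \<Longrightarrow> actJ n q u = 0"
      "\<And>q. q \<in> Q \<Longrightarrow> l q \<ge> M \<Longrightarrow> actJ n q v = 0" unfolding torsW_def by blast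
    then show "u + v \<in> torsW n"
      using sub E.act_add unfolding torsW_def by (auto intro!: exI[of _ "max N M"])
  next
    fix c u assume "u \<in> torsW n"
    then show "fscale c u \<in> torsW n"
      using sub E.act_scale unfolding torsW_def by fastforce
  qed
qed

text \<open>Monomials only shift components, so a monomial that kills \<open>w\<close> kills each
  component: torsion is a graded submodule.\<close>

lemma proj_torsW: assumes "w \<in> torsW n" shows "projJ n w a \<in> torsW n"
proof -
  obtain N where w: "w \<in> UJ n" and N: "\<And>q. q \<in> Q \<Longrightarrow> l q \<ge> N \<Longrightarrow> actJ n q w = 0"
    using assms unfolding torsW_def by blast
  have "actJ n q (projJ n w a) = 0" if "q \<in> Q" "l q \<ge> N" for q
    using proj_act[OF that(1) w, of a] N[OF that] proj_id[OF zero_VJ, of n "a + q"] by simp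
  then show ?thesis using VJ_UJ[OF proj_V[OF w]] unfolding torsW_def by blast
qed

lemma dW_torsW: assumes "w \<in> torsW n" shows "dW n w \<in> torsW (Suc n)"
proof -
  obtain N where w: "w \<in> UJ n" and N: "\<And>q. q \<in> Q \<Longrightarrow> l q \<ge> N \<Longrightarrow> actJ n q w = 0"
    using assms unfolding torsW_def by blast
  have "dW n 0 = 0" using dW_scale[OF VJ_UJ[OF zero_VJ], of n 0] by simp
  then have "actJ (Suc n) q (dW n w) = 0" if "q \<in> Q" "l q \<ge> N" for q
    using dW_act[OF that(1) w] N[OF that] by simp
  then show ?thesis using dW_U[OF w] unfolding torsW_def by blast
qed

end

section \<open>Hilbert functions of local cohomology modules\<close>

context embedded_resolution
begin

interpretation C: baer_complex G l fscale CJ XJ DJ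
  by (rule baer_complex_J)

interpretation T: baer_complex G l fscale C.tors XJ DJ
  by (rule C.baer_tors)

text \<open>Transports dimensions from intervals of subspaces to the quotient module in the
  definition of local cohomology. The index \<open>Suc i\<close> accounts for the zero space put in
  front of the resolution.\<close>

lemma hilbert_function_local_cohomology:
  assumes rd: "\<And>a. fvs.rdim (T.boundaries (Suc i) {} a) (T.cycles (Suc i) {} a) (h a)"
  shows "has_hilbert_function (local_cohomology (semigroup_ring Q) (max_monomial_ideal Q) J d i) h"
proof -
  interpret E: embedded_module Q "J i" "\<phi> i" by (rule emb)
  let ?\<phi> = "\<phi> i" and ?M = "J i"

  \<comment> \<open>Cycles and boundaries of the torsion complex and their images under the
    embedding\<close>
  define Z where "Z = {x \<in> carrier (TJ i). d i x = \<zero>\<^bsub>TJ (Suc i)\<^esub>}"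
  define B where "B = (case i of 0 \<Rightarrow> {\<zero>\<^bsub>TJ 0\<^esub>} | Suc j \<Rightarrow> d j ` carrier (TJ j))"
  define H where "H = subquotient (TJ i) Z B"
  have H: "local_cohomology (semigroup_ring Q) (max_monomial_ideal Q) J d i = H"
    unfolding local_cohomology_def cohomology_def H_def Z_def B_def ..
  define ZW where "ZW = {w \<in> torsW i. dW i w = 0}"
  define BW where "BW = (case i of 0 \<Rightarrow> {0} | Suc j \<Rightarrow> dW j ` torsW j)"
  have torsU: "torsW n \<subseteq> UJ n" for n by (auto simp: torsW_def)
  have subZ: "fvs.subspace ZW"
    using subspace_torsW[of i] torsU[of i] unfolding fvs.subspace_def ZW_def
    using dW_add[of _ i] dW_scale[of _ i] dW_scale[OF VJ_UJ[OF zero_VJ], of i 0] by (auto simp: subset_iff)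
  have subB: "fvs.subspace BW"
  proof (cases i)
    case 0
    then show ?thesis by (simp add: BW_def fvs.subspace_single_0)
  next
    case (Suc j)
    note S = subspace_torsW[of j]
    have add: "dW j u + dW j v = dW j (u + v)" and scl: "fscale c (dW j u) = dW j (fscale c u)"
      if "u \<in> torsW j" "v \<in> torsW j" for u v c
      using dW_add[of u j v] dW_scale[of u j c] subsetD[OF torsU that(1)] subsetD[OF torsU that(2)] by simp_all
    have "fvs.subspace (dW j ` torsW j)"
      unfolding fvs.subspace_def
    proof (intro conjI ballI allI)
      have "dW j 0 = 0" using dW_scale[OF VJ_UJ[OF zero_VJ], of j 0] by simp
      then show "0 \<in> dW j ` torsW j" using fvs.subspace_0[OF S] by (metis imageI)
    next
      fix x y assume "x \<in> dW j ` torsW j" "y \<in> dW j ` torsW j"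
      then obtain u v where "x = dW j u" "y = dW j v" "u \<in> torsW j" "v \<in> torsW j" by blast
      then show "x + y \<in> dW j ` torsW j" using add fvs.subspace_add[OF S] by (metis imageI)
    next
      fix c x assume "x \<in> dW j ` torsW j"
      then obtain u where "x = dW j u" "u \<in> torsW j" by blast
      then show "fscale c x \<in> dW j ` torsW j" using scl[of u u c] fvs.subspace_scale[OF S] by (metis imageI)
    qed
    then show ?thesis by (simp add: BW_def Suc)
  qed
  have BWU: "BW \<subseteq> UJ i"
    using VJ_UJ[OF zero_VJ] dW_U[OF subsetD[OF torsU]] by (auto simp: BW_def split: nat.split)
  have BZ: "BW \<subseteq> ZW"
    using fvs.subspace_0[OF subZ] dW_torsW dW_dW[OF subsetD[OF torsU]] by (auto simp: BW_def ZW_def split: nat.split)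
  have Zc: "Z \<subseteq> carrier ?M" using subsetD[OF carrier_TJ] by (auto simp: Z_def)
  have Z_iff: "x \<in> Z \<longleftrightarrow> ?\<phi> x \<in> ZW" if "x \<in> carrier ?M" for x
    using that torsW_iff[OF that] dW_phi[OF that] embedded_module.phi_eq_0_iff[OF emb d_carrier[OF that]]
    by (auto simp: Z_def ZW_def TJ_ops)
  have BWim: "BW = ?\<phi> ` B"
  proof (cases i)
    case 0
    then show ?thesis using E.phi_zero by (simp add: BW_def B_def TJ_ops)
  next
    case (Suc j)
    have "dW j ` \<phi> j ` carrier (TJ j) = \<phi> (Suc j) ` d j ` carrier (TJ j)"
      unfolding image_image by (intro image_cong refl dW_phi subsetD[OF carrier_TJ])
    then show ?thesis by (simp add: BW_def B_def Suc torsW_image)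
  qed
  have Bc: "B \<subseteq> carrier ?M"
  proof (cases i)
    case (Suc j)
    then show ?thesis using d_carrier[OF subsetD[OF carrier_TJ]] by (auto simp: B_def)
  qed (use E.M.zero_closed in \<open>auto simp: B_def TJ_ops\<close>)
  have cyc: "T.cycles (Suc i) {} a = ZW \<inter> VJ i a" for a
    using torsW_tors C.tors_C[of _ "Suc i" a] by (auto simp: T.cycles_def T.ann_def ZW_def DJ_simps CJ_simps)
  have bnd: "T.boundaries (Suc i) {} a = BW \<inter> VJ i a" for a
  proof (cases i)
    case 0
    have "C.tors 0 a = {0}" using C.sub_tors[of 0 a] C.tors_C[of _ 0 a] fvs.subspace_0 by (auto simp: CJ_simps)
    then show ?thesis using zero_VJ by (auto simp: 0 BW_def T.boundaries_Suc T.ann_def DJ_simps)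
  next
    case (Suc j)
    \<comment> \<open>A homogeneous boundary has a homogeneous primitive: project any torsion
      primitive to degree \<open>a\<close>.\<close>
    have "w \<in> dW j ` C.tors (Suc j) a" if w: "w \<in> dW j ` torsW j" "w \<in> VJ (Suc j) a" for w
    proof -
      obtain u where u: "u \<in> torsW j" "w = dW j u" using w by blast
      have uU: "u \<in> UJ j" using u torsU by blast
      have "w = dW j (projJ j u a)" using proj_id[OF w(2)] proj_dW[OF uU] u by simp
      moreover have "projJ j u a \<in> C.tors (Suc j) a"
        using torsW_tors[OF proj_V[OF uU]] proj_torsW[OF u(1)] by blast
      ultimately show ?thesis by blast
    qed
    moreover have "dW j u \<in> dW j ` torsW j \<inter> VJ (Suc j) a" if "u \<in> C.tors (Suc j) a" for u
    proof -
      have "u \<in> VJ j a" using C.tors_C[OF that] by (simp add: CJ_simps)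
      then show ?thesis using torsW_tors that dW_V by blast
    qed
    ultimately show ?thesis by (auto simp: Suc BW_def T.boundaries_Suc T.ann_def DJ_simps)
  qed

  \<comment> \<open>Cosets and the operations of the quotient module\<close>
  define coset where "coset x = B +>\<^bsub>TJ i\<^esub> x" for x
  have coset: "coset x = {z \<in> carrier ?M. ?\<phi> z - ?\<phi> x \<in> BW}" if x: "x \<in> carrier ?M" for x
  proof -
    have "coset x = (\<lambda>b. b \<oplus>\<^bsub>?M\<^esub> x) ` B"
      by (auto simp: coset_def a_r_coset_def r_coset_def TJ_ops)
    also have "\<dots> = {z \<in> carrier ?M. ?\<phi> z - ?\<phi> x \<in> BW}"
    proof (intro equalityI subsetI)
      fix z assume "z \<in> (\<lambda>b. b \<oplus>\<^bsub>?M\<^esub> x) ` B"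
      then obtain b where b: "b \<in> B" "z = b \<oplus>\<^bsub>?M\<^esub> x" by blast
      then have "b \<in> carrier ?M" using Bc by blast
      then show "z \<in> {z \<in> carrier ?M. ?\<phi> z - ?\<phi> x \<in> BW}" using b x BWim by (simp add: E.phi_add)
    next
      fix z assume z: "z \<in> {z \<in> carrier ?M. ?\<phi> z - ?\<phi> x \<in> BW}"
      then obtain b where b: "b \<in> B" "?\<phi> z - ?\<phi> x = ?\<phi> b" unfolding BWim by blast
      then have bc: "b \<in> carrier ?M" using Bc by blast
      have "?\<phi> z = ?\<phi> (b \<oplus>\<^bsub>?M\<^esub> x)" unfolding E.phi_add[OF bc x] b(2)[symmetric] by simp
      then have "z = b \<oplus>\<^bsub>?M\<^esub> x" using E.phi_eq_iff z bc x by simp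
      then show "z \<in> (\<lambda>b. b \<oplus>\<^bsub>?M\<^esub> x) ` B" using b by blast
    qed
    finally show ?thesis .
  qed
  have coset_eq: "coset x = coset y \<longleftrightarrow> ?\<phi> x - ?\<phi> y \<in> BW" if x: "x \<in> carrier ?M" and y: "y \<in> carrier ?M" for x y
  proof
    assume "coset x = coset y"
    moreover have "x \<in> coset x" using coset[OF x] x fvs.subspace_0[OF subB] by simp
    ultimately show "?\<phi> x - ?\<phi> y \<in> BW" using coset[OF y] by blast
  next
    assume *: "?\<phi> x - ?\<phi> y \<in> BW"
    have "?\<phi> z - ?\<phi> x \<in> BW \<longleftrightarrow> ?\<phi> z - ?\<phi> y \<in> BW" for z
      using fvs.subspace_add[OF subB _ *, of "?\<phi> z - ?\<phi> x"] fvs.subspace_diff[OF subB _ *, of "?\<phi> z - ?\<phi> y"] by auto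
    then show "coset x = coset y" using coset x y by simp
  qed
  have coset_in: "y \<in> coset x \<longleftrightarrow> y \<in> carrier ?M \<and> coset y = coset x" if "x \<in> carrier ?M" for x y
    using coset[OF that] coset_eq[of y x] that by auto

  have H_ops: "carrier H = coset ` Z" "zero H = B" "add H = set_add (TJ i)"
    "smult H = (\<lambda>r X. \<Union>x\<in>X. B +>\<^bsub>TJ i\<^esub> (r \<odot>\<^bsub>TJ i\<^esub> x))"
    "component H a = coset ` (Z \<inter> component ?M a)" for a
    by (auto simp: H_def subquotient_def coset_def component_TJ Z_def)
  have coset_add: "coset x \<oplus>\<^bsub>H\<^esub> coset y = coset (x \<oplus>\<^bsub>?M\<^esub> y)" if x: "x \<in> carrier ?M" and y: "y \<in> carrier ?M" for x y
  proof -
    have "coset x \<oplus>\<^bsub>H\<^esub> coset y = {u \<oplus>\<^bsub>?M\<^esub> v | u v. u \<in> coset x \<and> v \<in> coset y}"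
      by (auto simp: H_ops set_add_def set_mult_def TJ_ops)
    also have "\<dots> = coset (x \<oplus>\<^bsub>?M\<^esub> y)"
    proof (intro equalityI subsetI)
      fix z assume "z \<in> {u \<oplus>\<^bsub>?M\<^esub> v | u v. u \<in> coset x \<and> v \<in> coset y}"
      then obtain u v where uv: "z = u \<oplus>\<^bsub>?M\<^esub> v" "u \<in> carrier ?M" "v \<in> carrier ?M" "?\<phi> u - ?\<phi> x \<in> BW" "?\<phi> v - ?\<phi> y \<in> BW"
        using coset[OF x] coset[OF y] by blast
      have "?\<phi> z - ?\<phi> (x \<oplus>\<^bsub>?M\<^esub> y) = (?\<phi> u - ?\<phi> x) + (?\<phi> v - ?\<phi> y)"
        unfolding uv(1) E.phi_add[OF uv(2,3)] E.phi_add[OF x y] by simp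
      then have "?\<phi> z - ?\<phi> (x \<oplus>\<^bsub>?M\<^esub> y) \<in> BW" using fvs.subspace_add[OF subB uv(4,5)] by simp
      then show "z \<in> coset (x \<oplus>\<^bsub>?M\<^esub> y)" using coset[of "x \<oplus>\<^bsub>?M\<^esub> y"] x y uv by simp
    next
      fix z assume "z \<in> coset (x \<oplus>\<^bsub>?M\<^esub> y)"
      then have z: "z \<in> carrier ?M" "?\<phi> z - ?\<phi> (x \<oplus>\<^bsub>?M\<^esub> y) \<in> BW" using coset[of "x \<oplus>\<^bsub>?M\<^esub> y"] x y by auto
      \<comment> \<open>The deviation of z from x + y is put entirely into the first
        summand.\<close>
      define u where "u = z \<ominus>\<^bsub>?M\<^esub> y"
      have u: "u \<in> carrier ?M" "z = u \<oplus>\<^bsub>?M\<^esub> y"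
        using z x y by (auto simp: u_def a_minus_def E.M.a_assoc E.M.l_neg)
      have "?\<phi> u - ?\<phi> x = ?\<phi> z - ?\<phi> (x \<oplus>\<^bsub>?M\<^esub> y)" unfolding u(2) E.phi_add[OF u(1) y] E.phi_add[OF x y] by simp
      then have "u \<in> coset x" using coset[OF x] u z by simp
      moreover have "y \<in> coset y" using coset_in[OF y] y by blast
      ultimately show "z \<in> {u \<oplus>\<^bsub>?M\<^esub> v | u v. u \<in> coset x \<and> v \<in> coset y}" using u(2) by blast
    qed
    finally show ?thesis .
  qed
  have coset_scale: "mon 0 c \<odot>\<^bsub>H\<^esub> coset x = coset (mon 0 c \<odot>\<^bsub>?M\<^esub> x)" if x: "x \<in> carrier ?M" for x c
  proof -
    \<comment> \<open>The scalar multiple of a class is a union over its representatives; all of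
      them give the same coset, so the union collapses.\<close>
    have "coset (mon 0 c \<odot>\<^bsub>?M\<^esub> y) = coset (mon 0 c \<odot>\<^bsub>?M\<^esub> x)" if "y \<in> coset x" for y
    proof -
      have y: "y \<in> carrier ?M" "?\<phi> y - ?\<phi> x \<in> BW" using that coset[OF x] by auto
      have "?\<phi> (mon 0 c \<odot>\<^bsub>?M\<^esub> y) - ?\<phi> (mon 0 c \<odot>\<^bsub>?M\<^esub> x) = fscale c (?\<phi> y - ?\<phi> x)"
        unfolding E.phi_scale[OF x] E.phi_scale[OF y(1)] fvs.scale_right_diff_distrib ..
      then show ?thesis using coset_eq[OF E.smult_closed[OF E.const_R y(1)] E.smult_closed[OF E.const_R x]]
          fvs.subspace_scale[OF subB y(2)] by simp
    qed
    moreover have "x \<in> coset x" using coset_in[OF x] x by blast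
    ultimately show ?thesis unfolding H_ops TJ_ops coset_def[symmetric] by blast
  qed
  have Z_closed: "x \<oplus>\<^bsub>?M\<^esub> y \<in> Z" "mon 0 c \<odot>\<^bsub>?M\<^esub> x \<in> Z" if "x \<in> Z" "y \<in> Z" for x y c
  proof -
    have xy: "x \<in> carrier ?M" "y \<in> carrier ?M" "?\<phi> x \<in> ZW" "?\<phi> y \<in> ZW" using that Zc Z_iff by auto
    show "x \<oplus>\<^bsub>?M\<^esub> y \<in> Z"
      using Z_iff[OF E.M.a_closed[OF xy(1,2)]] fvs.subspace_add[OF subZ xy(3,4)] by (simp add: E.phi_add xy)
    show "mon 0 c \<odot>\<^bsub>?M\<^esub> x \<in> Z"
      using Z_iff[OF E.smult_closed[OF E.const_R xy(1)]] fvs.subspace_scale[OF subZ xy(3)] by (simp add: E.phi_scale xy)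
  qed
  have Z_0: "\<zero>\<^bsub>?M\<^esub> \<in> Z" using Z_iff[of "\<zero>\<^bsub>?M\<^esub>"] fvs.subspace_0[OF subZ] by simp
  have coset_0: "coset \<zero>\<^bsub>?M\<^esub> = B"
  proof -
    have "coset \<zero>\<^bsub>?M\<^esub> = (\<lambda>b. b \<oplus>\<^bsub>?M\<^esub> \<zero>\<^bsub>?M\<^esub>) ` B"
      by (auto simp: coset_def a_r_coset_def r_coset_def TJ_ops)
    also have "\<dots> = B" using Bc by (force simp: image_iff subset_iff)
    finally show ?thesis .
  qed
  have "abelian_monoid H"
  proof (rule abelian_monoidI)
    fix X Y assume "X \<in> carrier H" "Y \<in> carrier H"
    then obtain x y where xy: "X = coset x" "Y = coset y" "x \<in> Z" "y \<in> Z" by (auto simp: H_ops)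
    then have c: "x \<in> carrier ?M" "y \<in> carrier ?M" using Zc by auto
    show "X \<oplus>\<^bsub>H\<^esub> Y \<in> carrier H" using xy c Z_closed by (simp add: coset_add) (simp add: H_ops)
    show "X \<oplus>\<^bsub>H\<^esub> Y = Y \<oplus>\<^bsub>H\<^esub> X" using xy c by (simp add: coset_add E.M.a_comm)
    show "\<zero>\<^bsub>H\<^esub> \<oplus>\<^bsub>H\<^esub> X = X" using coset_add[of "\<zero>\<^bsub>?M\<^esub>" x] xy c by (simp add: coset_0 H_ops(2))
    fix W assume "W \<in> carrier H"
    then obtain w where w: "W = coset w" "w \<in> Z" by (auto simp: H_ops)
    then have "w \<in> carrier ?M" using Zc by auto
    then show "(X \<oplus>\<^bsub>H\<^esub> Y) \<oplus>\<^bsub>H\<^esub> W = X \<oplus>\<^bsub>H\<^esub> (Y \<oplus>\<^bsub>H\<^esub> W)" using xy c w by (simp add: coset_add E.M.a_assoc)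
  next
    show "\<zero>\<^bsub>H\<^esub> \<in> carrier H" using Z_0 coset_0 by (auto simp: H_ops intro!: image_eqI[of _ _ "\<zero>\<^bsub>?M\<^esub>"])
  qed
  then interpret HM: abelian_monoid H .
  have coset_sum: "(\<Oplus>\<^bsub>H\<^esub>f\<in>F. coset (t f)) = coset (\<Oplus>\<^bsub>?M\<^esub>f\<in>F. t f)" "(\<Oplus>\<^bsub>?M\<^esub>f\<in>F. t f) \<in> Z"
    if "finite F" "\<And>f. f \<in> F \<Longrightarrow> t f \<in> Z" for F :: "('j \<Rightarrow> 'k) set" and t
  proof -
    have "(\<Oplus>\<^bsub>H\<^esub>f\<in>F. coset (t f)) = coset (\<Oplus>\<^bsub>?M\<^esub>f\<in>F. t f) \<and> (\<Oplus>\<^bsub>?M\<^esub>f\<in>F. t f) \<in> Z"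
      using that
    proof (induction F rule: finite_induct)
      case empty
      then show ?case by (simp add: coset_0 H_ops(2) Z_0)
    next
      case (insert f F)
      then have IH: "(\<Oplus>\<^bsub>H\<^esub>f\<in>F. coset (t f)) = coset (\<Oplus>\<^bsub>?M\<^esub>f\<in>F. t f)" "(\<Oplus>\<^bsub>?M\<^esub>f\<in>F. t f) \<in> Z" by auto
      have tZ: "t f \<in> Z" "\<And>g. g \<in> F \<Longrightarrow> t g \<in> Z" using insert.prems by auto
      have "(\<Oplus>\<^bsub>H\<^esub>f\<in>insert f F. coset (t f)) = coset (t f) \<oplus>\<^bsub>H\<^esub> (\<Oplus>\<^bsub>H\<^esub>f\<in>F. coset (t f))"
        using insert.hyps tZ by (intro HM.finsum_insert) (auto simp: H_ops)
      moreover have "(\<Oplus>\<^bsub>?M\<^esub>f\<in>insert f F. t f) = t f \<oplus>\<^bsub>?M\<^esub> (\<Oplus>\<^bsub>?M\<^esub>f\<in>F. t f)"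
        using insert.hyps tZ Zc by (intro E.M.finsum_insert) auto
      ultimately show ?case using IH tZ Zc coset_add[of "t f" "\<Oplus>\<^bsub>?M\<^esub>f\<in>F. t f"] Z_closed by auto
    qed
    then show "(\<Oplus>\<^bsub>H\<^esub>f\<in>F. coset (t f)) = coset (\<Oplus>\<^bsub>?M\<^esub>f\<in>F. t f)" "(\<Oplus>\<^bsub>?M\<^esub>f\<in>F. t f) \<in> Z" by auto
  qed

  \<comment> \<open>Bases of the homogeneous components of the quotient\<close>
  have "\<exists>Bs. component_basis H a Bs \<and> card Bs = h a" for a
  proof -
    have subBa: "fvs.subspace (BW \<inter> VJ i a)" using fvs.subspace_inter[OF subB E.subspace_V] .
    have "fvs.rdim (BW \<inter> VJ i a) (ZW \<inter> VJ i a) (h a)" using rd[of a] unfolding cyc bnd .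
    from fvs.rdim_basis[OF this subBa] obtain F where
      F0: "finite F \<and> card F = h a \<and> F \<subseteq> ZW \<inter> VJ i a \<and>
        (\<forall>z\<in>ZW \<inter> VJ i a. \<exists>!c. c \<in> F \<rightarrow>\<^sub>E UNIV \<and> z - (\<Sum>f\<in>F. fscale (c f) f) \<in> BW \<inter> VJ i a)" ..
    then have F: "finite F" "card F = h a" "F \<subseteq> ZW \<inter> VJ i a" by simp_all
    have basis: "\<exists>!c. c \<in> F \<rightarrow>\<^sub>E UNIV \<and> z - (\<Sum>f\<in>F. fscale (c f) f) \<in> BW \<inter> VJ i a"
      if "z \<in> ZW \<inter> VJ i a" for z
      by (rule bspec[OF F0[THEN conjunct2, THEN conjunct2, THEN conjunct2] that])
    define e where "e f = coset (psiJ i f)" for f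
    have FU: "f \<in> UJ i" if "f \<in> F" for f using that F(3) VJ_UJ by blast
    have psi: "psiJ i f \<in> carrier ?M" "\<phi> i (psiJ i f) = f" "psiJ i f \<in> Z" "psiJ i f \<in> component ?M a" if "f \<in> F" for f
    proof -
      show 1: "psiJ i f \<in> carrier ?M" "\<phi> i (psiJ i f) = f" using E.psi_in E.phi_psi FU[OF that] by auto
      show "psiJ i f \<in> Z" using Z_iff[OF 1(1)] 1(2) F(3) that by auto
      show "psiJ i f \<in> component ?M a" using E.psi_V F(3) that by blast
    qed
    have lin: "(\<Sum>f\<in>F. fscale (c f) f) \<in> VJ i a" for c
      using F(3) by (intro fvs.subspace_sum[OF E.subspace_V] fvs.subspace_scale[OF E.subspace_V]) auto
    define dg where "dg v = restrict (\<lambda>g. if g = v then 1 else (0::'k)) F" for v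
    have delta: "(\<Sum>g\<in>F. fscale (dg f g) g) = f" if "f \<in> F" for f
    proof -
      have "(\<Sum>g\<in>F. fscale (dg f g) g) = (\<Sum>g\<in>F. if g = f then g else 0)"
        by (intro sum.cong) (auto simp: dg_def)
      also have "\<dots> = f" using F(1) that by simp
      finally show ?thesis .
    qed
    \<comment> \<open>If f and g had the same coset, both \<open>dg f\<close> and
      \<open>dg g\<close> would represent f modulo boundaries, and coefficients are unique. So
      passing to cosets keeps the cardinality.\<close>
    have inj: "inj_on e F"
    proof (rule inj_onI)
      fix f g assume fg: "f \<in> F" "g \<in> F" "e f = e g"
      have "f - g \<in> BW" using fg coset_eq[OF psi(1) psi(1)] psi(2) by (simp add: e_def)
      moreover have "f - g \<in> VJ i a" "f - f \<in> VJ i a" using fg F(3) fvs.subspace_diff[OF E.subspace_V] by blast+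
      moreover have "f - f \<in> BW" using fvs.subspace_0[OF subB] by simp
      ultimately have "f - g \<in> BW \<inter> VJ i a" "f - f \<in> BW \<inter> VJ i a" by auto
      then have *: "f - (\<Sum>x\<in>F. fscale (dg g x) x) \<in> BW \<inter> VJ i a" "f - (\<Sum>x\<in>F. fscale (dg f x) x) \<in> BW \<inter> VJ i a"
        unfolding delta[OF fg(1)] delta[OF fg(2)] by blast+
      have r: "dg v \<in> F \<rightarrow>\<^sub>E UNIV" for v by (simp add: dg_def)
      have ex: "\<exists>!c. c \<in> F \<rightarrow>\<^sub>E UNIV \<and> f - (\<Sum>x\<in>F. fscale (c x) x) \<in> BW \<inter> VJ i a"
        by (rule basis[OF subsetD[OF F(3) fg(1)]])
      have "dg g = dg f"
        using the1_equality[OF ex, of "dg g"] the1_equality[OF ex, of "dg f"] r * by simp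
      from fun_cong[OF this, of f] have "(if f = g then 1 else (0::'k)) = 1" using fg by (simp add: dg_def)
      then show "f = g" by (metis zero_neq_one)
    qed
    have sum_eq: "(\<Oplus>\<^bsub>H\<^esub>b\<in>e ` F. mon 0 (c b) \<odot>\<^bsub>H\<^esub> b) = coset x \<longleftrightarrow>
        ?\<phi> x - (\<Sum>f\<in>F. fscale (c (e f)) f) \<in> BW \<inter> VJ i a"
      if x: "x \<in> Z \<inter> component ?M a" for c x
    proof -
      have xc: "x \<in> carrier ?M" using x Zc by blast
      have tZ: "mon 0 (c (e f)) \<odot>\<^bsub>?M\<^esub> psiJ i f \<in> Z" if "f \<in> F" for f using Z_closed(2) psi(3) that by blast
      have "(\<Oplus>\<^bsub>H\<^esub>b\<in>e ` F. mon 0 (c b) \<odot>\<^bsub>H\<^esub> b) = (\<Oplus>\<^bsub>H\<^esub>f\<in>F. mon 0 (c (e f)) \<odot>\<^bsub>H\<^esub> e f)"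
        using inj tZ by (intro HM.finsum_reindex) (auto simp: e_def coset_scale psi H_ops(1))
      also have "\<dots> = (\<Oplus>\<^bsub>H\<^esub>f\<in>F. coset (mon 0 (c (e f)) \<odot>\<^bsub>?M\<^esub> psiJ i f))"
        using tZ by (intro HM.add.finprod_cong') (auto simp: e_def coset_scale psi H_ops(1))
      also have "\<dots> = coset (\<Oplus>\<^bsub>?M\<^esub>f\<in>F. mon 0 (c (e f)) \<odot>\<^bsub>?M\<^esub> psiJ i f)"
        by (rule coset_sum(1)[OF F(1)]) (rule tZ)
      finally have eq: "(\<Oplus>\<^bsub>H\<^esub>b\<in>e ` F. mon 0 (c b) \<odot>\<^bsub>H\<^esub> b) = coset (\<Oplus>\<^bsub>?M\<^esub>f\<in>F. mon 0 (c (e f)) \<odot>\<^bsub>?M\<^esub> psiJ i f)" .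
      have sc: "(\<Oplus>\<^bsub>?M\<^esub>f\<in>F. mon 0 (c (e f)) \<odot>\<^bsub>?M\<^esub> psiJ i f) \<in> carrier ?M"
        by (rule subsetD[OF Zc coset_sum(2)[OF F(1)]]) (rule tZ)
      have "?\<phi> (\<Oplus>\<^bsub>?M\<^esub>f\<in>F. mon 0 (c (e f)) \<odot>\<^bsub>?M\<^esub> psiJ i f) = (\<Sum>f\<in>F. ?\<phi> (mon 0 (c (e f)) \<odot>\<^bsub>?M\<^esub> psiJ i f))"
        using F(1) tZ Zc by (intro E.phi_sum) auto
      also have "\<dots> = (\<Sum>f\<in>F. fscale (c (e f)) f)" by (intro sum.cong) (auto simp: E.phi_scale psi)
      finally have ph: "?\<phi> (\<Oplus>\<^bsub>?M\<^esub>f\<in>F. mon 0 (c (e f)) \<odot>\<^bsub>?M\<^esub> psiJ i f) = (\<Sum>f\<in>F. fscale (c (e f)) f)" .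
      have "?\<phi> x \<in> VJ i a" using x by (auto simp: E.V_def)
      then have "?\<phi> x - (\<Sum>f\<in>F. fscale (c (e f)) f) \<in> VJ i a" by (rule fvs.subspace_diff[OF E.subspace_V _ lin])
      then show ?thesis unfolding eq using coset_eq[OF xc sc] ph by auto
    qed
    have "component_basis H a (e ` F)"
      unfolding component_basis_def
    proof (intro conjI ballI)
      show "finite (e ` F)" using F(1) by simp
      show "e ` F \<subseteq> component H a" using psi by (auto simp: e_def H_ops(5))
      fix X assume "X \<in> component H a"
      then obtain x where x: "X = coset x" "x \<in> Z \<inter> component ?M a" by (auto simp: H_ops(5))
      have "?\<phi> x \<in> ZW \<inter> VJ i a" using x Z_iff Zc by (auto simp: E.V_def)
      from basis[OF this] obtain c
        where c: "c \<in> F \<rightarrow>\<^sub>E UNIV \<and> ?\<phi> x - (\<Sum>f\<in>F. fscale (c f) f) \<in> BW \<inter> VJ i a"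
          and uniq: "\<forall>c'. c' \<in> F \<rightarrow>\<^sub>E UNIV \<and> ?\<phi> x - (\<Sum>f\<in>F. fscale (c' f) f) \<in> BW \<inter> VJ i a \<longrightarrow> c' = c"
        by (rule ex1E)
      \<comment> \<open>Coefficients are carried from vectors to cosets along the bijection
        \<open>e\<close>; the restriction keeps them extensional.\<close>
      define c0 where "c0 = restrict (\<lambda>b. c (inv_into F e b)) (e ` F)"
      have c0: "c0 (e f) = c f" if "f \<in> F" for f using that inj by (simp add: c0_def)
      show "\<exists>!c. c \<in> e ` F \<rightarrow>\<^sub>E (UNIV::'k set) \<and> X = (\<Oplus>\<^bsub>H\<^esub>b\<in>e ` F. mon 0 (c b) \<odot>\<^bsub>H\<^esub> b)"
      proof (rule ex1I[of _ c0], intro conjI)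
        show "c0 \<in> e ` F \<rightarrow>\<^sub>E UNIV" by (simp add: c0_def)
        have "(\<Sum>f\<in>F. fscale (c0 (e f)) f) = (\<Sum>f\<in>F. fscale (c f) f)" using c0 by (intro sum.cong) auto
        then show "X = (\<Oplus>\<^bsub>H\<^esub>b\<in>e ` F. mon 0 (c0 b) \<odot>\<^bsub>H\<^esub> b)" using sum_eq[OF x(2), of c0] conjunct2[OF c] x(1) by simp
      next
        fix c' assume c': "c' \<in> e ` F \<rightarrow>\<^sub>E UNIV \<and> X = (\<Oplus>\<^bsub>H\<^esub>b\<in>e ` F. mon 0 (c' b) \<odot>\<^bsub>H\<^esub> b)"
        have "restrict (\<lambda>f. c' (e f)) F = c"
        proof (rule uniq[rule_format], rule conjI)
          have "(\<Sum>f\<in>F. fscale (restrict (\<lambda>f. c' (e f)) F f) f) = (\<Sum>f\<in>F. fscale (c' (e f)) f)" by (intro sum.cong) auto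
          then show "?\<phi> x - (\<Sum>f\<in>F. fscale (restrict (\<lambda>f. c' (e f)) F f) f) \<in> BW \<inter> VJ i a"
            using sum_eq[OF x(2), of c'] c' x(1) by simp
        qed simp
        then have "c' (e f) = c f" if "f \<in> F" for f using that by (metis restrict_apply')
        then have inF: "c' b = c0 b" if "b \<in> e ` F" for b using that c0 by auto
        have outF: "c' b = c0 b" if "b \<notin> e ` F" for b
          using PiE_arb[OF conjunct1[OF c'] that] that by (simp add: c0_def)
        show "c' = c0"
        proof
          fix b show "c' b = c0 b" using inF outF by (cases "b \<in> e ` F") simp_all
        qed
      qed
    qed
    moreover have "card (e ` F) = h a" using card_image[OF inj] F(2) by simp
    ultimately show ?thesis by blast
  qed
  then show ?thesis unfolding H has_hilbert_function_def by blast
qed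

lemma hilbert_series_local_cohomology:
  assumes exact: "\<And>n x. x \<in> carrier (J (Suc n)) \<Longrightarrow> d (Suc n) x = \<zero>\<^bsub>J (Suc (Suc n))\<^esub> \<Longrightarrow> x \<in> d n ` carrier (J n)"
    and fin: "finite S" and y: "\<And>g. g \<in> S \<Longrightarrow> y g \<in> carrier (J 0)"
    and gen: "\<And>x. x \<in> carrier (J 0) \<Longrightarrow> d 0 x = \<zero>\<^bsub>J (Suc 0)\<^esub> \<Longrightarrow>
      \<exists>c\<in>S \<rightarrow> carrier (semigroup_ring Q). \<phi> 0 x = (\<Sum>g\<in>S. \<phi> 0 (c g \<odot>\<^bsub>J 0\<^esub> y g))"
    and gs: "set gs = G"
  shows "\<exists>h. has_hilbert_function (local_cohomology (semigroup_ring Q) (max_monomial_ideal Q) J d i) h \<and>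
    (\<exists>F. finite F \<and> (\<forall>a. h a \<noteq> 0 \<longrightarrow> (\<exists>f\<in>F. f - a \<in> Q))) \<and>
    finite {a. iter_diff gs (\<lambda>a. int (h a)) a \<noteq> 0}"
proof -
  have "C.chain_H (\<le>) n {}" for n using exact fin y gen by (rule noetherian_J)
  from C.hilbert_function_tors[OF CJ_simps(1) this gs, of "Suc i"]
  show ?thesis using hilbert_function_local_cohomology by blast
qed

end

theorem corollary5p5:
  fixes Q :: "(int ^ 'd) set"
    and M :: "('k::field, 'd, 'm) zd_module"
    and J :: "nat \<Rightarrow> ('k, 'd, 'j) zd_module"
    and \<epsilon> :: "'m \<Rightarrow> 'j"
    and d :: "nat \<Rightarrow> 'j \<Rightarrow> 'j"
    and i :: nat
  assumes "infinite (UNIV :: 'k set)"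
    and "affine_semigroup Q"
    and "pointed Q"
    and "graded_module Q M"
    and "finitely_generated (semigroup_ring Q) M"
    and "graded_injective_resolution Q M \<epsilon> J d"
  shows "\<exists>h. has_hilbert_function
               (local_cohomology (semigroup_ring Q) (max_monomial_ideal Q) J d i) h \<and>
             formal_sum_of_rational_functions (\<lambda>a. of_nat (h a))"
proof -
  obtain G0 where G0: "finite G0" "Q = additive_submonoid hull G0"
    using assms(2) unfolding affine_semigroup_def by blast
  \<comment> \<open>The generator 0 is discarded, since no linear form is positive on it.\<close>
  define G where "G = G0 - {0}"
  have finG: "finite G" using G0 by (simp add: G_def)
  have QG: "Q = additive_submonoid hull G"
  proof
    have "0 \<in> additive_submonoid hull G" using submonoid_hull unfolding additive_submonoid_def by blast
    then have "G0 \<subseteq> additive_submonoid hull G" using hull_subset[of G additive_submonoid] by (auto simp: G_def)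
    then show "Q \<subseteq> additive_submonoid hull G" unfolding G0(2) using submonoid_hull by (rule hull_minimal)
    show "additive_submonoid hull G \<subseteq> Q" unfolding G0(2) by (rule hull_mono) (auto simp: G_def)
  qed
  obtain v e where v: "\<And>g. g \<in> G \<Longrightarrow> v \<bullet> real_vec g > 0" and e: "v \<bullet> real_vec e > 0"
  proof (cases "G = {}")
    case True
    \<comment> \<open>Even for Q = {0} a direction of positive value is required for choosing the
      translate of the cone. The index type is nonempty, so the all-ones vector is nonzero.\<close>
    define e :: "int ^ 'd" where "e = (\<chi> j. 1)"
    have "e \<noteq> 0" by (simp add: e_def vec_eq_iff)
    then have "real_vec e \<bullet> real_vec e > 0" by (simp add: real_vec_eq_0_iff)
    then show ?thesis using that True by blast
  next
    case False
    have "0 \<notin> real_vec ` G" using real_vec_eq_0_iff by (force simp: G_def)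
    moreover have "real_vec ` G \<subseteq> real_vec ` Q" unfolding QG by (rule image_mono[OF hull_subset])
    ultimately obtain v where "\<forall>x\<in>real_vec ` G. v \<bullet> x > 0"
      using pointed_functional[of "real_vec ` Q" "real_vec ` G"] assms(3) finG
      unfolding pointed_def real_cone_def by blast
    then show ?thesis using that False by blast
  qed
  define l where "l a = v \<bullet> real_vec a" for a :: "int ^ 'd"
  interpret P: pointed_monoid G l
    unfolding pointed_monoid_def
    by unfold_locales (auto simp: l_def finG real_vec_add inner_simps v)
  have PQ: "P.Q = Q" unfolding P.Q_def QG ..
  note res = assms(6)[unfolded graded_injective_resolution_def]
  have inj: "graded_injective Q (J n)" for n using res by blast
  have "graded_module Q (J n)" for n using inj unfolding graded_injective_def by blast
  from graded_module.embedding_exists[OF this] obtain \<phi> :: "nat \<Rightarrow> 'j \<Rightarrow> 'j \<Rightarrow> 'k"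
    where phi: "\<And>n. inj_on (\<phi> n) (carrier (J n)) \<and>
      (\<forall>x\<in>carrier (J n). \<forall>y\<in>carrier (J n). \<phi> n (x \<oplus>\<^bsub>J n\<^esub> y) = \<phi> n x + \<phi> n y) \<and>
      (\<forall>c. \<forall>x\<in>carrier (J n). \<phi> n (mon 0 c \<odot>\<^bsub>J n\<^esub> x) = fscale c (\<phi> n x))"
    by metis
  have emb: "embedded_module Q (J n) (\<phi> n)" for n
    by (intro embedded_module.intro embedded_module_axioms.intro \<open>\<And>n. graded_module Q (J n)\<close>)
      (use phi[of n] in blast)+
  have ex: "d n ` carrier (J n) = {x \<in> carrier (J (Suc n)). d (Suc n) x = \<zero>\<^bsub>J (Suc (Suc n))\<^esub>}" for n
    using res by blast
  interpret R: embedded_resolution G l J d \<phi>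
  proof (intro embedded_resolution.intro embedded_resolution_axioms.intro P.pointed_monoid_axioms)
    show "d n \<in> graded_hom P.Q (J n) (J (Suc n))" for n using res unfolding PQ by blast
    show "d (Suc n) (d n x) = \<zero>\<^bsub>J (Suc (Suc n))\<^esub>" if "x \<in> carrier (J n)" for n x
      using ex[of n] that by blast
  qed (use emb inj PQ in auto)
  interpret M: graded_module Q M by (rule assms(4))
  interpret J0: embedded_module Q "J 0" "\<phi> 0" by (rule emb)
  obtain S where S: "finite S" "S \<subseteq> carrier M"
    and gen: "\<And>x. x \<in> carrier M \<Longrightarrow> \<exists>c\<in>S \<rightarrow> carrier (semigroup_ring Q). x = (\<Oplus>\<^bsub>M\<^esub>g\<in>S. c g \<odot>\<^bsub>M\<^esub> g)"
    using assms(5) unfolding finitely_generated_def by blast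
  have eps: "\<epsilon> \<in> graded_hom Q M (J 0)" using res by blast
  have eps_in: "x \<in> carrier M \<Longrightarrow> \<epsilon> x \<in> carrier (J 0)"
    and eps_add: "x \<in> carrier M \<Longrightarrow> y \<in> carrier M \<Longrightarrow> \<epsilon> (x \<oplus>\<^bsub>M\<^esub> y) = \<epsilon> x \<oplus>\<^bsub>J 0\<^esub> \<epsilon> y"
    and eps_smult: "r \<in> carrier (semigroup_ring Q) \<Longrightarrow> x \<in> carrier M \<Longrightarrow> \<epsilon> (r \<odot>\<^bsub>M\<^esub> x) = r \<odot>\<^bsub>J 0\<^esub> \<epsilon> x" for x y r
    using eps unfolding graded_hom_def by blast+
  have eps_sum: "\<phi> 0 (\<epsilon> (\<Oplus>\<^bsub>M\<^esub>g\<in>A. t g)) = (\<Sum>g\<in>A. \<phi> 0 (\<epsilon> (t g)))"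
    if "finite A" "\<And>g. g \<in> A \<Longrightarrow> t g \<in> carrier M" for A :: "'m set" and t
    using that
  proof (induction A rule: finite_induct)
    case empty
    have "\<phi> 0 (\<epsilon> \<zero>\<^bsub>M\<^esub>) = \<phi> 0 (\<epsilon> \<zero>\<^bsub>M\<^esub>) + \<phi> 0 (\<epsilon> \<zero>\<^bsub>M\<^esub>)"
      using eps_add[of "\<zero>\<^bsub>M\<^esub>" "\<zero>\<^bsub>M\<^esub>"] J0.phi_add[OF eps_in eps_in, of "\<zero>\<^bsub>M\<^esub>" "\<zero>\<^bsub>M\<^esub>"] by simp
    then show ?case by simp
  next
    case (insert g A)
    then have sum: "(\<Oplus>\<^bsub>M\<^esub>g\<in>insert g A. t g) = t g \<oplus>\<^bsub>M\<^esub> (\<Oplus>\<^bsub>M\<^esub>g\<in>A. t g)" "(\<Oplus>\<^bsub>M\<^esub>g\<in>A. t g) \<in> carrier M" "t g \<in> carrier M"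
      by (auto intro!: M.M.finsum_insert M.M.finsum_closed)
    have "\<phi> 0 (\<epsilon> (\<Oplus>\<^bsub>M\<^esub>g\<in>insert g A. t g)) = \<phi> 0 (\<epsilon> (t g)) + \<phi> 0 (\<epsilon> (\<Oplus>\<^bsub>M\<^esub>g\<in>A. t g))"
      unfolding sum(1) eps_add[OF sum(3,2)] by (rule J0.phi_add[OF eps_in[OF sum(3)] eps_in[OF sum(2)]])
    then show ?case using insert by simp
  qed
  obtain gs where gs: "set gs = G" using finite_list[OF finG] by blast
  have "\<exists>h. has_hilbert_function (local_cohomology (semigroup_ring P.Q) (max_monomial_ideal P.Q) J d i) h \<and>
    (\<exists>F. finite F \<and> (\<forall>a. h a \<noteq> 0 \<longrightarrow> (\<exists>f\<in>F. f - a \<in> P.Q))) \<and>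
    finite {a. iter_diff gs (\<lambda>a. int (h a)) a \<noteq> 0}"
  \<comment> \<open>The images of the generators of \<open>M\<close> under the augmentation generate
    the kernel of \<open>d 0\<close>.\<close>
  proof (rule R.hilbert_series_local_cohomology[OF _ S(1) _ _ gs, of \<epsilon>])
    show "x \<in> d n ` carrier (J n)" if "x \<in> carrier (J (Suc n))" "d (Suc n) x = \<zero>\<^bsub>J (Suc (Suc n))\<^esub>" for n x
      using ex[of n] that by blast
    show "\<epsilon> g \<in> carrier (J 0)" if "g \<in> S" for g using eps_in S(2) that by blast
    fix x assume "x \<in> carrier (J 0)" "d 0 x = \<zero>\<^bsub>J (Suc 0)\<^esub>"
    moreover have "\<epsilon> ` carrier M = {x \<in> carrier (J 0). d 0 x = \<zero>\<^bsub>J (Suc 0)\<^esub>}" using res by simp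
    ultimately obtain m where m: "m \<in> carrier M" "x = \<epsilon> m" by blast
    obtain c where c: "c \<in> S \<rightarrow> carrier (semigroup_ring Q)" "m = (\<Oplus>\<^bsub>M\<^esub>g\<in>S. c g \<odot>\<^bsub>M\<^esub> g)"
      using gen[OF m(1)] by blast
    have cg: "c g \<odot>\<^bsub>M\<^esub> g \<in> carrier M" "\<epsilon> (c g \<odot>\<^bsub>M\<^esub> g) = c g \<odot>\<^bsub>J 0\<^esub> \<epsilon> g" if "g \<in> S" for g
      using that c(1) S(2) by (auto intro!: M.smult_closed eps_smult)
    have "\<phi> 0 x = (\<Sum>g\<in>S. \<phi> 0 (c g \<odot>\<^bsub>J 0\<^esub> \<epsilon> g))"
      unfolding m(2) c(2) using eps_sum[OF S(1), of "\<lambda>g. c g \<odot>\<^bsub>M\<^esub> g"] cg by simp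
    then show "\<exists>c\<in>S \<rightarrow> carrier (semigroup_ring P.Q). \<phi> 0 x = (\<Sum>g\<in>S. \<phi> 0 (c g \<odot>\<^bsub>J 0\<^esub> \<epsilon> g))"
      using c(1) unfolding PQ by blast
  qed
  then obtain h F where h: "has_hilbert_function (local_cohomology (semigroup_ring Q) (max_monomial_ideal Q) J d i) h"
    "finite F" "\<And>a. h a \<noteq> 0 \<Longrightarrow> \<exists>f\<in>F. f - a \<in> Q" "finite {a. iter_diff gs (\<lambda>a. int (h a)) a \<noteq> 0}"
    unfolding PQ by blast
  have "formal_sum_of_rational_functions (\<lambda>a. of_nat (h a))"
    by (rule rational_series[OF _ e h(4,2)]) (use v gs h(3) QG in auto)
  then show ?thesis using h(1) by blast
qed

end
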